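(* For all $w \in W$, the set $\mathscr{L}(D(w))$ coincides with the set of reduced skew pipe dreams $D \in \mathcal{SPD}_n$ such that $w_D = w$.
   Context: **Weyl group.** Fix an integer $n \ge 2$, put $[n]=\{1,\dots,n\}$, $\tilde I=\{\pm i \mid i\in[n]\}$, $N = n^2$. $W$ is the group of signed permutations, i.e. permutations $\sigma$ of $\tilde I$ with $\sigma(-i)=-\sigma(i)$ for all $i$ (product is composition, right factor applied first; identity $e$). It is generated by $s_1=(1\ \ {-1})$ and $s_k=(k-1\ \ k)(-(k-1)\ \ {-k})$ for $2\le k\le n$. $\ell(w)$ is the minimal length of an expression of $w$ as a product of the $s_i$; $R(w)$ is the set of reduced words $(i_1,\dots,i_r)$ for $w$ (so $w=s_{i_1}\cdots s_{i_r}$, $r=\ell(w)$). $w_0\in W$, $w_0(i)=-i$, is the longest element; $\ell(w_0)=N$. **Skew pipe dreams and $D(w)$.** $SY_n=\{(i,j)\in\mathbb{Z}^2\mid 1\le i\le n,\ i\le j\le 2n-i\}$ (boxes; $i$ = row counted from the top, $j$ = column counted from the left). $\mathcal{SPD}_n$ is the power set of $SY_n$; its elements are called skew pipe dreams. The boxes of $SY_n$ are listed as $(p_1,q_1),\dots,(p_N,q_N)$ by going through the rows from row $n$ up to row $1$, each row from right to left: $(n,n),(n-1,n+1),(n-1,n),(n-1,n-1),\dots,(1,2n-1),\dots,(1,2),(1,1)$. Let ${\bm i}_C=(i_1,\dots,i_N)=(1,\,2,1,2,\,3,2,1,2,3,\,\dots,\,n,n-1,\dots,1,\dots,n-1,n)\in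 R(w_0)$. For $w\in W$, let ${\bm k}_w=(k_1<\dots<k_{\ell(w)})$ be the lexicographically smallest sequence in $[N]^{\ell(w)}$, strictly increasing, with $(i_{k_1},\dots,i_{k_{\ell(w)}})\in R(w)$ (empty if $w=e$). Set $D(w)=SY_n\setminus\{(p_k,q_k)\mid k\text{ an entry of }{\bm k}_w\}$; in particular $D(e)=SY_n$. **Ladder moves.** Let $D\in\mathcal{SPD}_n$ and $(i,j)=(p_k,q_k)\in SY_n$. The ladder move $L_{i,j}(D)$ is defined if $(i,j)\in D$, $(i,j+1)\notin D$, and there is $k+1\le \ell\le N$ with $q_\ell\in\{j,2n-j\}$ such that $(p_\ell,q_\ell),(p_\ell,q_\ell+1)\in SY_n\setminus D$ and $(p_r,q_r),(p_r,q_r+1)\in D$ for all $k+1\le r\le \ell-1$ with $q_r\in\{j,2n-j\}$. Then $L_{i,j}(D)=D\cup\{(p_\ell,q_\ell+1)\}\setminus\{(i,j)\}$. $\mathscr{L}(D(w))$ is the set of skew pipe dreams obtained from $D(w)$ by (possibly empty) sequences of ladder moves. **Path model, $w_D$, reducedness.** Let $\widetilde{SY}_n=\{(i,j)\mid 1\le j\le n,\ 1\le i\le 2j-1\}$ (row $i$ from the top, column $j$ from the left). For $D\in\mathcal{SPD}_n$ let $\Omega(D)\subseteq\widetilde{SY}_n$ be given by: $(2k-1,j)\in\Omega(D)$ iff $(k,j)\in D$ (for $k\le j\le n$), and $(2k,j)\in\Omega(D)$ iff $(k,2n+1-j)\in D$ (for $k+1\le j\le n$). Let $\widetilde{SY}_n^{\rm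 (ex)}=\widetilde{SY}_n\sqcup\{(2k,k)\mid 1\le k\le n\}\sqcup\{(k,n+1)\mid 1\le k\le 2n\}$. The diagram $\mathscr{G}(D)$ is obtained by filling each box $(i,j)$ of $\widetilde{SY}_n^{\rm (ex)}$ with a tile: a crossing (joining left edge to right edge and top edge to bottom edge) if $(i,j)\in\Omega(D)$; if $(i,j)\notin\Omega(D)$, an elbow joint (joining left to top and right to bottom) when $j\le n$ with $i$ odd or $j=n+1$ with $i$ even, and a reversed elbow joint (joining left to bottom and top to right) when $j\le n$ with $i$ even or $j=n+1$ with $i$ odd. Pipes are the resulting curves. For $1\le k\le n$, $\ell_k$ is the pipe with an end at the left end of row $2k-1$ of $\widetilde{SY}_n^{\rm (ex)}$. There is a unique permutation $v_D$ of $[n]$ such that the other end of $\ell_k$ is at the top of column $n+1-v_D(k)$; write $L_{v_D(k)}=\ell_k$. Let ${\rm sign}(L_j)$ be the number of self-crossings of $L_j$ (crossing tiles both of whose strands belong to $L_j$). Define $w_D\in W$ by $w_D(j)=(-1)^{{\rm sign}(L_j)+1}v_D^{-1}(j)$ and $w_D(-j)=-w_D(j)$ for $j\in[n]$. $D$ is called reduced if $|D|=\ell(w_0)-\ell(w_D)$.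
   Formalization: The pipe ℓ_k is taken to start at the left end of row 2k−1 counted from the bottom (row 2(n+1−k)−1 from the top); with rows counted from the top, D = SY_n gives w_D(j) = n+1−j ≠ e and the claim fails. *)

theory Defs
  imports "HOL-Combinatorics.Permutations" "HOL-Library.List_Lexorder"
begin

section \<open>Signed permutations\<close>

definition signed_idx :: "nat \<Rightarrow> int set" where
  "signed_idx n = {- int n..int n} - {0}"

text \<open>Permutations of \<^term>\<open>signed_idx n\<close> are functions on \<^typ>\<open>int\<close> that are the identity
  outside \<^term>\<open>signed_idx n\<close> (this is part of \<^const>\<open>permutes\<close>), so that equality of elements of
  the group is equality of functions.\<close>

definition weyl_group :: "nat \<Rightarrow> (int \<Rightarrow> int) set" where
  "weyl_group n = {\<sigma>. \<sigma> permutes signed_idx n \<and> (\<forall>i\<in>signed_idx n. \<sigma> (- i) = - \<sigma> i)}"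

definition simple_refl :: "nat \<Rightarrow> int \<Rightarrow> int" where
  "simple_refl k =
     (if k = 1 then transpose 1 (- 1)
      else transpose (int k - 1) (int k) \<circ> transpose (- (int k - 1)) (- int k))"

definition word_prod :: "nat list \<Rightarrow> int \<Rightarrow> int" where
  "word_prod ks = foldr (\<lambda>k \<sigma>. simple_refl k \<circ> \<sigma>) ks id"

definition weyl_length :: "nat \<Rightarrow> (int \<Rightarrow> int) \<Rightarrow> nat" where
  "weyl_length n w = (LEAST r. \<exists>ks. length ks = r \<and> set ks \<subseteq> {1..n} \<and> word_prod ks = w)"

definition reduced_words :: "nat \<Rightarrow> (int \<Rightarrow> int) \<Rightarrow> nat list set" where
  "reduced_words n w =
     {ks. set ks \<subseteq> {1..n} \<and> word_prod ks = w \<and> length ks = weyl_length n w}"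

definition longest_elt :: "nat \<Rightarrow> int \<Rightarrow> int" where
  "longest_elt n i = (if i \<in> signed_idx n then - i else i)"


section \<open>Skew pipe dreams\<close>

text \<open>Boxes are pairs (row, column); rows are counted from the top, columns from the left. All
  subtractions on \<^typ>\<open>nat\<close> below are applied in ranges where they do not truncate.\<close>

type_synonym box = "nat \<times> nat"

definition SY :: "nat \<Rightarrow> box set" where
  "SY n = {(i, j). 1 \<le> i \<and> i \<le> n \<and> i \<le> j \<and> j \<le> 2 * n - i}"

definition SPD :: "nat \<Rightarrow> box set set" where
  "SPD n = Pow (SY n)"

definition box_list :: "nat \<Rightarrow> box list" where
  "box_list n = concat (map (\<lambda>p. map (\<lambda>q. (p, q)) (rev [p..<Suc (2 * n - p)])) (rev [1..<Suc n]))"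

text \<open>The \<open>k\<close>-th box \<open>(p\<^sub>k, q\<^sub>k)\<close>, for \<open>k\<close> in \<^term>\<open>{1..n\<^sup>2}\<close>.\<close>

definition nth_box :: "nat \<Rightarrow> nat \<Rightarrow> box" where
  "nth_box n k = box_list n ! (k - 1)"

abbreviation box_row :: "nat \<Rightarrow> nat \<Rightarrow> nat" where
  "box_row n k \<equiv> fst (nth_box n k)"

abbreviation box_col :: "nat \<Rightarrow> nat \<Rightarrow> nat" where
  "box_col n k \<equiv> snd (nth_box n k)"

text \<open>The word \<open>(1, 2,1,2, 3,2,1,2,3, \<dots>, n,\<dots>,1,\<dots>,n)\<close>.\<close>

definition word_C :: "nat \<Rightarrow> nat list" where
  "word_C n = concat (map (\<lambda>m. rev [2..<Suc m] @ [1..<Suc m]) [1..<Suc n])"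

text \<open>The order on \<^typ>\<open>nat list\<close> used by \<^const>\<open>Least\<close> is the lexicographic one of
  \<^theory>\<open>HOL-Library.List_Lexorder\<close>. Entries of the sequence are positions counted from 1.\<close>

definition lex_min_positions :: "nat \<Rightarrow> (int \<Rightarrow> int) \<Rightarrow> nat list" where
  "lex_min_positions n w =
     (LEAST ks. length ks = weyl_length n w \<and> set ks \<subseteq> {1..n\<^sup>2} \<and> sorted_wrt (<) ks \<and>
        map (\<lambda>k. word_C n ! (k - 1)) ks \<in> reduced_words n w)"

definition dream_of :: "nat \<Rightarrow> (int \<Rightarrow> int) \<Rightarrow> box set" where
  "dream_of n w = SY n - {nth_box n k | k. k \<in> set (lex_min_positions n w)}"


section \<open>Ladder moves\<close>

text \<open>\<open>ladder_move n (i, j) D E\<close>: the ladder move at \<open>(i, j)\<close> is defined on \<open>D\<close>, with result \<open>E\<close>.\<close>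

definition ladder_move :: "nat \<Rightarrow> box \<Rightarrow> box set \<Rightarrow> box set \<Rightarrow> bool" where
  "ladder_move n x D E \<longleftrightarrow>
     (\<exists>i j k l. x = (i, j) \<and> k \<in> {1..n\<^sup>2} \<and> nth_box n k = (i, j) \<and>
        (i, j) \<in> D \<and> (i, j + 1) \<notin> D \<and>
        k + 1 \<le> l \<and> l \<le> n\<^sup>2 \<and> box_col n l \<in> {j, 2 * n - j} \<and>
        {(box_row n l, box_col n l), (box_row n l, box_col n l + 1)} \<subseteq> SY n - D \<and>
        (\<forall>r. k + 1 \<le> r \<and> r \<le> l - 1 \<and> box_col n r \<in> {j, 2 * n - j} \<longrightarrow>
           (box_row n r, box_col n r) \<in> D \<and> (box_row n r, box_col n r + 1) \<in> D) \<and>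
        E = (D \<union> {(box_row n l, box_col n l + 1)}) - {(i, j)})"

definition ladder_closure :: "nat \<Rightarrow> box set \<Rightarrow> box set set" where
  "ladder_closure n D = {E. (\<lambda>A B. \<exists>x\<in>SY n. ladder_move n x A B)\<^sup>*\<^sup>* D E}"


section \<open>The path model\<close>

definition crossings :: "nat \<Rightarrow> box set \<Rightarrow> box set" where
  "crossings n D =
     {(2 * k - 1, j) | k j. 1 \<le> k \<and> k \<le> j \<and> j \<le> n \<and> (k, j) \<in> D} \<union>
     {(2 * k, j) | k j. 1 \<le> k \<and> k + 1 \<le> j \<and> j \<le> n \<and> (k, 2 * n + 1 - j) \<in> D}"

definition SY_tilde :: "nat \<Rightarrow> box set" where
  "SY_tilde n = {(i, j). 1 \<le> j \<and> j \<le> n \<and> 1 \<le> i \<and> i \<le> 2 * j - 1}"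

definition SY_ext :: "nat \<Rightarrow> box set" where
  "SY_ext n = SY_tilde n \<union> {(2 * k, k) | k. 1 \<le> k \<and> k \<le> n} \<union> {(k, n + 1) | k. 1 \<le> k \<and> k \<le> 2 * n}"

text \<open>\<open>VEdge i j\<close> and \<open>HEdge i j\<close> are the left and the top edge of the box \<open>(i, j)\<close>; neighbouring
  boxes share an edge.\<close>

datatype edge = VEdge nat nat | HEdge nat nat

fun left_edge right_edge top_edge bottom_edge :: "box \<Rightarrow> edge" where
  "left_edge (i, j) = VEdge i j"
| "right_edge (i, j) = VEdge i (j + 1)"
| "top_edge (i, j) = HEdge i j"
| "bottom_edge (i, j) = HEdge (i + 1) j"

text \<open>A tile is given by its two strands, a strand by the two edges that it joins.\<close>

definition crossing_tile :: "box \<Rightarrow> edge set set" where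
  "crossing_tile x = {{left_edge x, right_edge x}, {top_edge x, bottom_edge x}}"

definition elbow_tile :: "box \<Rightarrow> edge set set" where
  "elbow_tile x = {{left_edge x, top_edge x}, {right_edge x, bottom_edge x}}"

definition reversed_elbow_tile :: "box \<Rightarrow> edge set set" where
  "reversed_elbow_tile x = {{left_edge x, bottom_edge x}, {top_edge x, right_edge x}}"

definition tile :: "nat \<Rightarrow> box set \<Rightarrow> box \<Rightarrow> edge set set" where
  "tile n D x =
     (let (i, j) = x in
      if x \<in> crossings n D then crossing_tile x
      else if j \<le> n \<and> odd i \<or> j = n + 1 \<and> even i then elbow_tile x
      else reversed_elbow_tile x)"

text \<open>A pipe is represented by the set of edges that it passes through.\<close>

definition pipe_through :: "nat \<Rightarrow> box set \<Rightarrow> edge \<Rightarrow> edge set" where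
  "pipe_through n D a = {b. (\<lambda>a b. \<exists>x\<in>SY_ext n. {a, b} \<in> tile n D x)\<^sup>*\<^sup>* a b}"

text \<open>The left ends of the odd rows of \<^term>\<open>SY_ext n\<close> are numbered from the bottom: the pipe
  \<open>\<ell>\<^sub>k\<close> starts in the row that is number \<open>2k - 1\<close> from the bottom of \<^term>\<open>SY_tilde n\<close>, that is,
  in row \<open>2(n + 1 - k) - 1\<close> from the top, whose first box is in column \<open>n + 1 - k\<close>. In this way
  the pipes of \<^term>\<open>SY n\<close> (crossings only) give the identity. Numbering these rows from the top
  would replace \<open>w\<^sub>D(j)\<close> by \<open>\<plusminus>(n + 1 - \<bar>w\<^sub>D(j)\<bar>)\<close> with the same sign, so that \<^term>\<open>SY n\<close> would not
  be a reduced skew pipe dream for the identity.\<close>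

definition start_pipe :: "nat \<Rightarrow> box set \<Rightarrow> nat \<Rightarrow> edge set" where
  "start_pipe n D k = pipe_through n D (left_edge (2 * (n + 1 - k) - 1, n + 1 - k))"

definition end_perm :: "nat \<Rightarrow> box set \<Rightarrow> nat \<Rightarrow> nat" where
  "end_perm n D =
     (THE v. v permutes {1..n} \<and> (\<forall>k\<in>{1..n}. top_edge (1, n + 1 - v k) \<in> start_pipe n D k))"

definition end_pipe :: "nat \<Rightarrow> box set \<Rightarrow> nat \<Rightarrow> edge set" where
  "end_pipe n D j = start_pipe n D (inv (end_perm n D) j)"

definition self_crossings :: "nat \<Rightarrow> box set \<Rightarrow> edge set \<Rightarrow> nat" where
  "self_crossings n D P = card {x \<in> crossings n D. \<forall>s\<in>tile n D x. s \<subseteq> P}"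

definition dream_elt_pos :: "nat \<Rightarrow> box set \<Rightarrow> nat \<Rightarrow> int" where
  "dream_elt_pos n D j =
     (- 1) ^ (self_crossings n D (end_pipe n D j) + 1) * int (inv (end_perm n D) j)"

definition dream_elt :: "nat \<Rightarrow> box set \<Rightarrow> int \<Rightarrow> int" where
  "dream_elt n D x =
     (if x \<notin> signed_idx n then x
      else if 0 < x then dream_elt_pos n D (nat x)
      else - dream_elt_pos n D (nat (- x)))"

definition reduced_dream :: "nat \<Rightarrow> box set \<Rightarrow> bool" where
  "reduced_dream n D \<longleftrightarrow>
     int (card D) = int (weyl_length n (longest_elt n)) - int (weyl_length n (dream_elt n D))"

end

theory Submission
  imports Defs
begin

text \<open>Labelling the pipes by signed numbers, with a change of sign at each U-turn in column \<open>n + 1\<close>,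
  makes \<open>w\<^sub>D\<close> readable off the top edges, because a pipe crosses itself in a double row exactly if it
  takes the U-turn there. The crossings between the two ends of a ladder are passed straight by two
  vertical strands (or by one strand, in column \<open>n\<close>), so that the tiles at the two ends have the same effect, namely
  to exchange these strands (to change the sign): ladder moves do not change \<open>w\<^sub>D\<close>, and crossings
  at both ends may be deleted together.
  Hence every \<open>D\<close> can be reduced by inverse ladder moves and deletions of pairs to a left-justified
  diagram with the same \<open>w\<^sub>D\<close>. The complement of a left-justified diagram takes a prefix of each of
  the blocks \<open>m, \<dots>, 1, \<dots>, m\<close>, i.e. the unique factorization of an element into minimal
  coset representatives; it is a reduced word of \<open>w\<^sub>D\<close> and lexicographically smallest,
  so that the diagram is \<open>D(w\<^sub>D)\<close>. If \<open>D\<close> is reduced, counting boxes excludes deletions.\<close>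

section \<open>Signed labellings\<close>

text \<open>A pipe is defined by reachability, which gives little hold on it when a tile is
  switched. The rules for labels, in contrast, are local and linear: a labelling with given start
  labels exists and is unique, so two diagrams have the same element as soon as some labellings of
  them agree on the top edges. For every switch of tiles it is then enough to write down a modified
  labelling. Strands and loops outside the pipes \<open>\<ell>\<^sub>k\<close> get the label 0, so
  that the absolute value of a label tells which pipe passes through an edge. Signs must also be
  tied to self-crossings, which are scattered over the diagram; this is done one double row at a
  time, because a sign can only change at the right end of such a row. That a left-justified diagram
  is determined by its element comes from D(w) itself: the minimal positions depend on w alone, and
  the diagram is the complement of their boxes.\<close>

definition inflow :: "nat \<Rightarrow> nat \<Rightarrow> nat" where
  "inflow r c = (if odd r then c else c + 1)"

definition outflow :: "nat \<Rightarrow> nat \<Rightarrow> nat" where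
  "outflow r c = (if odd r then c + 1 else c)"

text \<open>Odd rows are traversed from left to right and even rows, after the U-turn, from right to
  left. In these terms elbows in odd rows and reversed elbows in even rows obey one rule: the
  entering strand turns up, and the strand from below leaves along the row.\<close>

definition tile_ok :: "box set \<Rightarrow> (nat \<Rightarrow> nat \<Rightarrow> int) \<Rightarrow> (nat \<Rightarrow> nat \<Rightarrow> int) \<Rightarrow> nat \<Rightarrow> nat \<Rightarrow> bool" where
  "tile_ok C H V r c \<longleftrightarrow>
     (if (r, c) \<in> C then V r (outflow r c) = V r (inflow r c) \<and> H r c = H (r + 1) c
      else H r c = V r (inflow r c) \<and> V r (outflow r c) = H (r + 1) c)"

text \<open>\<open>H r c\<close> and \<open>V r c\<close> are the labels of \<^term>\<open>HEdge r c\<close> and \<^term>\<open>VEdge r c\<close>. The strand through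
  the left and bottom edges of box \<open>(2k, k)\<close> belongs to no pipe; it gets the label 0 to make labellings unique.\<close>

definition labelling ::
  "nat \<Rightarrow> box set \<Rightarrow> (nat \<Rightarrow> int) \<Rightarrow> (nat \<Rightarrow> nat \<Rightarrow> int) \<Rightarrow> (nat \<Rightarrow> nat \<Rightarrow> int) \<Rightarrow> bool" where
  "labelling n C s H V \<longleftrightarrow>
     (\<forall>c\<in>{1..n}. \<forall>r\<in>{1..2 * c}. tile_ok C H V r c) \<and>
     (\<forall>k\<in>{1..n}. V (2 * k - 1) k = s k \<and> H (2 * k + 1) k = 0 \<and>
        V (2 * k) (n + 1) = - V (2 * k - 1) (n + 1))"

lemma labelling_tile:
  "labelling n C s H V \<Longrightarrow> 1 \<le> c \<Longrightarrow> c \<le> n \<Longrightarrow> 1 \<le> r \<Longrightarrow> r \<le> 2 * c \<Longrightarrow> tile_ok C H V r c"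
  unfolding labelling_def by auto

lemma labelling_odd:
  assumes "labelling n C s H V" "1 \<le> k" "k \<le> c" "c \<le> n"
  shows "if (2 * k - 1, c) \<in> C then V (2 * k - 1) (c + 1) = V (2 * k - 1) c \<and> H (2 * k - 1) c = H (2 * k) c
         else H (2 * k - 1) c = V (2 * k - 1) c \<and> V (2 * k - 1) (c + 1) = H (2 * k) c"
proof -
  have "odd (2 * k - 1)" "2 * k - 1 + 1 = 2 * k" using assms by auto
  moreover have "tile_ok C H V (2 * k - 1) c"
    using assms by (intro labelling_tile) auto
  ultimately show ?thesis
    unfolding tile_ok_def inflow_def outflow_def
    by (simp only: if_True if_False not_True_eq_False not_False_eq_True)
qed

lemma labelling_even:
  assumes "labelling n C s H V" "1 \<le> k" "k \<le> c" "c \<le> n"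
  shows "if (2 * k, c) \<in> C then V (2 * k) c = V (2 * k) (c + 1) \<and> H (2 * k) c = H (2 * k + 1) c
         else H (2 * k) c = V (2 * k) (c + 1) \<and> V (2 * k) c = H (2 * k + 1) c"
proof -
  have "tile_ok C H V (2 * k) c"
    using assms by (intro labelling_tile) auto
  then show ?thesis
    unfolding tile_ok_def inflow_def outflow_def by (auto split: if_splits)
qed

lemma labelling_ends:
  assumes "labelling n C s H V" "1 \<le> k" "k \<le> n"
  shows "V (2 * k - 1) k = s k" "H (2 * k + 1) k = 0" "V (2 * k) (n + 1) = - V (2 * k - 1) (n + 1)"
  using assms unfolding labelling_def by auto

section \<open>Uniqueness of labellings\<close>

lemma row_parity:
  fixes r :: nat
  assumes "1 \<le> r"
  obtains k where "1 \<le> k" "r = 2 * k - 1" | k where "1 \<le> k" "r = 2 * k"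
proof (cases "even r")
  case True then show ?thesis using assms that(2) by (auto elim!: evenE)
next
  case False
  then obtain j where "r = 2 * j + 1" by (auto elim: oddE)
  then show ?thesis using that(1)[of "j + 1"] by simp
qed

text \<open>The only possible source of a nonzero label is the U-turn. If it feeds
  \<open>\<rho>\<close> into the even row, then every label of the double row is 0 or
  \<open>\<rho>\<close>; this holds in particular for the last label of the odd row, which is
  \<open>- \<rho>\<close>. Hence \<open>\<rho>\<close> is 0.\<close>

lemma labelling_zero_row:
  assumes L: "labelling n C (\<lambda>_. 0) H V" and k: "1 \<le> k" "k \<le> n"
    and below: "\<And>c. c \<in> {k..n} \<Longrightarrow> H (2 * k + 1) c = 0"
  shows "(\<forall>c\<in>{k..n}. H (2 * k) c = 0 \<and> H (2 * k - 1) c = 0) \<and>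
         (\<forall>c\<in>{k..n+1}. V (2 * k) c = 0 \<and> V (2 * k - 1) c = 0)"
proof -
  define \<rho> where "\<rho> = V (2 * k) (n + 1)"
  have V2: "V (2 * k) c \<in> {0, \<rho>}" if "k \<le> c" "c \<le> n + 1" for c
    using that(2,1)
  proof (induction c rule: inc_induct)
    case base then show ?case by (simp add: \<rho>_def)
  next
    case (step m)
    then show ?case using labelling_even[OF L k(1), of m] below[of m] by (auto split: if_splits)
  qed
  have H2: "H (2 * k) c \<in> {0, \<rho>}" if "k \<le> c" "c \<le> n" for c
    using labelling_even[OF L k(1), of c] below[of c] that V2[of "c + 1"] by (auto split: if_splits)
  have V1: "V (2 * k - 1) c \<in> {0, \<rho>}" if "k \<le> c" "c \<le> n + 1" for c
    using that
  proof (induction c rule: dec_induct)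
    case base then show ?case using labelling_ends[OF L k] by simp
  next
    case (step m)
    then show ?case using labelling_odd[OF L k(1), of m] H2[of m] by (auto split: if_splits)
  qed
  have H1: "H (2 * k - 1) c \<in> {0, \<rho>}" if "k \<le> c" "c \<le> n" for c
    using labelling_odd[OF L k(1), of c] that V1[of c] H2[of c] by (auto split: if_splits)
  have "\<rho> = 0"
    using V1[of "n + 1"] k labelling_ends(3)[OF L k] by (auto simp: \<rho>_def)
  then show ?thesis using V1 V2 H1 H2 by auto
qed

lemma labelling_zero_rows:
  assumes L: "labelling n C (\<lambda>_. 0) H V" and k: "1 \<le> k" "k \<le> n"
  shows "(\<forall>c\<in>{k..n}. H (2 * k + 1) c = 0 \<and> H (2 * k) c = 0 \<and> H (2 * k - 1) c = 0) \<and>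
         (\<forall>c\<in>{k..n+1}. V (2 * k) c = 0 \<and> V (2 * k - 1) c = 0)"
  using k(2,1)
proof (induction k rule: inc_induct)
  case base
  then show ?case using labelling_zero_row[OF L base order.refl] labelling_ends(2)[OF L base] by auto
next
  case (step m)
  have m: "1 \<le> m" "m \<le> n" using step by auto
  have "H (2 * m + 1) c = 0" if "c \<in> {m..n}" for c
    using that step labelling_ends(2)[OF L m] by (cases "c = m") auto
  then show ?case using labelling_zero_row[OF L m] by auto
qed

lemma labelling_diff:
  assumes "labelling n C s H V" "labelling n C s' H' V'"
  shows "labelling n C (\<lambda>k. s k - s' k) (\<lambda>r c. H r c - H' r c) (\<lambda>r c. V r c - V' r c)"
  using assms unfolding labelling_def tile_ok_def
  by (intro conjI ballI) (simp_all split: if_splits)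

text \<open>The rules are linear, so the difference of two labellings with equal start labels is a
  labelling with start labels 0.\<close>

lemma labelling_unique:
  assumes "labelling n C s H V" "labelling n C s H' V'"
  shows "1 \<le> c \<Longrightarrow> c \<le> n \<Longrightarrow> 1 \<le> r \<Longrightarrow> r \<le> 2 * c + 1 \<Longrightarrow> H r c = H' r c"
    and "1 \<le> c \<Longrightarrow> c \<le> n + 1 \<Longrightarrow> 1 \<le> r \<Longrightarrow> r \<le> 2 * c \<Longrightarrow> r \<le> 2 * n \<Longrightarrow> V r c = V' r c"
proof -
  have L: "labelling n C (\<lambda>_. 0) (\<lambda>r c. H r c - H' r c) (\<lambda>r c. V r c - V' r c)"
    using labelling_diff[OF assms] by simp
  show "H r c = H' r c" if "1 \<le> c" "c \<le> n" "1 \<le> r" "r \<le> 2 * c + 1"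
  proof (cases "r = 2 * c + 1")
    case True
    then show ?thesis using labelling_ends(2)[OF L, of c] that by simp
  next
    case False
    from \<open>1 \<le> r\<close> show ?thesis
    proof (cases rule: row_parity)
      case (1 k)
      then have "1 \<le> k" "k \<le> n" "c \<in> {k..n}" using that False by auto
      then show ?thesis using labelling_zero_rows[OF L, of k] 1 by auto
    next
      case (2 k)
      then have "1 \<le> k" "k \<le> n" "c \<in> {k..n}" using that False by auto
      then show ?thesis using labelling_zero_rows[OF L, of k] 2 by auto
    qed
  qed
  show "V r c = V' r c" if "1 \<le> c" "c \<le> n + 1" "1 \<le> r" "r \<le> 2 * c" "r \<le> 2 * n"
    using \<open>1 \<le> r\<close>
  proof (cases rule: row_parity)
    case (1 k)
    then have "1 \<le> k" "k \<le> n" "c \<in> {k..n+1}" using that by auto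
    then show ?thesis using labelling_zero_rows[OF L, of k] 1 by auto
  next
    case (2 k)
    then have "1 \<le> k" "k \<le> n" "c \<in> {k..n+1}" using that by auto
    then show ?thesis using labelling_zero_rows[OF L, of k] 2 by auto
  qed
qed

text \<open>Existence: as a function of the label fed back by the U-turn, every label of a double row is
  either constant or the identity; hence feeding back minus the value for the feed 0 is consistent.\<close>

definition const_or_id :: "(int \<Rightarrow> int) \<Rightarrow> bool" where
  "const_or_id f \<longleftrightarrow> (\<exists>a. f = (\<lambda>_. a)) \<or> f = (\<lambda>\<rho>. \<rho>)"

lemma double_row_exists:
  fixes x :: "nat \<Rightarrow> int" and C :: "box set"
  assumes "k \<le> n"
  shows "\<exists>H1 H2 V1 V2. V1 k = s \<and> V2 (n + 1) = - V1 (n + 1) \<and>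
     (\<forall>c\<in>{k..n}.
       (if (r, c) \<in> C then V1 (c + 1) = V1 c \<and> H1 c = H2 c else H1 c = V1 c \<and> V1 (c + 1) = H2 c) \<and>
       (if (r', c) \<in> C then V2 c = V2 (c + 1) \<and> H2 c = x c else H2 c = V2 (c + 1) \<and> V2 c = x c))"
proof -
  \<comment> \<open>\<open>g\<close> counts columns from the right, in the direction of flow of the
    even row; \<open>h\<close> below counts them from the left, starting in column
    \<open>k\<close>.\<close>
  define g where "g \<rho> = rec_nat \<rho> (\<lambda>i y. if (r', n - i) \<in> C then y else x (n - i))" for \<rho> :: int
  define V2 where "V2 \<rho> c = g \<rho> (n + 1 - c)" for \<rho> c
  define H2 where "H2 \<rho> c = (if (r', c) \<in> C then x c else V2 \<rho> (c + 1))" for \<rho> c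
  define h where "h \<rho> = rec_nat s (\<lambda>i y. if (r, k + i) \<in> C then y else H2 \<rho> (k + i))" for \<rho>
  define V1 where "V1 \<rho> c = h \<rho> (c - k)" for \<rho> c
  define H1 where "H1 \<rho> c = (if (r, c) \<in> C then H2 \<rho> c else V1 \<rho> c)" for \<rho> c
  have V2_step: "V2 \<rho> c = (if (r', c) \<in> C then V2 \<rho> (c + 1) else x c)" if "c \<le> n" for \<rho> c
    using that by (simp add: V2_def g_def Suc_diff_le)
  have V1_step: "V1 \<rho> (c + 1) = (if (r, c) \<in> C then V1 \<rho> c else H2 \<rho> c)" if "k \<le> c" for \<rho> c
    using that by (simp add: V1_def h_def Suc_diff_le)
  have cg: "const_or_id (\<lambda>\<rho>. g \<rho> i)" for i
  proof (induction i)
    case 0 show ?case by (simp add: g_def const_or_id_def)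
  next
    case (Suc i)
    then show ?case by (cases "(r', n - i) \<in> C") (auto simp: g_def const_or_id_def)
  qed
  have cH2: "const_or_id (\<lambda>\<rho>. H2 \<rho> c)" for c
    using cg by (cases "(r', c) \<in> C") (auto simp: H2_def V2_def const_or_id_def)
  have "const_or_id (\<lambda>\<rho>. h \<rho> i)" for i
  proof (induction i)
    case 0 show ?case by (auto simp: h_def const_or_id_def)
  next
    case (Suc i)
    then show ?case using cH2[of "k + i"] by (cases "(r, k + i) \<in> C") (auto simp: h_def)
  qed
  then have "const_or_id (\<lambda>\<rho>. V1 \<rho> (n + 1))" by (simp add: V1_def)
  \<comment> \<open>In the constant case both sides agree trivially; in the identity case the value
    for the feed 0 is 0, and so is the new feed.\<close>
  then have fix_pt: "V1 (- V1 0 (n + 1)) (n + 1) = V1 0 (n + 1)"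
    unfolding const_or_id_def by (metis add.inverse_neutral)
  define \<rho> where "\<rho> = - V1 0 (n + 1)"
  show ?thesis
  proof (rule exI[of _ "H1 \<rho>"], rule exI[of _ "H2 \<rho>"], rule exI[of _ "V1 \<rho>"], rule exI[of _ "V2 \<rho>"],
      intro conjI ballI)
    show "V1 \<rho> k = s" by (simp add: V1_def h_def)
    show "V2 \<rho> (n + 1) = - V1 \<rho> (n + 1)"
      using fix_pt by (simp add: V2_def g_def \<rho>_def)
  qed (use V1_step V2_step in \<open>auto simp: H1_def H2_def\<close>)
qed

lemma labelling_exists: "\<exists>H V. labelling n C s H V"
proof -
  let ?P = "\<lambda>k0 H V. \<forall>k\<in>{k0..n}. 1 \<le> k \<longrightarrow> V (2 * k - 1) k = s k \<and> H (2 * k + 1) k = 0 \<and>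
        V (2 * k) (n + 1) = - V (2 * k - 1) (n + 1) \<and>
        (\<forall>c\<in>{k..n}. tile_ok C H V (2 * k - 1) c \<and> tile_ok C H V (2 * k) c)"
  have "\<exists>H V. ?P k0 H V" if "1 \<le> k0" "k0 \<le> n + 1" for k0
    using that(2,1)
  proof (induction k0 rule: inc_induct)
    case base show ?case by auto
  next
    case (step k)
    then obtain H V where IH: "?P (Suc k) H V" by auto
    have k: "1 \<le> k" "k \<le> n" using step by auto
    \<comment> \<open>Double rows are added from the bottom up. Column \<open>k\<close> has no box
      below \<open>(2 * k, k)\<close>, so there the bottom label is the conventional 0.\<close>
    define x where "x = (H (2 * k + 1))(k := 0)"
    obtain H1 H2 V1 V2 where *: "V1 k = s k" "V2 (n + 1) = - V1 (n + 1)"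
      "\<forall>c\<in>{k..n}.
       (if (2 * k - 1, c) \<in> C then V1 (c + 1) = V1 c \<and> H1 c = H2 c else H1 c = V1 c \<and> V1 (c + 1) = H2 c) \<and>
       (if (2 * k, c) \<in> C then V2 c = V2 (c + 1) \<and> H2 c = x c else H2 c = V2 (c + 1) \<and> V2 c = x c)"
      using double_row_exists[OF k(2), of "s k" "2 * k - 1" C "2 * k" x] by (elim exE conjE) (rule that)
    define H' where "H' = H(2 * k - 1 := H1, 2 * k := H2, 2 * k + 1 := x)"
    define V' where "V' = V(2 * k - 1 := V1, 2 * k := V2)"
    have rows: "H' (2 * k - 1) = H1" "H' (2 * k) = H2" "H' (2 * k + 1) = x"
      "V' (2 * k - 1) = V1" "V' (2 * k) = V2"
      using k by (auto simp: H'_def V'_def)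
    have above: "V' r = V r" "c \<noteq> k \<Longrightarrow> H' r c = H r c" if "r > 2 * k" for r c
      using that by (auto simp: H'_def V'_def x_def)
    have ok: "tile_ok C H' V' (2 * k - 1) c" "tile_ok C H' V' (2 * k) c" if "c \<in> {k..n}" for c
    proof -
      have "odd (2 * k - 1)" "2 * k - 1 + 1 = 2 * k" "even (2 * k)" using k by auto
      then show "tile_ok C H' V' (2 * k - 1) c" "tile_ok C H' V' (2 * k) c"
        using conjunct1[OF bspec[OF *(3) that]] conjunct2[OF bspec[OF *(3) that]] unfolding tile_ok_def inflow_def outflow_def by (simp_all only: rows if_True if_False not_True_eq_False not_False_eq_True)
    qed
    have keep: "tile_ok C H' V' r c = tile_ok C H V r c" if "r > 2 * k" "c \<noteq> k" for r c
    proof -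
      have "H' (r + 1) c = H (r + 1) c" "H' r c = H r c" "V' r = V r"
        using above(1)[of r] above(2)[of r c] above(2)[of "r + 1" c] that by auto
      then show ?thesis by (simp add: tile_ok_def)
    qed
    have "?P k H' V'"
    proof (intro ballI impI, goal_cases)
      case (1 k')
      show ?case
      proof (cases "k' = k")
        case True
        have "H' (2 * k + 1) k = 0" using rows(3) by (simp add: x_def)
        then show ?thesis using True *(1,2) rows ok by auto
      next
        case False
        then have k': "k' \<in> {Suc k..n}" "1 \<le> k'" using 1 by auto
        have big: "2 * k' - 1 > 2 * k" "2 * k' > 2 * k" "2 * k' + 1 > 2 * k" "k' \<noteq> k" using k' by auto
        have "H' (2 * k' + 1) k' = H (2 * k' + 1) k'" "V' (2 * k' - 1) = V (2 * k' - 1)" "V' (2 * k') = V (2 * k')"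
          using above(2)[OF big(3,4)] above(1)[OF big(1)] above(1)[OF big(2)] by auto
        moreover have "tile_ok C H' V' (2 * k' - 1) c" "tile_ok C H' V' (2 * k') c" if "c \<in> {k'..n}" for c
          using keep[OF big(1), of c] keep[OF big(2), of c] IH k' that by auto
        ultimately show ?thesis using IH k' by auto
      qed
    qed
    then show ?case by blast
  qed
  from this[of 1] obtain H V where P: "?P 1 H V" by auto
  have "tile_ok C H V r c" if "c \<in> {1..n}" "r \<in> {1..2 * c}" for r c
  proof -
    have "1 \<le> r" using that by simp
    then show ?thesis
    proof (cases rule: row_parity)
      case (1 k)
      then have "k \<in> {1..n}" "c \<in> {k..n}" using that by auto
      then show ?thesis using P 1 by blast
    next
      case (2 k)
      then have "k \<in> {1..n}" "c \<in> {k..n}" using that by auto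
      then show ?thesis using P 2 by blast
    qed
  qed
  then show ?thesis using P unfolding labelling_def by (intro exI[of _ H] exI[of _ V]) auto
qed

section \<open>Pipes and labels\<close>

lemma SY_ext_iff:
  "(r, c) \<in> SY_ext n \<longleftrightarrow> (1 \<le> c \<and> c \<le> n \<and> 1 \<le> r \<and> r \<le> 2 * c) \<or> (c = n + 1 \<and> 1 \<le> r \<and> r \<le> 2 * n)"
  by (auto simp: SY_ext_def SY_tilde_def)

lemma crossings_bounds:
  assumes "(r, c) \<in> crossings n D" shows "1 \<le> c" "c \<le> n" "1 \<le> r" "r < 2 * c"
  using assms by (auto simp: crossings_def)

lemma tile_inner:
  assumes "c \<le> n"
  shows "tile n D (r, c) =
    (if (r, c) \<in> crossings n D
     then {{VEdge r (inflow r c), VEdge r (outflow r c)}, {HEdge r c, HEdge (r + 1) c}}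
     else {{VEdge r (inflow r c), HEdge r c}, {VEdge r (outflow r c), HEdge (r + 1) c}})"
  using assms
  by (auto simp: tile_def inflow_def outflow_def crossing_tile_def elbow_tile_def
      reversed_elbow_tile_def insert_commute)

lemma tile_outer:
  "tile n D (r, n + 1) =
    (if even r then {{VEdge r (n + 1), HEdge r (n + 1)}, {VEdge r (n + 2), HEdge (r + 1) (n + 1)}}
     else {{VEdge r (n + 1), HEdge (r + 1) (n + 1)}, {HEdge r (n + 1), VEdge r (n + 2)}})"
  using crossings_bounds[of r "n + 1" n D]
  by (auto simp: tile_def elbow_tile_def reversed_elbow_tile_def insert_commute)

text \<open>In column \<open>n + 1\<close> the U-turn from row \<open>2k - 1\<close> to row
  \<open>2k\<close> passes through the top edge of the even box. This edge gets the label before the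
  change of sign; the remaining edges of that column, which carry no pipe
  \<open>\<ell>\<^sub>k\<close>, get 0.\<close>

fun edge_label :: "nat \<Rightarrow> (nat \<Rightarrow> nat \<Rightarrow> int) \<Rightarrow> (nat \<Rightarrow> nat \<Rightarrow> int) \<Rightarrow> edge \<Rightarrow> int" where
  "edge_label n H V (HEdge r c) =
     (if c \<le> n then H r c else if c = n + 1 \<and> even r then V (r - 1) (n + 1) else 0)"
| "edge_label n H V (VEdge r c) = (if c \<le> n + 1 then V r c else 0)"

text \<open>Absolute values are compared because the second half of a U-turn changes the
  sign.\<close>

lemma edge_label_strand:
  assumes L: "labelling n (crossings n D) s H V" and x: "x \<in> SY_ext n" and ab: "{a, b} \<in> tile n D x"
  shows "\<bar>edge_label n H V a\<bar> = \<bar>edge_label n H V b\<bar>"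
proof -
  obtain r c where rc: "x = (r, c)" by force
  show ?thesis
  proof (cases "c \<le> n")
    case True
    then have "1 \<le> c" "1 \<le> r" "r \<le> 2 * c" using x rc SY_ext_iff[of r c n] by auto
    then have "tile_ok (crossings n D) H V r c" using labelling_tile[OF L _ True] by simp
    then show ?thesis
      using ab True unfolding rc tile_inner[OF True] tile_ok_def
      by (auto split: if_splits simp: doubleton_eq_iff inflow_def outflow_def)
  next
    case False
    then have c: "c = n + 1" and r: "1 \<le> r" "r \<le> 2 * n" using x rc SY_ext_iff[of r c n] by auto
    from r(1) show ?thesis
    proof (cases rule: row_parity)
      case (1 k)
      then have "odd r" by auto
      then show ?thesis using ab unfolding rc c tile_outer by (auto simp: doubleton_eq_iff)
    next
      case (2 k)
      then have "V r (n + 1) = - V (r - 1) (n + 1)" using labelling_ends(3)[OF L, of k] r by auto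
      then show ?thesis using ab 2 unfolding rc c tile_outer by (auto simp: doubleton_eq_iff)
    qed
  qed
qed

lemma pipe_through_const:
  assumes "\<And>x a b. x \<in> SY_ext n \<Longrightarrow> {a, b} \<in> tile n D x \<Longrightarrow> F a = F b" and "b \<in> pipe_through n D a"
  shows "F b = F a"
proof -
  have "(\<lambda>a b. \<exists>x\<in>SY_ext n. {a, b} \<in> tile n D x)\<^sup>*\<^sup>* a b" using assms(2) by (simp add: pipe_through_def)
  then show ?thesis by induction (use assms(1) in force)+
qed

lemma start_pipe_strand:
  assumes "x \<in> SY_ext n" "{a, b} \<in> tile n D x"
  shows "a \<in> start_pipe n D k \<longleftrightarrow> b \<in> start_pipe n D k"
proof -
  have *: "b \<in> start_pipe n D k" if "x \<in> SY_ext n" "{a, b} \<in> tile n D x" "a \<in> start_pipe n D k" for a b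
    using that unfolding start_pipe_def pipe_through_def
    by (auto intro: rtranclp.rtrancl_into_rtrancl)
  show ?thesis using *[of a b] *[of b a] assms by (auto simp: insert_commute)
qed

text \<open>Pipes are numbered from the bottom, so the odd row of double row \<open>k\<close> starts
  pipe \<open>n + 1 - k\<close>. The minus sign is the summand 1 in the exponent of the sign of
  w_D.\<close>

abbreviation pipe_start_label :: "nat \<Rightarrow> nat \<Rightarrow> int" where
  "pipe_start_label n \<equiv> \<lambda>k. - int (n + 1 - k)"

lemma start_pipe_start: "k \<in> {1..n} \<Longrightarrow> VEdge (2 * k - 1) k \<in> start_pipe n D (n + 1 - k)"
  by (auto simp: start_pipe_def pipe_through_def)

lemma start_pipe_label:
  assumes L: "labelling n (crossings n D) (pipe_start_label n) H V"
    and k: "k \<in> {1..n}" and e: "e \<in> start_pipe n D k"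
  shows "\<bar>edge_label n H V e\<bar> = int k"
proof -
  let ?e0 = "VEdge (2 * (n + 1 - k) - 1) (n + 1 - k)"
  have "\<bar>edge_label n H V e\<bar> = \<bar>edge_label n H V ?e0\<bar>"
    using e pipe_through_const[of n D "\<lambda>e. \<bar>edge_label n H V e\<bar>" e ?e0] edge_label_strand[OF L]
    by (auto simp: start_pipe_def)
  also have "\<dots> = int k" using labelling_ends(1)[OF L, of "n + 1 - k"] k by auto
  finally show ?thesis .
qed

text \<open>Resetting to 0 the labels outside the pipes \<open>\<ell>\<^sub>k\<close> gives a labelling again; uniqueness then
  shows that nothing was reset.\<close>

lemma labelling_restrict:
  assumes L: "labelling n (crossings n D) (pipe_start_label n) H V"
  defines "S \<equiv> \<Union>k\<in>{1..n}. start_pipe n D k"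
  shows "labelling n (crossings n D) (pipe_start_label n)
    (\<lambda>r c. if HEdge r c \<in> S then H r c else 0) (\<lambda>r c. if VEdge r c \<in> S then V r c else 0)"
proof -
  have S: "a \<in> S \<longleftrightarrow> b \<in> S" if "x \<in> SY_ext n" "{a, b} \<in> tile n D x" for a b x
    using start_pipe_strand[OF that] by (auto simp: S_def)
  let ?H = "\<lambda>r c. if HEdge r c \<in> S then H r c else 0"
  let ?V = "\<lambda>r c. if VEdge r c \<in> S then V r c else 0"
  have "tile_ok (crossings n D) ?H ?V r c" if "c \<in> {1..n}" "r \<in> {1..2 * c}" for r c
  proof -
    have ok: "tile_ok (crossings n D) H V r c" using labelling_tile[OF L] that by simp
    have c: "c \<le> n" and x: "(r, c) \<in> SY_ext n" using that by (auto simp: SY_ext_iff)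
    show ?thesis
    proof (cases "(r, c) \<in> crossings n D")
      case True
      then have "VEdge r (inflow r c) \<in> S \<longleftrightarrow> VEdge r (outflow r c) \<in> S" "HEdge r c \<in> S \<longleftrightarrow> HEdge (r + 1) c \<in> S"
        by (auto intro!: S[OF x] simp: tile_inner[OF c])
      then show ?thesis using ok True by (auto simp: tile_ok_def)
    next
      case False
      then have "VEdge r (inflow r c) \<in> S \<longleftrightarrow> HEdge r c \<in> S" "VEdge r (outflow r c) \<in> S \<longleftrightarrow> HEdge (r + 1) c \<in> S"
        by (auto intro!: S[OF x] simp: tile_inner[OF c])
      then show ?thesis using ok False by (auto simp: tile_ok_def)
    qed
  qed
  moreover have "?V (2 * k - 1) k = pipe_start_label n k \<and> ?H (2 * k + 1) k = 0 \<and>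
      ?V (2 * k) (n + 1) = - ?V (2 * k - 1) (n + 1)" if k: "k \<in> {1..n}" for k
  proof -
    have "VEdge (2 * k - 1) k \<in> S"
      using start_pipe_start[OF k, of D] k unfolding S_def by (intro UN_I[of "n + 1 - k"]) auto
    moreover have "VEdge (2 * k - 1) (n + 1) \<in> S \<longleftrightarrow> HEdge (2 * k) (n + 1) \<in> S"
      using k by (intro S[of "(2 * k - 1, n + 1)"], unfold tile_outer SY_ext_iff) auto
    moreover have "VEdge (2 * k) (n + 1) \<in> S \<longleftrightarrow> HEdge (2 * k) (n + 1) \<in> S"
      using k by (intro S[of "(2 * k, n + 1)"], unfold tile_outer SY_ext_iff) auto
    ultimately show ?thesis using labelling_ends[OF L, of k] k by auto
  qed
  ultimately show ?thesis unfolding labelling_def by blast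
qed

text \<open>Since resetting labels outside the pipes changes nothing, an edge with a nonzero label
  lies on some pipe; the absolute value is constant along that pipe and hence is its number.\<close>

lemma H_in_start_pipe_iff:
  assumes L: "labelling n (crossings n D) (pipe_start_label n) H V"
    and k: "k \<in> {1..n}" and c: "1 \<le> c" "c \<le> n" and r: "1 \<le> r" "r \<le> 2 * c + 1"
  shows "HEdge r c \<in> start_pipe n D k \<longleftrightarrow> \<bar>H r c\<bar> = int k"
proof
  show "HEdge r c \<in> start_pipe n D k \<Longrightarrow> \<bar>H r c\<bar> = int k"
    using start_pipe_label[OF L k, of "HEdge r c"] c by simp
  assume *: "\<bar>H r c\<bar> = int k"
  have "H r c = (if HEdge r c \<in> (\<Union>k\<in>{1..n}. start_pipe n D k) then H r c else 0)"
    using labelling_unique(1)[OF L labelling_restrict[OF L] c r] .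
  with * k obtain k' where "k' \<in> {1..n}" "HEdge r c \<in> start_pipe n D k'" by (auto split: if_splits)
  then show "HEdge r c \<in> start_pipe n D k"
    using start_pipe_label[OF L, of k' "HEdge r c"] c * by simp
qed

lemma V_in_start_pipe_iff:
  assumes L: "labelling n (crossings n D) (pipe_start_label n) H V"
    and k: "k \<in> {1..n}" and c: "1 \<le> c" "c \<le> n + 1" and r: "1 \<le> r" "r \<le> 2 * c" "r \<le> 2 * n"
  shows "VEdge r c \<in> start_pipe n D k \<longleftrightarrow> \<bar>V r c\<bar> = int k"
proof
  show "VEdge r c \<in> start_pipe n D k \<Longrightarrow> \<bar>V r c\<bar> = int k"
    using start_pipe_label[OF L k, of "VEdge r c"] c by simp
  assume *: "\<bar>V r c\<bar> = int k"
  have "V r c = (if VEdge r c \<in> (\<Union>k\<in>{1..n}. start_pipe n D k) then V r c else 0)"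
    using labelling_unique(2)[OF L labelling_restrict[OF L] c r] .
  with * k obtain k' where "k' \<in> {1..n}" "VEdge r c \<in> start_pipe n D k'" by (auto split: if_splits)
  then show "VEdge r c \<in> start_pipe n D k"
    using start_pipe_label[OF L, of k' "VEdge r c"] c * by simp
qed

section \<open>Parity of self-crossings\<close>

text \<open>The invariant of a scan of a double row from left to right, for one pipe: \<open>X\<close> and \<open>Y\<close> are the
  signs with which it entered through the bottom and left through the top so far, \<open>h\<close> and \<open>g\<close> its signs
  on the current vertical edges of the odd and of the even row, and \<open>\<tau>\<close> is the parity of the number of
  self-crossings so far. When all four signs agree, the parity is not determined; such a state
  cannot be completed to a double row with a U-turn.\<close>

definition scan_inv :: "int \<Rightarrow> int \<Rightarrow> int \<Rightarrow> int \<Rightarrow> int \<Rightarrow> bool" where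
  "scan_inv X Y h g \<tau> \<longleftrightarrow>
     X \<noteq> 0 \<and> Y = X \<and> h = X \<and> g = X \<or> \<tau> = (if X \<noteq> 0 \<and> Y = - X then - 1 else 1)"

text \<open>One column of the scan: \<open>x\<close>, \<open>y\<close>, \<open>z\<close> are the
  signs on its bottom, middle and top edges, and \<open>A\<close> and \<open>B\<close> say whether
  the odd and the even tile are crossings. A crossing counts as a self-crossing if both its strands
  have nonzero sign. Conservation of flow and the bound of one entry and one exit leave finitely
  many sign patterns to check for each pair of tiles.\<close>

lemma scan_inv_step:
  fixes X Y h g x y z h' g' \<tau> :: int
  assumes inv: "scan_inv X Y h g \<tau>"
    and vals: "X \<in> {-1,0,1}" "Y \<in> {-1,0,1}" "h \<in> {-1,0,1}" "x \<in> {-1,0,1}" "g' \<in> {-1,0,1}"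
    and flow: "X + g = Y + h" "\<bar>X\<bar> + \<bar>g\<bar> = \<bar>Y\<bar> + \<bar>h\<bar>"
    and once: "\<bar>X\<bar> + \<bar>x\<bar> \<le> 1" "\<bar>Y\<bar> + \<bar>z\<bar> \<le> 1"
    and A: "if A then h' = h \<and> z = y else z = h \<and> h' = y"
    and B: "if B then g = g' \<and> y = x else y = g' \<and> g = x"
  shows "scan_inv (X + x) (Y + z) h' g'
    (\<tau> * ((if A \<and> h \<noteq> 0 \<and> y \<noteq> 0 then - 1 else 1) * (if B \<and> g \<noteq> 0 \<and> y \<noteq> 0 then - 1 else 1)))"
proof -
  have g: "g = Y + h - X" using flow(1) by simp
  \<comment> \<open>In the undetermined state \<open>g = X\<close> follows from the flow equation,
    so that \<open>g\<close> can be eliminated.\<close>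
  have inv': "X \<noteq> 0 \<and> Y = X \<and> h = X \<or> \<tau> = (if X \<noteq> 0 \<and> Y = - X then - 1 else 1)"
    using inv g unfolding scan_inv_def by auto
  have flow': "\<bar>X\<bar> + \<bar>Y + h - X\<bar> = \<bar>Y\<bar> + \<bar>h\<bar>" using flow g by simp
  show ?thesis
  proof (cases A; cases B)
    assume AB: "A" "B"
    then have e: "h' = h" "z = x" "y = x" "g' = g" using A B by auto
    show ?thesis using inv' vals(1,2,3,4) flow' once AB unfolding e g scan_inv_def
      by (elim insertE emptyE; hypsubst) simp_all
  next
    assume AB: "A" "\<not> B"
    then have e: "h' = h" "z = g'" "y = g'" "x = g" using A B by auto
    show ?thesis using inv' vals(1,2,3,5) flow' once AB unfolding e g scan_inv_def
      by (elim insertE emptyE; hypsubst) simp_all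
  next
    assume AB: "\<not> A" "B"
    then have e: "h' = x" "z = h" "y = x" "g' = g" using A B by auto
    show ?thesis using inv' vals(1,2,3,4) flow' once AB unfolding e g scan_inv_def
      by (elim insertE emptyE; hypsubst) simp_all
  next
    assume AB: "\<not> A" "\<not> B"
    then have e: "h' = g'" "z = h" "y = g'" "x = g" using A B by auto
    show ?thesis using inv' vals(1,2,3,5) flow' once AB unfolding e g scan_inv_def
      by (elim insertE emptyE; hypsubst) simp_all
  qed
qed

text \<open>At most one summand is nonzero, so no cancellation can occur.\<close>

lemma abs_sum_eq:
  fixes f :: "'a \<Rightarrow> int"
  assumes "finite A" "(\<Sum>a\<in>A. \<bar>f a\<bar>) \<le> 1"
  shows "\<bar>\<Sum>a\<in>A. f a\<bar> = (\<Sum>a\<in>A. \<bar>f a\<bar>)"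
  using assms
proof (induction A rule: finite_induct)
  case (insert a A)
  have "0 \<le> (\<Sum>a\<in>A. \<bar>f a\<bar>)" by (simp add: sum_nonneg)
  then show ?case using insert by (auto simp: abs_if split: if_splits)
qed simp

text \<open>\<open>\<phi>\<close> singles out the pipe with number \<open>p\<close>, and
  \<open>\<tau>\<close> is the parity of its self-crossings in the double row. What enters from
  below, from the left start and from the right along the even row leaves through the top or to the
  right along the odd row, with signs and with absolute values. At the right end the U-turn forces
  \<open>g = - h\<close>, which excludes the undetermined state of the scan.\<close>

lemma double_row_parity:
  fixes H V :: "nat \<Rightarrow> nat \<Rightarrow> int" and p :: int
  assumes L: "labelling n C s H V" and k: "1 \<le> k" "k \<le> n" and diag: "(2 * k, k) \<notin> C"
    and p: "0 < p"
  defines "\<phi> \<equiv> \<lambda>x. if \<bar>x\<bar> = p then sgn x else 0"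
  defines "\<sigma> \<equiv> \<lambda>r c. if (r, c) \<in> C \<and> \<bar>V r c\<bar> = p \<and> \<bar>H r c\<bar> = p then - 1 else (1 :: int)"
  assumes once: "\<bar>\<phi> (s k)\<bar> + (\<Sum>c\<in>{k..n}. \<bar>\<phi> (H (2 * k + 1) c)\<bar>) \<le> 1"
  defines "\<tau> \<equiv> \<Prod>c\<in>{k..n}. \<sigma> (2 * k - 1) c * \<sigma> (2 * k) c"
  defines "X \<equiv> \<phi> (s k) + (\<Sum>c\<in>{k..n}. \<phi> (H (2 * k + 1) c))"
  shows "(\<Sum>c\<in>{k..n}. \<phi> (H (2 * k - 1) c)) = X * \<tau>"
    and "(\<Sum>c\<in>{k..n}. \<bar>\<phi> (H (2 * k - 1) c)\<bar>) =
         \<bar>\<phi> (s k)\<bar> + (\<Sum>c\<in>{k..n}. \<bar>\<phi> (H (2 * k + 1) c)\<bar>)"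
    and "X = 0 \<Longrightarrow> \<tau> = 1"
proof -
  define h where "h c = \<phi> (V (2 * k - 1) c)" for c
  define g where "g c = \<phi> (V (2 * k) c)" for c
  define x where "x c = \<phi> (H (2 * k + 1) c)" for c
  define y where "y c = \<phi> (H (2 * k) c)" for c
  define z where "z c = \<phi> (H (2 * k - 1) c)" for c
  define Xs where "Xs c = \<phi> (s k) + (\<Sum>i\<in>{k..<c}. x i)" for c
  define Ys where "Ys c = (\<Sum>i\<in>{k..<c}. z i)" for c
  define AX where "AX c = \<bar>\<phi> (s k)\<bar> + (\<Sum>i\<in>{k..<c}. \<bar>x i\<bar>)" for c
  define AY where "AY c = (\<Sum>i\<in>{k..<c}. \<bar>z i\<bar>)" for c
  define \<tau>s where "\<tau>s c = (\<Prod>i\<in>{k..<c}. \<sigma> (2 * k - 1) i * \<sigma> (2 * k) i)" for c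
  have \<phi>_vals: "\<phi> a \<in> {-1, 0, 1}" and \<phi>_0: "\<phi> a = 0 \<longleftrightarrow> \<bar>a\<bar> \<noteq> p" and \<phi>_uminus: "\<phi> (- a) = - \<phi> a" for a
    using p by (auto simp: \<phi>_def sgn_if)
  have A: "if (2 * k - 1, c) \<in> C then h (c + 1) = h c \<and> z c = y c else z c = h c \<and> h (c + 1) = y c"
    if "c \<in> {k..n}" for c
    using labelling_odd[OF L k(1), of c] that by (auto simp: h_def y_def z_def split: if_splits)
  have B: "if (2 * k, c) \<in> C then g c = g (c + 1) \<and> y c = x c else y c = g (c + 1) \<and> g c = x c"
    if "c \<in> {k..n}" for c
    using labelling_even[OF L k(1), of c] that by (auto simp: g_def y_def x_def split: if_splits)
  \<comment> \<open>\<open>g k = 0\<close> because the box \<open>(2k, k)\<close> is no crossing: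
    its left edge is joined to its bottom edge, which has the label 0.\<close>
  have start: "h k = \<phi> (s k)" "g k = 0" and uturn: "g (n + 1) = - h (n + 1)"
    using labelling_ends[OF L k] labelling_even[OF L k(1), of k] diag k p
    by (auto simp: h_def g_def \<phi>_uminus) (auto simp: \<phi>_def)
  have flow: "Xs c + g c = Ys c + h c \<and> AX c + \<bar>g c\<bar> = AY c + \<bar>h c\<bar>" if "k \<le> c" "c \<le> n + 1" for c
    using that
  proof (induction c rule: dec_induct)
    case base show ?case by (simp add: Xs_def Ys_def AX_def AY_def start)
  next
    case (step m)
    have S: "Xs (Suc m) = Xs m + x m" "Ys (Suc m) = Ys m + z m" "AX (Suc m) = AX m + \<bar>x m\<bar>"
      "AY (Suc m) = AY m + \<bar>z m\<bar>"
      using step(1) by (simp_all add: Xs_def Ys_def AX_def AY_def)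
    show ?case
      using step A[of m] B[of m] unfolding S
      by (cases "(2 * k - 1, m) \<in> C"; cases "(2 * k, m) \<in> C") auto
  qed
  have ivl: "{k..<n + 1} = {k..n}" by auto
  have AX_end: "AX (n + 1) \<le> 1" using once unfolding AX_def ivl x_def by simp
  have AY_end: "AY (n + 1) = AX (n + 1)" using flow[of "n + 1"] uturn k by simp
  have AX: "AX c \<le> 1" and AY: "AY c \<le> 1" if "c \<le> n + 1" for c
  proof -
    have "(\<Sum>i\<in>{k..<c}. \<bar>x i\<bar>) \<le> (\<Sum>i\<in>{k..<n+1}. \<bar>x i\<bar>)" "(\<Sum>i\<in>{k..<c}. \<bar>z i\<bar>) \<le> (\<Sum>i\<in>{k..<n+1}. \<bar>z i\<bar>)"
      using that by (intro sum_mono2; auto)+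
    then show "AX c \<le> 1" "AY c \<le> 1" using AX_end AY_end unfolding AX_def AY_def by linarith+
  qed
  have absX: "\<bar>Xs c\<bar> = AX c" if "c \<le> n + 1" for c
  proof -
    have "(\<Sum>i\<in>{k..<c}. \<bar>x i\<bar>) \<le> 1" using AX[OF that] unfolding AX_def by linarith
    then have "\<bar>\<Sum>i\<in>{k..<c}. x i\<bar> = (\<Sum>i\<in>{k..<c}. \<bar>x i\<bar>)" by (intro abs_sum_eq) auto
    then show ?thesis using AX[OF that] unfolding AX_def Xs_def by linarith
  qed
  have absY: "\<bar>Ys c\<bar> = AY c" if "c \<le> n + 1" for c
    using AY[OF that] unfolding AY_def Ys_def by (intro abs_sum_eq) auto
  have inv: "scan_inv (Xs c) (Ys c) (h c) (g c) (\<tau>s c)" if "k \<le> c" "c \<le> n + 1" for c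
    using that
  proof (induction c rule: dec_induct)
    case base show ?case by (simp add: Xs_def Ys_def \<tau>s_def start scan_inv_def)
  next
    case (step m)
    then have m: "m \<in> {k..n}" "k \<le> m" "m \<le> n + 1" "m + 1 \<le> n + 1" by auto
    have S: "Xs (m + 1) = Xs m + x m" "Ys (m + 1) = Ys m + z m" "AX (m + 1) = AX m + \<bar>x m\<bar>"
      "AY (m + 1) = AY m + \<bar>z m\<bar>"
      using step(1) by (simp_all add: Xs_def Ys_def AX_def AY_def)
    have \<tau>: "\<tau>s (m + 1) = \<tau>s m * (\<sigma> (2 * k - 1) m * \<sigma> (2 * k) m)"
      using step(1) by (simp add: \<tau>s_def)
    have \<sigma>1: "\<sigma> (2 * k - 1) m = (if (2 * k - 1, m) \<in> C \<and> h m \<noteq> 0 \<and> y m \<noteq> 0 then - 1 else 1)"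
    proof -
      have "\<sigma> (2 * k - 1) m = (if (2 * k - 1, m) \<in> C \<and> h m \<noteq> 0 \<and> z m \<noteq> 0 then - 1 else 1)"
        unfolding \<sigma>_def h_def z_def \<phi>_0 by simp
      then show ?thesis using A[OF m(1)] by (cases "(2 * k - 1, m) \<in> C") simp_all
    qed
    have \<sigma>2: "\<sigma> (2 * k) m = (if (2 * k, m) \<in> C \<and> g m \<noteq> 0 \<and> y m \<noteq> 0 then - 1 else 1)"
      unfolding \<sigma>_def g_def y_def \<phi>_0 by simp
    have vals: "Xs m \<in> {-1, 0, 1}" "Ys m \<in> {-1, 0, 1}"
      using absX[OF m(3)] absY[OF m(3)] AX[OF m(3)] AY[OF m(3)] by auto
    have "scan_inv (Xs m) (Ys m) (h m) (g m) (\<tau>s m)" using step by auto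
    then have "scan_inv (Xs m + x m) (Ys m + z m) (h (m + 1)) (g (m + 1))
       (\<tau>s m * (\<sigma> (2 * k - 1) m * \<sigma> (2 * k) m))"
      unfolding \<sigma>1 \<sigma>2
    proof (rule scan_inv_step)
      show "Xs m + g m = Ys m + h m" "\<bar>Xs m\<bar> + \<bar>g m\<bar> = \<bar>Ys m\<bar> + \<bar>h m\<bar>"
        using flow[OF m(2,3)] absX[OF m(3)] absY[OF m(3)] by auto
      show "\<bar>Xs m\<bar> + \<bar>x m\<bar> \<le> 1" "\<bar>Ys m\<bar> + \<bar>z m\<bar> \<le> 1"
        using AX[OF m(4)] AY[OF m(4)] absX[OF m(3)] absY[OF m(3)] S by auto
      show "Xs m \<in> {-1, 0, 1}" "Ys m \<in> {-1, 0, 1}" by fact+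
      show "h m \<in> {-1, 0, 1}" "x m \<in> {-1, 0, 1}" "g (m + 1) \<in> {-1, 0, 1}"
        unfolding h_def x_def g_def by (rule \<phi>_vals)+
    qed (use A[OF m(1)] B[OF m(1)] in simp_all)
    then show ?case using S \<tau> by simp
  qed
  have X: "Xs (n + 1) = X" and \<tau>: "\<tau>s (n + 1) = \<tau>" unfolding Xs_def X_def \<tau>s_def \<tau>_def ivl x_def by auto
  have "Ys (n + 1) = X * \<tau> \<and> (X = 0 \<longrightarrow> \<tau> = 1)"
  proof -
    \<comment> \<open>The third equation is the flow equation with \<open>g = - h\<close>. Together
      with the second it leaves \<open>h = 0\<close>, where the pipe leaves with its old sign, or
      \<open>h = X\<close>, where it took the U-turn and leaves with the opposite sign.\<close>
    have "X \<in> {-1,0,1}" "\<bar>Ys (n + 1)\<bar> = \<bar>X\<bar>" "Ys (n + 1) = X - 2 * h (n + 1)"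
      using absX[of "n + 1"] absY[of "n + 1"] AX_end AY_end flow[of "n + 1"] uturn k X by auto
    moreover have "h (n + 1) \<in> {-1,0,1}" using \<phi>_vals by (simp add: h_def)
    moreover have "scan_inv X (Ys (n + 1)) (h (n + 1)) (- h (n + 1)) \<tau>"
      using inv[of "n + 1"] X \<tau> uturn k by simp
    ultimately show ?thesis unfolding scan_inv_def by auto
  qed
  then show "(\<Sum>c\<in>{k..n}. \<phi> (H (2 * k - 1) c)) = X * \<tau>" "X = 0 \<Longrightarrow> \<tau> = 1"
    unfolding Ys_def ivl z_def by auto
  show "(\<Sum>c\<in>{k..n}. \<bar>\<phi> (H (2 * k - 1) c)\<bar>) =
         \<bar>\<phi> (s k)\<bar> + (\<Sum>c\<in>{k..n}. \<bar>\<phi> (H (2 * k + 1) c)\<bar>)"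
    using AY_end unfolding AX_def AY_def ivl x_def z_def .
qed

lemma prod_rows_pairs:
  fixes f :: "nat \<Rightarrow> nat \<Rightarrow> int"
  shows "(\<Prod>c\<in>{1..n}. \<Prod>r\<in>{1..2 * c}. f r c) = (\<Prod>k\<in>{1..n}. \<Prod>c\<in>{k..n}. f (2 * k - 1) c * f (2 * k) c)"
proof -
  have pairs: "(\<Prod>r\<in>{1..2 * m}. f r c) = (\<Prod>k\<in>{1..m}. f (2 * k - 1) c * f (2 * k) c)" for m c
    by (induction m) (simp_all add: mult_ac)
  have "(\<Prod>c\<in>{1..n}. \<Prod>k\<in>{1..c}. g k c) = (\<Prod>k\<in>{1..n}. \<Prod>c\<in>{k..n}. g k c)" for g :: "nat \<Rightarrow> nat \<Rightarrow> int"
    by (simp add: prod.Sigma, rule prod.reindex_bij_witness[of _ "\<lambda>(k, c). (c, k)" "\<lambda>(c, k). (k, c)"]) auto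
  then show ?thesis unfolding pairs .
qed

text \<open>The power of -1 becomes a product of local signs over all boxes, regrouped by double
  rows to match \<open>double_row_parity\<close>. Boxes \<open>(2k, k)\<close> may be included since
  they are never crossings.\<close>

lemma self_crossings_sign:
  assumes L: "labelling n (crossings n D) (pipe_start_label n) H V" and p: "p \<in> {1..n}"
  shows "(- 1) ^ self_crossings n D (start_pipe n D p) =
    (\<Prod>k\<in>{1..n}. \<Prod>c\<in>{k..n}.
      (if (2 * k - 1, c) \<in> crossings n D \<and> \<bar>V (2 * k - 1) c\<bar> = int p \<and> \<bar>H (2 * k - 1) c\<bar> = int p then - 1 else 1) *
      (if (2 * k, c) \<in> crossings n D \<and> \<bar>V (2 * k) c\<bar> = int p \<and> \<bar>H (2 * k) c\<bar> = int p then - 1 else 1 :: int))"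
proof -
  let ?C = "crossings n D"
  let ?P = "\<lambda>r c. (r, c) \<in> ?C \<and> \<bar>V r c\<bar> = int p \<and> \<bar>H r c\<bar> = int p"
  let ?U = "SIGMA c:{1..n}. {1..2 * c}"
  have "(r, c) \<in> {x \<in> ?C. \<forall>s\<in>tile n D x. s \<subseteq> start_pipe n D p} \<longleftrightarrow> ?P r c" for r c
  proof (cases "(r, c) \<in> ?C")
    case True
    note b = crossings_bounds[OF True]
    have ok: "V r (outflow r c) = V r (inflow r c)" "H r c = H (r + 1) c"
      using labelling_tile[OF L, of c r] b True by (auto simp: tile_ok_def)
    have "VEdge r (inflow r c) \<in> start_pipe n D p \<longleftrightarrow> \<bar>V r (inflow r c)\<bar> = int p"
      using V_in_start_pipe_iff[OF L p, of "inflow r c" r] b by (auto simp: inflow_def)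
    moreover have "VEdge r (outflow r c) \<in> start_pipe n D p \<longleftrightarrow> \<bar>V r (outflow r c)\<bar> = int p"
      using V_in_start_pipe_iff[OF L p, of "outflow r c" r] b by (auto simp: outflow_def)
    moreover have "HEdge r c \<in> start_pipe n D p \<longleftrightarrow> \<bar>H r c\<bar> = int p"
      using H_in_start_pipe_iff[OF L p, of c r] b by simp
    moreover have "HEdge (r + 1) c \<in> start_pipe n D p \<longleftrightarrow> \<bar>H (r + 1) c\<bar> = int p"
      using H_in_start_pipe_iff[OF L p, of c "r + 1"] b by simp
    moreover have "V r c = V r (inflow r c)" using ok(1) by (auto simp: inflow_def outflow_def split: if_splits)
    ultimately show ?thesis using True ok by (auto simp: tile_inner[OF b(2)])
  qed auto
  then have "{x \<in> ?C. \<forall>s\<in>tile n D x. s \<subseteq> start_pipe n D p} = (\<lambda>(c, r). (r, c)) ` {x \<in> ?U. case x of (c, r) \<Rightarrow> ?P r c}"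
    using crossings_bounds by (fastforce simp: image_iff)
  moreover have "inj_on (\<lambda>(c, r). (r, c)) A" for A :: "(nat \<times> nat) set" by (auto simp: inj_on_def)
  ultimately have "self_crossings n D (start_pipe n D p) = card {x \<in> ?U. case x of (c, r) \<Rightarrow> ?P r c}"
    unfolding self_crossings_def by (simp add: card_image)
  then have "(- 1 :: int) ^ self_crossings n D (start_pipe n D p) =
      (\<Prod>x\<in>?U. if (case x of (c, r) \<Rightarrow> ?P r c) then - 1 else 1)"
    by (simp add: prod.If_cases Int_def)
  also have "\<dots> = (\<Prod>(c, r)\<in>?U. if ?P r c then - 1 else 1)"
    by (rule prod.cong) (simp_all add: split_def)
  also have "\<dots> = (\<Prod>c\<in>{1..n}. \<Prod>r\<in>{1..2 * c}. if ?P r c then - 1 else 1)"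
    by (simp add: prod.Sigma)
  also have "\<dots> = (\<Prod>k\<in>{1..n}. \<Prod>c\<in>{k..n}. (if ?P (2 * k - 1) c then - 1 else 1) * (if ?P (2 * k) c then - 1 else 1))"
    by (rule prod_rows_pairs)
  finally show ?thesis .
qed

text \<open>Induction over the double rows from the bottom. Below its start, in double row
  \<open>n + 1 - p\<close>, pipe \<open>p\<close> is absent and contributes no self-crossing; it
  starts with the sign -1, and from there on each double row multiplies the sign by the parity of
  its self-crossings in that row.\<close>

lemma top_label_sums:
  assumes L: "labelling n (crossings n D) (pipe_start_label n) H V" and p: "p \<in> {1..n}"
  defines "\<phi> \<equiv> \<lambda>x :: int. if \<bar>x\<bar> = int p then sgn x else 0"
  shows "(\<Sum>c\<in>{1..n}. \<bar>\<phi> (H 1 c)\<bar>) = 1"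
    and "(\<Sum>c\<in>{1..n}. \<phi> (H 1 c)) = - ((- 1) ^ self_crossings n D (start_pipe n D p))"
proof -
  let ?C = "crossings n D"
  define \<tau> where "\<tau> k = (\<Prod>c\<in>{k..n}.
      (if (2 * k - 1, c) \<in> ?C \<and> \<bar>V (2 * k - 1) c\<bar> = int p \<and> \<bar>H (2 * k - 1) c\<bar> = int p then - 1 else 1) *
      (if (2 * k, c) \<in> ?C \<and> \<bar>V (2 * k) c\<bar> = int p \<and> \<bar>H (2 * k) c\<bar> = int p then - 1 else 1 :: int))" for k
  let ?Q = "\<lambda>k. (\<Sum>c\<in>{k..n}. \<bar>\<phi> (H (2 * k - 1) c)\<bar>) = (if k \<le> n + 1 - p then 1 else 0) \<and>
     (\<Sum>c\<in>{k..n}. \<phi> (H (2 * k - 1) c)) = (if k \<le> n + 1 - p then - (\<Prod>i\<in>{k..n}. \<tau> i) else 0) \<and>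
     (k > n + 1 - p \<longrightarrow> (\<Prod>i\<in>{k..n}. \<tau> i) = 1)"
  have "?Q k" if "1 \<le> k" "k \<le> n + 1" for k
    using that(2,1)
  proof (induction k rule: inc_induct)
    case base then show ?case using p by auto
  next
    case (step k)
    then have k: "1 \<le> k" "k \<le> n" by auto
    have diag: "(2 * k, k) \<notin> ?C" using crossings_bounds(4)[of "2 * k" k n D] by auto
    have \<phi>0: "\<phi> 0 = 0" by (simp add: \<phi>_def)
    have split: "{k..n} = insert k {Suc k..n}" using k by auto
    have odd_row: "2 * Suc k - 1 = 2 * k + 1" by simp
    have \<phi>s: "\<phi> (pipe_start_label n k) = (if k = n + 1 - p then - 1 else 0)"
      using k p by (auto simp: \<phi>_def sgn_if)
    have A: "(\<Sum>c\<in>{k..n}. \<bar>\<phi> (H (2 * k + 1) c)\<bar>) = (if Suc k \<le> n + 1 - p then 1 else 0)"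
      and S: "(\<Sum>c\<in>{k..n}. \<phi> (H (2 * k + 1) c)) = (if Suc k \<le> n + 1 - p then - (\<Prod>i\<in>{Suc k..n}. \<tau> i) else 0)"
      and T: "Suc k > n + 1 - p \<longrightarrow> (\<Prod>i\<in>{Suc k..n}. \<tau> i) = 1"
      using step(3) k labelling_ends(2)[OF L k] unfolding odd_row split by (auto simp: \<phi>0)
    have once: "\<bar>\<phi> (pipe_start_label n k)\<bar> + (\<Sum>c\<in>{k..n}. \<bar>\<phi> (H (2 * k + 1) c)\<bar>) \<le> 1"
      unfolding A \<phi>s by auto
    have p0: "0 < int p" using p by simp
    note once' = once[unfolded \<phi>_def]
    have row: "(\<Sum>c\<in>{k..n}. \<phi> (H (2 * k - 1) c)) =
        (\<phi> (pipe_start_label n k) + (\<Sum>c\<in>{k..n}. \<phi> (H (2 * k + 1) c))) * \<tau> k"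
      "(\<Sum>c\<in>{k..n}. \<bar>\<phi> (H (2 * k - 1) c)\<bar>) =
        \<bar>\<phi> (pipe_start_label n k)\<bar> + (\<Sum>c\<in>{k..n}. \<bar>\<phi> (H (2 * k + 1) c)\<bar>)"
      "\<phi> (pipe_start_label n k) + (\<Sum>c\<in>{k..n}. \<phi> (H (2 * k + 1) c)) = 0 \<Longrightarrow> \<tau> k = 1"
      unfolding \<phi>_def \<tau>_def
      by (rule double_row_parity(1)[OF L k diag p0 once'], rule double_row_parity(2)[OF L k diag p0 once'],
          rule double_row_parity(3)[OF L k diag p0 once'])
    have prod: "(\<Prod>i\<in>{k..n}. \<tau> i) = \<tau> k * (\<Prod>i\<in>{Suc k..n}. \<tau> i)" unfolding split by simp
    show ?case
      using row p T unfolding A S \<phi>s prod by (auto simp: mult.commute)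
  qed
  from this[of 1] have Q: "?Q 1" by simp
  have "1 \<le> n + 1 - p" using p by auto
  then show "(\<Sum>c\<in>{1..n}. \<bar>\<phi> (H 1 c)\<bar>) = 1"
    "(\<Sum>c\<in>{1..n}. \<phi> (H 1 c)) = - ((- 1) ^ self_crossings n D (start_pipe n D p))"
    using Q unfolding self_crossings_sign[OF L p] \<tau>_def by auto
qed

section \<open>Reading the end permutation and w_D off the top edges\<close>

lemma top_label_unique:
  assumes L: "labelling n (crossings n D) (pipe_start_label n) H V" and p: "p \<in> {1..n}"
  shows "\<exists>!c. c \<in> {1..n} \<and> \<bar>H 1 c\<bar> = int p"
proof -
  let ?f = "\<lambda>c. \<bar>if \<bar>H 1 c\<bar> = int p then sgn (H 1 c) else 0\<bar>"
  have "?f c = (if \<bar>H 1 c\<bar> = int p then 1 else 0)" for c using p by (auto simp: sgn_if)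
  then have "(\<Sum>c\<in>{1..n}. if \<bar>H 1 c\<bar> = int p then 1 else 0 :: int) = 1"
    using top_label_sums(1)[OF L p] by simp
  then have "card {c \<in> {1..n}. \<bar>H 1 c\<bar> = int p} = 1"
    by (simp add: sum.If_cases Int_def)
  then obtain c where "{c \<in> {1..n}. \<bar>H 1 c\<bar> = int p} = {c}" by (auto simp: card_1_singleton_iff)
  then show ?thesis by (intro ex1I[of _ c]) auto
qed

text \<open>Each absolute value occurs exactly once on the top edges. This gives both the existence
  and the uniqueness required by the definite description in \<open>end_perm\<close>.\<close>

lemma end_perm_top_label:
  assumes L: "labelling n (crossings n D) (pipe_start_label n) H V"
  shows "end_perm n D permutes {1..n}"
    and "p \<in> {1..n} \<Longrightarrow> \<bar>H 1 (n + 1 - end_perm n D p)\<bar> = int p"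
proof -
  define col where "col p = (THE c. c \<in> {1..n} \<and> \<bar>H 1 c\<bar> = int p)" for p
  have col: "col p \<in> {1..n}" "\<bar>H 1 (col p)\<bar> = int p" if "p \<in> {1..n}" for p
    using theI'[OF top_label_unique[OF L that]] by (auto simp: col_def)
  define v where "v p = (if p \<in> {1..n} then n + 1 - col p else p)" for p
  have v_col: "v p \<in> {1..n}" "n + 1 - v p = col p" if "p \<in> {1..n}" for p
    using col(1)[OF that] that by (auto simp: v_def)
  have inj: "inj_on v {1..n}"
    by (rule inj_onI) (metis v_col(2) col(2) of_nat_eq_iff)
  moreover have "v ` {1..n} \<subseteq> {1..n}" using v_col(1) by blast
  ultimately have "bij_betw v {1..n} {1..n}"
    using endo_inj_surj[of "{1..n}" v] by (simp add: bij_betw_def)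
  then have v: "v permutes {1..n}"
    by (rule bij_imp_permutes) (simp add: v_def del: atLeastAtMost_iff)
  have mem: "top_edge (1, n + 1 - u p) \<in> start_pipe n D p \<longleftrightarrow> \<bar>H 1 (n + 1 - u p)\<bar> = int p"
    if "u permutes {1..n}" "p \<in> {1..n}" for u p
    using H_in_start_pipe_iff[OF L that(2), of "n + 1 - u p" 1] permutes_in_image[OF that(1), of p] that(2) by auto
  have "end_perm n D = v"
    unfolding end_perm_def
  proof (rule the_equality)
    show "v permutes {1..n} \<and> (\<forall>k\<in>{1..n}. top_edge (1, n + 1 - v k) \<in> start_pipe n D k)"
    proof (intro conjI ballI v)
      fix k assume k: "k \<in> {1..n}"
      show "top_edge (1, n + 1 - v k) \<in> start_pipe n D k"
        using mem[OF v k] col(2)[OF k] v_col(2)[OF k] by simp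
    qed
    fix u assume u: "u permutes {1..n} \<and> (\<forall>k\<in>{1..n}. top_edge (1, n + 1 - u k) \<in> start_pipe n D k)"
    show "u = v"
    proof
      fix p
      show "u p = v p"
      proof (cases "p \<in> {1..n}")
        case True
        have up: "u p \<in> {1..n}" using permutes_in_image[OF conjunct1[OF u], of p] True by (rule iffD2)
        have "\<bar>H 1 (n + 1 - u p)\<bar> = int p" using mem[OF conjunct1[OF u] True] bspec[OF conjunct2[OF u] True] by (rule iffD1)
        moreover have "n + 1 - u p \<in> {1..n}" using up by auto
        ultimately have "n + 1 - u p = col p"
          using top_label_unique[OF L True] col[OF True] by blast
        then show ?thesis using up True by (auto simp: v_def)
      next
        case False
        then show ?thesis using permutes_not_in[OF conjunct1[OF u] False] by (simp add: v_def del: atLeastAtMost_iff)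
      qed
    qed
  qed
  then show "end_perm n D permutes {1..n}" "p \<in> {1..n} \<Longrightarrow> \<bar>H 1 (n + 1 - end_perm n D p)\<bar> = int p"
    using v v_col(2) col(2) by simp_all
qed

text \<open>Only column \<open>n + 1 - j\<close> has a top label of absolute value \<open>p\<close>,
  so the sum in \<open>top_label_sums\<close> is the sign of this single label.\<close>

lemma dream_elt_pos_eq_label:
  assumes L: "labelling n (crossings n D) (pipe_start_label n) H V" and j: "j \<in> {1..n}"
  shows "dream_elt_pos n D j = H 1 (n + 1 - j)"
proof -
  define p where "p = inv (end_perm n D) j"
  note perm = end_perm_top_label(1)[OF L]
  have p: "p \<in> {1..n}" "end_perm n D p = j"
    using permutes_in_image[OF permutes_inv[OF perm]] permutes_inverses(1)[OF perm] j by (auto simp: p_def)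
  have Hj: "\<bar>H 1 (n + 1 - j)\<bar> = int p" using end_perm_top_label(2)[OF L p(1)] p(2) by simp
  have c: "n + 1 - j \<in> {1..n}" using j by auto
  have "(\<Sum>c\<in>{1..n}. if \<bar>H 1 c\<bar> = int p then sgn (H 1 c) else 0) =
      (\<Sum>c\<in>{1..n}. if c = n + 1 - j then sgn (H 1 c) else 0)"
    using top_label_unique[OF L p(1)] Hj c by (intro sum.cong) auto
  then have "sgn (H 1 (n + 1 - j)) = - ((- 1) ^ self_crossings n D (start_pipe n D p))"
    using top_label_sums(2)[OF L p(1)] c by simp
  then have "H 1 (n + 1 - j) = - ((- 1) ^ self_crossings n D (start_pipe n D p)) * int p"
    using Hj by (metis mult_sgn_abs mult.commute abs_of_nat)
  then show ?thesis by (simp add: dream_elt_pos_def end_pipe_def p_def)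
qed

section \<open>Ladders\<close>

text \<open>Two columns \<open>c\<close> and \<open>c + 1\<close> whose tiles in the rows strictly between \<open>t\<close> and \<open>b\<close> are all
  crossings: switching the first tile of row \<open>b\<close> (in the direction of flow) exchanges the two
  vertical strands of the strip, and switching the last tile of row \<open>t\<close> exchanges them back.\<close>

lemma labelling_toggle_two_columns:
  assumes L: "labelling n C s H V" and c: "1 \<le> c" "c < n" and tb: "1 \<le> t" "t < b" "b \<le> 2 * c"
    and mid: "\<And>r. t < r \<Longrightarrow> r < b \<Longrightarrow> (r, c) \<in> C \<and> (r, c + 1) \<in> C"
    and b_out: "(b, outflow b c) \<notin> C" and t_in: "(t, inflow t c) \<notin> C"
    and b_in: "(b, inflow b c) \<in> C \<longleftrightarrow> (b, inflow b c) \<notin> C'"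
    and t_out: "(t, outflow t c) \<in> C \<longleftrightarrow> (t, outflow t c) \<notin> C'"
    and same: "\<And>x. x \<noteq> (b, inflow b c) \<Longrightarrow> x \<noteq> (t, outflow t c) \<Longrightarrow> x \<in> C \<longleftrightarrow> x \<in> C'"
  shows "\<exists>H' V'. labelling n C' s H' V' \<and> H' 1 = H 1"
proof -
  define H' where "H' r = (if t < r \<and> r \<le> b then (H r)(c := H r (c + 1), c + 1 := H r c) else H r)" for r
  \<comment> \<open>Only the edge shared by the two columns changes in rows \<open>b\<close> and
    \<open>t\<close>. In row \<open>b\<close> it is joined to the top edge of the second box, in row
    \<open>t\<close> to the bottom edge of the first; at these edges the two vertical labels have
    been exchanged.\<close>
  define V' where "V' r = (if r = b then (V r)(c + 1 := H b (inflow b c))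
      else if r = t then (V r)(c + 1 := H (t + 1) (outflow t c)) else V r)" for r
  have ok: "tile_ok C H V r c'" if "1 \<le> c'" "c' \<le> n" "1 \<le> r" "r \<le> 2 * c'" for r c'
    using labelling_tile[OF L that] .
  have "tile_ok C' H' V' r c'" if c': "c' \<in> {1..n}" and r: "r \<in> {1..2 * c'}" for r c'
  proof -
    have old: "tile_ok C H V r c'" using ok c' r by simp
    consider "r < t" | "r > b" | "t \<le> r" "r \<le> b" "c' \<noteq> c" "c' \<noteq> c + 1"
      | "t < r" "r < b" "c' = c \<or> c' = c + 1" | "r = b" "c' = c \<or> c' = c + 1" | "r = t" "c' = c \<or> c' = c + 1"
      by linarith
    then show ?thesis
    proof cases
      case 1
      then have "H' r = H r" "H' (r + 1) = H (r + 1)" "V' r = V r" "(r, c') \<in> C \<longleftrightarrow> (r, c') \<in> C'"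
        using tb same[of "(r, c')"] by (auto simp: H'_def V'_def)
      then show ?thesis using old by (simp add: tile_ok_def)
    next
      case 2
      then have "H' r = H r" "H' (r + 1) = H (r + 1)" "V' r = V r" "(r, c') \<in> C \<longleftrightarrow> (r, c') \<in> C'"
        using tb same[of "(r, c')"] by (auto simp: H'_def V'_def)
      then show ?thesis using old by (simp add: tile_ok_def)
    next
      case 3
      then have "(r, c') \<in> C \<longleftrightarrow> (r, c') \<in> C'"
        using same[of "(r, c')"] by (auto simp: inflow_def outflow_def split: if_splits)
      moreover have "H' r c' = H r c'" "H' (r + 1) c' = H (r + 1) c'"
        using 3 by (auto simp: H'_def)
      moreover have "V' r (inflow r c') = V r (inflow r c')" "V' r (outflow r c') = V r (outflow r c')"
        using 3 by (auto simp: V'_def inflow_def outflow_def)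
      ultimately show ?thesis using old by (simp add: tile_ok_def)
    next
      case 4
      then have C: "(r, c') \<in> C" and C': "(r, c') \<in> C'" using mid[of r] same[of "(r, c')"] by auto
      have "V' r = V r" using 4 by (auto simp: V'_def)
      moreover have "H r c = H (r + 1) c" "H r (c + 1) = H (r + 1) (c + 1)"
        using ok[of c r] ok[of "c + 1" r] mid[of r] 4 c tb by (auto simp: tile_ok_def)
      ultimately show ?thesis using old C C' 4 by (auto simp: tile_ok_def H'_def)
    next
      case 5
      have t: "tile_ok C H V b c" "tile_ok C H V b (c + 1)" using ok c tb by auto
      have "(b, outflow b c) \<notin> C'" using same[of "(b, outflow b c)"] b_out tb
        by (auto simp: inflow_def outflow_def split: if_splits)
      then show ?thesis
        using 5 t b_in b_out tb unfolding tile_ok_def H'_def V'_def inflow_def outflow_def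
        by (cases "odd b"; cases "(b, inflow b c) \<in> C") (auto simp: inflow_def)
    next
      case 6
      have t: "tile_ok C H V t c" "tile_ok C H V t (c + 1)" using ok c tb by auto
      have "(t, inflow t c) \<notin> C'" using same[of "(t, inflow t c)"] t_in tb
        by (auto simp: inflow_def outflow_def split: if_splits)
      then show ?thesis
        using 6 t t_out t_in tb unfolding tile_ok_def H'_def V'_def inflow_def outflow_def
        by (cases "odd t"; cases "(t, outflow t c) \<in> C") (auto simp: outflow_def)
    qed
  qed
  moreover have "V' (2 * k - 1) k = s k \<and> H' (2 * k + 1) k = 0 \<and> V' (2 * k) (n + 1) = - V' (2 * k - 1) (n + 1)"
    if k: "k \<in> {1..n}" for k
  proof -
    have "V' (2 * k - 1) k = V (2 * k - 1) k" using tb k by (auto simp: V'_def)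
    moreover have "H' (2 * k + 1) k = H (2 * k + 1) k" using tb by (auto simp: H'_def)
    moreover have "V' r (n + 1) = V r (n + 1)" for r using c by (auto simp: V'_def)
    ultimately show ?thesis using labelling_ends[OF L, of k] k by simp
  qed
  ultimately have "labelling n C' s H' V'" unfolding labelling_def by blast
  moreover have "H' 1 = H 1" using tb by (simp add: H'_def)
  ultimately show ?thesis by blast
qed

text \<open>The same for the last column, where the two vertical strands are the two directions of a single one:
  a switch at either end changes its sign.\<close>

lemma labelling_toggle_last_column:
  assumes L: "labelling n C s H V" and ab: "1 \<le> a" "a < b" "b \<le> n"
    and mid: "\<And>k. a < k \<Longrightarrow> k < b \<Longrightarrow> (2 * k - 1, n) \<in> C \<and> (2 * k, n) \<in> C"
    and b_even: "(2 * b, n) \<notin> C" and a_odd: "(2 * a - 1, n) \<notin> C"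
    and b_odd: "(2 * b - 1, n) \<in> C \<longleftrightarrow> (2 * b - 1, n) \<notin> C'"
    and a_even: "(2 * a, n) \<in> C \<longleftrightarrow> (2 * a, n) \<notin> C'"
    and same: "\<And>x. x \<noteq> (2 * b - 1, n) \<Longrightarrow> x \<noteq> (2 * a, n) \<Longrightarrow> x \<in> C \<longleftrightarrow> x \<in> C'"
  shows "\<exists>H' V'. labelling n C' s H' V' \<and> H' 1 = H 1"
proof -
  \<comment> \<open>\<open>\<alpha>\<close> and \<open>\<beta>\<close> are the new labels of the
    middle edges of the double rows \<open>a\<close> and \<open>b\<close>. Without a crossing at the
    switched tile the middle edge lies on a closed loop through the U-turn, so its label equals its
    own negative and is 0; with a crossing it continues the vertical strand, whose sign is changed
    between the two ends.\<close>
  define \<alpha> where "\<alpha> = (if (2 * a, n) \<in> C' then - H (2 * a + 1) n else 0)"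
  define \<beta> where "\<beta> = (if (2 * b - 1, n) \<in> C' then - H (2 * b - 1) n else 0)"
  define H' where "H' r = (if r = 2 * a then (H r)(n := \<alpha>) else if r = 2 * b then (H r)(n := \<beta>)
      else if 2 * a < r \<and> r < 2 * b then (H r)(n := - H r n) else H r)" for r
  define V' where "V' r = (if r = 2 * a - 1 then (V r)(n + 1 := \<alpha>) else if r = 2 * a then (V r)(n + 1 := - \<alpha>)
      else if r = 2 * b - 1 then (V r)(n + 1 := - \<beta>) else if r = 2 * b then (V r)(n + 1 := \<beta>) else V r)" for r
  have C'_b: "(2 * b, n) \<notin> C'" using same[of "(2 * b, n)"] b_even ab by auto
  have C'_a: "(2 * a - 1, n) \<notin> C'" using same[of "(2 * a - 1, n)"] a_odd ab by auto
  note tile = labelling_tile[OF L]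
  have "tile_ok C' H' V' r c" if c: "c \<in> {1..n}" and r: "r \<in> {1..2 * c}" for r c
  proof (cases "c = n")
    case False
    have "(r, c) \<in> C \<longleftrightarrow> (r, c) \<in> C'" using same[of "(r, c)"] False by auto
    moreover have "H' r c = H r c" "H' (r + 1) c = H (r + 1) c" using False by (auto simp: H'_def)
    moreover have "V' r (inflow r c) = V r (inflow r c)" "V' r (outflow r c) = V r (outflow r c)"
      using c False by (auto simp: V'_def inflow_def outflow_def)
    ultimately show ?thesis using tile[of c r] c r by (simp add: tile_ok_def)
  next
    case True
    have old: "tile_ok C H V r n" using tile[of n r] c r True by simp
    have "1 \<le> r" using r by simp
    then obtain k where k: "1 \<le> k" "r = 2 * k - 1 \<or> r = 2 * k"
      by (cases rule: row_parity) (use that in blast)+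
    then have kn: "k \<le> n" using r True by auto
    note odd_k = labelling_odd[OF L k(1) kn order.refl] and even_k = labelling_even[OF L k(1) kn order.refl]
    note ends_k = labelling_ends[OF L k(1) kn]
    have new: "(if (2 * k - 1, n) \<in> C' then V' (2 * k - 1) (n + 1) = V' (2 * k - 1) n \<and> H' (2 * k - 1) n = H' (2 * k) n
         else H' (2 * k - 1) n = V' (2 * k - 1) n \<and> V' (2 * k - 1) (n + 1) = H' (2 * k) n) \<and>
       (if (2 * k, n) \<in> C' then V' (2 * k) n = V' (2 * k) (n + 1) \<and> H' (2 * k) n = H' (2 * k + 1) n
         else H' (2 * k) n = V' (2 * k) (n + 1) \<and> V' (2 * k) n = H' (2 * k + 1) n)"
    proof -
      have par: "2 * i \<noteq> 2 * j - 1" if "1 \<le> j" for i j :: nat using that by presburger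
      consider "k < a" | "k > b" | "a < k" "k < b" | "k = a" | "k = b" by linarith
      then show ?thesis
      proof cases
        case 1
        then have "(2 * k - 1, n) \<in> C \<longleftrightarrow> (2 * k - 1, n) \<in> C'" "(2 * k, n) \<in> C \<longleftrightarrow> (2 * k, n) \<in> C'"
          using same[of "(2 * k - 1, n)"] same[of "(2 * k, n)"] ab k by auto
        moreover have "H' (2 * k - 1) = H (2 * k - 1)" "H' (2 * k) = H (2 * k)" "H' (2 * k + 1) = H (2 * k + 1)"
          "V' (2 * k - 1) = V (2 * k - 1)" "V' (2 * k) = V (2 * k)"
          using 1 ab k by (auto simp: H'_def V'_def)
        ultimately show ?thesis using odd_k even_k by (simp only: if_True if_False neg_equal_iff_equal minus_minus simp_thms)
      next
        case 2
        then have "(2 * k - 1, n) \<in> C \<longleftrightarrow> (2 * k - 1, n) \<in> C'" "(2 * k, n) \<in> C \<longleftrightarrow> (2 * k, n) \<in> C'"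
          using same[of "(2 * k - 1, n)"] same[of "(2 * k, n)"] ab k by auto
        moreover have "H' (2 * k - 1) = H (2 * k - 1)" "H' (2 * k) = H (2 * k)" "H' (2 * k + 1) = H (2 * k + 1)"
          "V' (2 * k - 1) = V (2 * k - 1)" "V' (2 * k) = V (2 * k)"
          using 2 ab k by (auto simp: H'_def V'_def)
        ultimately show ?thesis using odd_k even_k by (simp only: if_True if_False neg_equal_iff_equal minus_minus simp_thms)
      next
        case 3
        then have "(2 * k - 1, n) \<in> C" "(2 * k, n) \<in> C" "(2 * k - 1, n) \<in> C'" "(2 * k, n) \<in> C'"
          using mid[of k] same[of "(2 * k - 1, n)"] same[of "(2 * k, n)"] ab k par[of b k] par[of k a] by auto
        moreover have "H' (2 * k - 1) n = - H (2 * k - 1) n" "H' (2 * k) n = - H (2 * k) n" "H' (2 * k + 1) n = - H (2 * k + 1) n"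
          "V' (2 * k - 1) = V (2 * k - 1)" "V' (2 * k) = V (2 * k)"
          using 3 ab k by (auto simp: H'_def V'_def)
        ultimately show ?thesis using odd_k even_k by (simp only: if_True if_False neg_equal_iff_equal minus_minus simp_thms)
      next
        case 4
        have "H' (2 * k - 1) n = H (2 * k - 1) n" "H' (2 * k) n = \<alpha>" "H' (2 * k + 1) n = - H (2 * k + 1) n"
          "V' (2 * k - 1) n = V (2 * k - 1) n" "V' (2 * k - 1) (n + 1) = \<alpha>"
          "V' (2 * k) n = V (2 * k) n" "V' (2 * k) (n + 1) = - \<alpha>"
          using 4 ab k by (auto simp: H'_def V'_def)
        then show ?thesis using odd_k even_k ends_k C'_a a_odd a_even 4 unfolding \<alpha>_def
          by (cases "(2 * a, n) \<in> C'") simp_all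
      next
        case 5
        have "H' (2 * k - 1) n = - H (2 * k - 1) n" "H' (2 * k) n = \<beta>" "H' (2 * k + 1) n = H (2 * k + 1) n"
          "V' (2 * k - 1) n = V (2 * k - 1) n" "V' (2 * k - 1) (n + 1) = - \<beta>"
          "V' (2 * k) n = V (2 * k) n" "V' (2 * k) (n + 1) = \<beta>"
          using 5 ab k by (auto simp: H'_def V'_def)
        then show ?thesis using odd_k even_k ends_k C'_b b_odd b_even 5 unfolding \<beta>_def
          by (cases "(2 * b - 1, n) \<in> C'") simp_all
      qed
    qed
    show ?thesis
    proof (cases "r = 2 * k")
      case True
      then have "even r" by simp
      with new True \<open>c = n\<close> show ?thesis unfolding tile_ok_def inflow_def outflow_def
        by (simp split: if_splits)
    next
      case False
      then have "odd r" "r = 2 * k - 1" "r + 1 = 2 * k" using k by auto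
      with new \<open>c = n\<close> show ?thesis unfolding tile_ok_def inflow_def outflow_def
        by (simp split: if_splits)
    qed
  qed
  moreover have "V' (2 * k - 1) k = s k \<and> H' (2 * k + 1) k = 0 \<and> V' (2 * k) (n + 1) = - V' (2 * k - 1) (n + 1)"
    if k: "k \<in> {1..n}" for k
  proof -
    have "V' (2 * k - 1) k = V (2 * k - 1) k" using k by (auto simp: V'_def)
    moreover have "H' (2 * k + 1) k = H (2 * k + 1) k" using ab by (auto simp: H'_def)
    moreover have "V' (2 * k) (n + 1) = - V' (2 * k - 1) (n + 1)"
    proof -
      consider "k = a" | "k = b" | "k \<noteq> a" "k \<noteq> b" by blast
      then show ?thesis using ab k labelling_ends(3)[OF L, of k]
        by cases (auto simp: V'_def)
    qed
    ultimately show ?thesis using labelling_ends[OF L, of k] k by simp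
  qed
  ultimately have "labelling n C' s H' V'" unfolding labelling_def by blast
  moreover have "H' 1 = H 1" using ab by (auto simp: H'_def)
  ultimately show ?thesis by blast
qed

section \<open>Boxes of \<open>SY n\<close> and tiles of the path model\<close>

lemma SY_iff: "(i, j) \<in> SY n \<longleftrightarrow> 1 \<le> i \<and> i \<le> n \<and> i \<le> j \<and> i + j \<le> 2 * n"
  by (auto simp: SY_def)

lemma finite_SY: "finite (SY n)"
  by (rule finite_subset[of _ "{0..n} \<times> {0..2 * n}"]) (auto simp: SY_def)

text \<open>Row \<open>a\<close> is folded at column \<open>n\<close>: its left half becomes the odd
  row \<open>2a - 1\<close>, and its right half is reflected into the even row
  \<open>2a\<close>.\<close>

definition tile_of :: "nat \<Rightarrow> box \<Rightarrow> box" where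
  "tile_of n x = (case x of (a, b) \<Rightarrow> if b \<le> n then (2 * a - 1, b) else (2 * a, 2 * n + 1 - b))"

lemma inj_on_tile_of: "inj_on (tile_of n) (SY n)"
proof (rule inj_onI)
  fix x y assume "x \<in> SY n" "y \<in> SY n" and eq: "tile_of n x = tile_of n y"
  moreover obtain a b a' b' where "x = (a, b)" "y = (a', b')" by force
  moreover have "2 * i - 1 \<noteq> 2 * j" if "1 \<le> i" for i j :: nat using that by presburger
  ultimately show "x = y" by (auto simp: tile_of_def SY_iff split: if_splits) (metis+)
qed

lemma crossings_eq_image:
  assumes "D \<subseteq> SY n" shows "crossings n D = tile_of n ` D"
proof
  show "crossings n D \<subseteq> tile_of n ` D"
  proof
    fix x assume "x \<in> crossings n D"
    then consider k j where "x = (2 * k - 1, j)" "j \<le> n" "(k, j) \<in> D"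
      | k j where "x = (2 * k, j)" "j \<le> n" "(k, 2 * n + 1 - j) \<in> D"
      by (auto simp: crossings_def)
    then show "x \<in> tile_of n ` D"
    proof cases
      case 1
      then show ?thesis by (intro image_eqI[of _ _ "(k, j)"]) (auto simp: tile_of_def)
    next
      case 2
      then show ?thesis by (intro image_eqI[of _ _ "(k, 2 * n + 1 - j)"]) (auto simp: tile_of_def)
    qed
  qed
  show "tile_of n ` D \<subseteq> crossings n D"
  proof
    fix x assume "x \<in> tile_of n ` D"
    then obtain a b where ab: "(a, b) \<in> D" "x = tile_of n (a, b)" by auto
    then have SY: "1 \<le> a" "a \<le> n" "a \<le> b" "a + b \<le> 2 * n" using assms by (auto simp: SY_iff)
    show "x \<in> crossings n D"
    proof (cases "b \<le> n")
      case True
      then show ?thesis using ab SY unfolding crossings_def tile_of_def by auto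
    next
      case False
      then have "2 * n + 1 - (2 * n + 1 - b) = b" "a + 1 \<le> 2 * n + 1 - b" "2 * n + 1 - b \<le> n" using SY by auto
      then have "(2 * a, 2 * n + 1 - b) \<in> crossings n D"
        using ab SY unfolding crossings_def by fastforce
      then show ?thesis using ab False by (simp add: tile_of_def)
    qed
  qed
qed

lemma tile_of_in_crossings_iff:
  assumes "D \<subseteq> SY n" "x \<in> SY n" shows "tile_of n x \<in> crossings n D \<longleftrightarrow> x \<in> D"
  unfolding crossings_eq_image[OF assms(1)] using inj_on_image_mem_iff[OF inj_on_tile_of assms(2,1)] .

lemma dream_elt_cong:
  assumes "\<And>j. j \<in> {1..n} \<Longrightarrow> dream_elt_pos n D j = dream_elt_pos n D' j"
  shows "dream_elt n D = dream_elt n D'"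
proof
  fix x
  have "0 < x \<Longrightarrow> nat x \<in> {1..n}" "\<not> 0 < x \<Longrightarrow> nat (- x) \<in> {1..n}" if "x \<in> signed_idx n"
    using that by (auto simp: signed_idx_def)
  then show "dream_elt n D x = dream_elt n D' x" using assms by (auto simp: dream_elt_def)
qed

lemma dream_elt_eqI:
  assumes "labelling n (crossings n D) (pipe_start_label n) H V"
    and "labelling n (crossings n D') (pipe_start_label n) H' V'" and "H' 1 = H 1"
  shows "dream_elt n D = dream_elt n D'"
  by (rule dream_elt_cong) (simp only: dream_elt_pos_eq_label[OF assms(1)] dream_elt_pos_eq_label[OF assms(2)] assms(3))

text \<open>\<open>weight\<close> is monotone along the list of boxes.\<close>

definition weight :: "nat \<Rightarrow> box \<Rightarrow> nat" where
  "weight n x = (case x of (a, b) \<Rightarrow> (n - a) * (2 * n) + (2 * n - b) + 1)"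

lemma weight_less_iff:
  assumes "(a, b) \<in> SY n" "(p, q) \<in> SY n"
  shows "weight n (a, b) < weight n (p, q) \<longleftrightarrow> p < a \<or> p = a \<and> q < b"
proof -
  have lt: "weight n (a, b) < weight n (p, q)" if "p < a" "a \<le> n" "1 \<le> b" "b \<le> 2 * n" for a b p q
  proof -
    have "(n - a) + 1 \<le> n - p" using that by auto
    then have "((n - a) + 1) * (2 * n) \<le> (n - p) * (2 * n)" by (rule mult_right_mono) simp
    then have "(n - a) * (2 * n) + 2 * n \<le> (n - p) * (2 * n)" by (simp add: algebra_simps)
    then show ?thesis using that unfolding weight_def by simp
  qed
  have "p < a \<Longrightarrow> weight n (a, b) < weight n (p, q)" "a < p \<Longrightarrow> weight n (p, q) < weight n (a, b)"
    using lt assms by (auto simp: SY_iff)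
  moreover have "p = a \<Longrightarrow> weight n (a, b) < weight n (p, q) \<longleftrightarrow> q < b"
    using assms by (auto simp: weight_def SY_iff)
  ultimately show ?thesis by (cases p a rule: linorder_cases) auto
qed

text \<open>The hypotheses only ask that membership changes at both ends, so that ladder moves,
  their inverses and the joint deletion of two crossings are covered at once.\<close>

lemma dream_elt_toggle:
  assumes D: "D \<subseteq> SY n" and D': "D' \<subseteq> SY n" and x: "(i, j) \<in> SY n" and y: "(p, q) \<in> SY n" "(p, q + 1) \<in> SY n"
    and less: "weight n (i, j) < weight n (p, q)" and col: "q \<in> {j, 2 * n - j}"
    and right: "(i, j + 1) \<notin> D" and left: "(p, q) \<notin> D"
    and mid: "\<And>a b. (a, b) \<in> SY n \<Longrightarrow> b \<in> {j, 2 * n - j} \<Longrightarrow> weight n (i, j) < weight n (a, b) \<Longrightarrow>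
      weight n (a, b) < weight n (p, q) \<Longrightarrow> (a, b) \<in> D \<and> (a, b + 1) \<in> D"
    and x_iff: "(i, j) \<in> D \<longleftrightarrow> (i, j) \<notin> D'" and y_iff: "(p, q + 1) \<in> D \<longleftrightarrow> (p, q + 1) \<notin> D'"
    and same: "\<And>z. z \<noteq> (i, j) \<Longrightarrow> z \<noteq> (p, q + 1) \<Longrightarrow> z \<in> D \<longleftrightarrow> z \<in> D'"
  shows "dream_elt n D = dream_elt n D'"
proof -
  let ?C = "crossings n D" and ?C' = "crossings n D'"
  obtain H V where L: "labelling n ?C (pipe_start_label n) H V" using labelling_exists by blast
  have C_same: "z \<in> ?C \<longleftrightarrow> z \<in> ?C'" if "z \<noteq> tile_of n (i, j)" "z \<noteq> tile_of n (p, q + 1)" for z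
  proof -
    have "tile_of n x \<noteq> z \<or> (x \<in> D \<longleftrightarrow> x \<in> D')" for x using that same[of x] by auto
    then show ?thesis unfolding crossings_eq_image[OF D] crossings_eq_image[OF D'] by blast
  qed
  have C_x: "tile_of n (i, j) \<in> ?C \<longleftrightarrow> tile_of n (i, j) \<notin> ?C'"
    using x_iff tile_of_in_crossings_iff[OF D x] tile_of_in_crossings_iff[OF D' x] by simp
  have C_y: "tile_of n (p, q + 1) \<in> ?C \<longleftrightarrow> tile_of n (p, q + 1) \<notin> ?C'"
    using y_iff tile_of_in_crossings_iff[OF D y(2)] tile_of_in_crossings_iff[OF D' y(2)] by simp
  have odd_in: "(2 * k - 1, c) \<in> ?C \<longleftrightarrow> (k, c) \<in> D" if "1 \<le> k" "c \<le> n" for k c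
  proof
    assume "(2 * k - 1, c) \<in> ?C"
    moreover have "2 * k - 1 \<noteq> 2 * k'" for k' using that by presburger
    ultimately obtain k' where "2 * k - 1 = 2 * k' - 1" "1 \<le> k'" "(k', c) \<in> D" by (auto simp: crossings_def)
    moreover from this have "k' = k" using that by simp
    ultimately show "(k, c) \<in> D" by simp
  next
    assume "(k, c) \<in> D"
    then have "tile_of n (k, c) \<in> ?C" using D tile_of_in_crossings_iff[OF D] by auto
    then show "(2 * k - 1, c) \<in> ?C" using that by (simp add: tile_of_def)
  qed
  have even_in: "(2 * k, c) \<in> ?C \<longleftrightarrow> (k, 2 * n + 1 - c) \<in> D" if "1 \<le> k" "c \<le> n" for k c
  proof
    assume "(2 * k, c) \<in> ?C"
    moreover have "2 * k \<noteq> 2 * k' - 1" if "1 \<le> k'" for k' using that by presburger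
    ultimately show "(k, 2 * n + 1 - c) \<in> D" by (auto simp: crossings_def)
  next
    assume "(k, 2 * n + 1 - c) \<in> D"
    then have "tile_of n (k, 2 * n + 1 - c) \<in> ?C" using D tile_of_in_crossings_iff[OF D] by auto
    moreover have "tile_of n (k, 2 * n + 1 - c) = (2 * k, c)" using that by (auto simp: tile_of_def)
    ultimately show "(2 * k, c) \<in> ?C" by simp
  qed
  note SY = x[unfolded SY_iff] y[unfolded SY_iff]
  have less': "p < i \<or> p = i \<and> q < j" using less weight_less_iff[OF x y(1)] by simp
  have "\<exists>H' V'. labelling n ?C' (pipe_start_label n) H' V' \<and> H' 1 = H 1"
  proof (cases "j = n")
    case True
    then have q: "q = n" and pi: "p < i" using col less' by auto
    have tx: "tile_of n (i, j) = (2 * i - 1, n)" and ty: "tile_of n (p, q + 1) = (2 * p, n)"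
      using True q by (auto simp: tile_of_def)
    show ?thesis
    proof (rule labelling_toggle_last_column[OF L, where a = p and b = i])
      fix k assume k: "p < k" "k < i"
      then have kn: "(k, n) \<in> SY n" using SY by (auto simp: SY_iff)
      have "weight n (i, j) < weight n (k, n)" "weight n (k, n) < weight n (p, q)"
        using k weight_less_iff[OF x kn] weight_less_iff[OF kn y(1)] by auto
      then have "(k, n) \<in> D" "(k, n + 1) \<in> D" using mid[OF kn] True by auto
      then show "(2 * k - 1, n) \<in> ?C \<and> (2 * k, n) \<in> ?C" using odd_in[of k n] even_in[of k n] k by auto
    next
      show "(2 * i, n) \<notin> ?C" using even_in[of i n] right True SY by auto
      show "(2 * p - 1, n) \<notin> ?C" using odd_in[of p n] left q SY by auto
        next
      show "1 \<le> p" "p < i" "i \<le> n" using SY pi by auto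
    qed (rule C_x[unfolded tx] C_y[unfolded ty] C_same[unfolded tx ty]; assumption)+
  next
    case False
    \<comment> \<open>Folding sends the columns \<open>c\<close>, \<open>c + 1\<close> and also
      \<open>2n - c\<close>, \<open>2n - c + 1\<close> to the strip \<open>c\<close>,
      \<open>c + 1\<close>, the second pair in reverse order. As even rows flow backwards, the left
      box of a pair is always the first one in the direction of flow.\<close>
    define c where "c = min j (2 * n - j)"
    have c: "1 \<le> c" "c < n" "i \<le> c" "j = c \<or> j = 2 * n - c" "q = c \<or> q = 2 * n - c" "p \<le> c"
      "{j, 2 * n - j} = {c, 2 * n - c}"
      using False SY col by (auto simp: c_def)
    define row where "row a b = (if b \<le> n then 2 * a - 1 else 2 * a)" for a b :: nat
    have tx: "tile_of n (i, j) = (row i j, inflow (row i j) c)"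
      using c SY by (auto simp: tile_of_def row_def inflow_def)
    have ty: "tile_of n (p, q + 1) = (row p q, outflow (row p q) c)"
      using c SY by (auto simp: tile_of_def row_def outflow_def)
    show ?thesis
    proof (rule labelling_toggle_two_columns[OF L c(1,2), where t = "row p q" and b = "row i j"])
      show "1 \<le> row p q" "row i j \<le> 2 * c" using SY c by (auto simp: row_def)
      show "row p q < row i j" using less' c SY by (auto simp: row_def)
      show "(row i j, outflow (row i j) c) \<notin> ?C"
        using right c SY odd_in[of i "c + 1"] even_in[of i c] by (auto simp: row_def outflow_def Suc_diff_le)
      show "(row p q, inflow (row p q) c) \<notin> ?C"
        using left c SY odd_in[of p c] even_in[of p "c + 1"] by (auto simp: row_def inflow_def)
      fix r assume r: "row p q < r" "r < row i j"
      then have "1 \<le> r" by simp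
      then show "(r, c) \<in> ?C \<and> (r, c + 1) \<in> ?C"
      proof (cases rule: row_parity)
        case (1 k)
        then have k: "k \<le> i" "p < k \<or> p = k \<and> q < c" "k < i \<or> k = i \<and> c < j"
          using r c SY by (auto simp: row_def split: if_splits)
        then have kc: "(k, c) \<in> SY n" using 1 c SY by (auto simp: SY_iff)
        have "weight n (i, j) < weight n (k, c)" "weight n (k, c) < weight n (p, q)"
          using k weight_less_iff[OF x kc] weight_less_iff[OF kc y(1)] by auto
        then have "(k, c) \<in> D" "(k, c + 1) \<in> D" using mid[OF kc] c(7) by auto
        then show ?thesis using odd_in[of k c] odd_in[of k "c + 1"] 1 c by auto
      next
        case (2 k)
        then have k: "k \<le> i" "p < k \<or> p = k \<and> q < 2 * n - c" "k < i \<or> k = i \<and> 2 * n - c < j"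
          using r c SY by (auto simp: row_def split: if_splits)
        then have kc: "(k, 2 * n - c) \<in> SY n" using 2 c SY by (auto simp: SY_iff)
        have "weight n (i, j) < weight n (k, 2 * n - c)" "weight n (k, 2 * n - c) < weight n (p, q)"
          using k weight_less_iff[OF x kc] weight_less_iff[OF kc y(1)] by auto
        then have "(k, 2 * n - c) \<in> D" "(k, 2 * n - c + 1) \<in> D" using mid[OF kc] c(7) by auto
        then show ?thesis using even_in[of k c] even_in[of k "c + 1"] 2 c by (auto simp: Suc_diff_le)
      qed
    qed (rule C_x[unfolded tx] C_y[unfolded ty] C_same[unfolded tx ty]; assumption)+
  qed
  then show ?thesis using dream_elt_eqI[OF L] by blast
qed

section \<open>Reduction to left-justified diagrams\<close>

text \<open>A ladder move with positions in the list of boxes replaced by weights, which increase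
  along the list; \<open>ladder_move_iff_box_ladder\<close> compares the two forms.\<close>

definition box_ladder :: "nat \<Rightarrow> box set \<Rightarrow> box set \<Rightarrow> bool" where
  "box_ladder n D E \<longleftrightarrow>
     (\<exists>i j p q. (i, j) \<in> SY n \<and> (p, q) \<in> SY n \<and> (p, q + 1) \<in> SY n \<and>
        weight n (i, j) < weight n (p, q) \<and> q \<in> {j, 2 * n - j} \<and>
        (i, j) \<in> D \<and> (i, j + 1) \<notin> D \<and> (p, q) \<notin> D \<and> (p, q + 1) \<notin> D \<and>
        (\<forall>a b. (a, b) \<in> SY n \<and> b \<in> {j, 2 * n - j} \<and> weight n (i, j) < weight n (a, b) \<and>
           weight n (a, b) < weight n (p, q) \<longrightarrow> (a, b) \<in> D \<and> (a, b + 1) \<in> D) \<and>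
        E = (D \<union> {(p, q + 1)}) - {(i, j)})"

lemma box_ladder_preserves:
  assumes D: "D \<subseteq> SY n" and ladder: "box_ladder n D E"
  shows "E \<subseteq> SY n" "dream_elt n E = dream_elt n D" "card E = card D"
proof -
  obtain i j p q where *: "(i, j) \<in> SY n" "(p, q) \<in> SY n" "(p, q + 1) \<in> SY n"
    "weight n (i, j) < weight n (p, q)" "q \<in> {j, 2 * n - j}"
    "(i, j) \<in> D" "(i, j + 1) \<notin> D" "(p, q) \<notin> D" "(p, q + 1) \<notin> D"
    "\<And>a b. (a, b) \<in> SY n \<Longrightarrow> b \<in> {j, 2 * n - j} \<Longrightarrow> weight n (i, j) < weight n (a, b) \<Longrightarrow>
       weight n (a, b) < weight n (p, q) \<Longrightarrow> (a, b) \<in> D \<and> (a, b + 1) \<in> D"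
    "E = (D \<union> {(p, q + 1)}) - {(i, j)}"
    using ladder unfolding box_ladder_def by blast
  have ne: "(p, q + 1) \<noteq> (i, j)" using *(6,9) by metis
  show "E \<subseteq> SY n" using D * by auto
  have "dream_elt n D = dream_elt n E"
    by (rule dream_elt_toggle[OF D \<open>E \<subseteq> SY n\<close> *(1,2,3,4,5,7,8)]) (use *(6,9,10,11) ne in auto)
  then show "dream_elt n E = dream_elt n D" by simp
  have fin: "finite D" using D finite_SY finite_subset by blast
  have "E = insert (p, q + 1) (D - {(i, j)})" using * ne by auto
  then have "card E = Suc (card (D - {(i, j)}))" using fin *(9) by simp
  also have "\<dots> = card D" using card.remove[OF fin *(6)] by simp
  finally show "card E = card D" .
qed

definition left_justified :: "nat \<Rightarrow> box set \<Rightarrow> bool" where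
  "left_justified n D \<longleftrightarrow> (\<forall>p q. (p, q) \<in> SY n \<and> (p, q + 1) \<in> D \<longrightarrow> (p, q) \<in> D)"

text \<open>Take the earliest gap \<open>(p, q)\<close> whose right neighbour is in
  \<open>D\<close>, and the last earlier pair in columns \<open>q\<close> or \<open>2n - q\<close>
  that does not consist of two crossings. By minimality of the gap the right box of this pair is
  empty. If the left box is empty too, \<open>(p, q + 1)\<close> can be moved there by an inverse
  ladder move; otherwise the two crossings at the ends are deleted.\<close>

lemma reduction_step:
  assumes D: "D \<subseteq> SY n" and not_left: "\<not> left_justified n D"
  shows "\<exists>D'\<subseteq>SY n. dream_elt n D' = dream_elt n D \<and> sum (weight n) D' < sum (weight n) D \<and>
    (box_ladder n D' D \<or> card D' < card D)"
proof -
  let ?w = "weight n"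
  let ?bad = "\<lambda>x. x \<in> SY n \<and> x \<notin> D \<and> (fst x, snd x + 1) \<in> D"
  have "\<exists>x. ?bad x" using not_left by (auto simp: left_justified_def)
  then obtain x where x: "?bad x" and x_min: "\<And>y. ?bad y \<Longrightarrow> ?w x \<le> ?w y"
    using ex_has_least_nat[of ?bad _ ?w] by blast
  obtain p q where pq: "x = (p, q)" by force
  have y: "(p, q) \<in> SY n" "(p, q + 1) \<in> SY n" and left: "(p, q) \<notin> D" and right: "(p, q + 1) \<in> D"
    using x D unfolding pq by auto
  have no_bad: "(a, b) \<notin> D \<Longrightarrow> (a, b + 1) \<notin> D" if "(a, b) \<in> SY n" "?w (a, b) < ?w (p, q)" for a b
    using x_min[of "(a, b)"] that unfolding pq by fastforce
  define S where "S = {(a, b) \<in> SY n. b \<in> {q, 2 * n - q} \<and> ?w (a, b) < ?w (p, q) \<and> \<not> ((a, b) \<in> D \<and> (a, b + 1) \<in> D)}"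
  have fin: "finite S" using finite_subset[OF _ finite_SY, of S n] by (auto simp: S_def)
  define c where "c = min q (2 * n - q)"
  \<comment> \<open>A pair to stop at exists: \<open>(c, 2n - c)\<close> is the last box of its row,
    so its right neighbour lies outside \<open>SY n\<close>.\<close>
  have "(c, 2 * n - c) \<in> S"
  proof -
    have c: "(c, 2 * n - c) \<in> SY n" "2 * n - c \<in> {q, 2 * n - q}" using y by (auto simp: c_def SY_iff)
    moreover have "?w (c, 2 * n - c) < ?w (p, q)"
      using weight_less_iff[OF c(1) y(1)] y by (auto simp: c_def SY_iff)
    moreover have "(c, 2 * n - c + 1) \<notin> D" using subsetD[OF D, of "(c, 2 * n - c + 1)"] by (auto simp: SY_iff)
    ultimately show ?thesis by (auto simp: S_def)
  qed
  then have "Max (?w ` S) \<in> ?w ` S" using fin by (intro Max_in) auto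
  then obtain z where z: "z \<in> S" and "Max (?w ` S) = ?w z" by blast
  then have z_max: "?w y \<le> ?w z" if "y \<in> S" for y
    using that fin by (metis Max_ge finite_imageI imageI)
  obtain i j where ij: "z = (i, j)" by force
  have w: "(i, j) \<in> SY n" "j \<in> {q, 2 * n - q}" "?w (i, j) < ?w (p, q)" "\<not> ((i, j) \<in> D \<and> (i, j + 1) \<in> D)"
    using z unfolding ij S_def by auto
  have ij_right: "(i, j + 1) \<notin> D" using w no_bad[OF w(1,3)] by blast
  have col: "q \<in> {j, 2 * n - j}" "{j, 2 * n - j} = {q, 2 * n - q}" using w y by (auto simp: SY_iff)
  have "q = j \<or> q + j = 2 * n" using col(1) w(1) by (auto simp: SY_iff)
  \<comment> \<open>The columns of left boxes all have the parity of \<open>q\<close>, so the moved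
    box \<open>(p, q + 1)\<close> is never the left box of a pair.\<close>
  then have par: "q \<noteq> j + 1" "j \<noteq> q + 1" by presburger+
  have mid: "(a, b) \<in> D \<and> (a, b + 1) \<in> D"
    if "(a, b) \<in> SY n" "b \<in> {j, 2 * n - j}" "?w (i, j) < ?w (a, b)" "?w (a, b) < ?w (p, q)" for a b
    using z_max[of "(a, b)"] that col unfolding S_def ij by fastforce
  have mid_ne: "(a, b + 1) \<noteq> (p, q + 1)" "(a, b) \<noteq> (p, q + 1)"
    if "(a, b) \<in> SY n" "b \<in> {j, 2 * n - j}" "?w (i, j) < ?w (a, b)" "?w (a, b) < ?w (p, q)" for a b
  proof -
    have "b = q \<or> b + q = 2 * n" using that(2) y unfolding col(2) by (auto simp: SY_iff)
    then have "b \<noteq> q + 1" by presburger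
    then show "(a, b + 1) \<noteq> (p, q + 1)" "(a, b) \<noteq> (p, q + 1)" using that(4) by auto
  qed
  have finD: "finite D" using D finite_SY finite_subset by blast
  show ?thesis
  proof (cases "(i, j) \<in> D")
    case True
    define D' where "D' = D - {(i, j), (p, q + 1)}"
    have D': "D' \<subseteq> SY n" using D by (auto simp: D'_def)
    have "dream_elt n D = dream_elt n D'"
      by (rule dream_elt_toggle[OF D D' w(1) y w(3) col(1) ij_right left mid])
        (use True right in \<open>auto simp: D'_def\<close>)
    moreover have sub: "D' \<subset> D" using right by (auto simp: D'_def)
    moreover have "sum ?w D' < sum ?w D"
      using sum_strict_mono2[OF finD, of D' "(p, q + 1)" ?w] right sub by (auto simp: D'_def weight_def)
    ultimately show ?thesis using psubset_card_mono[OF finD sub] D' by auto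
  next
    case False
    define D' where "D' = insert (i, j) (D - {(p, q + 1)})"
    have D': "D' \<subseteq> SY n" using D w by (auto simp: D'_def)
    have "dream_elt n D = dream_elt n D'"
      by (rule dream_elt_toggle[OF D D' w(1) y w(3) col(1) ij_right left mid])
        (use False right par in \<open>auto simp: D'_def\<close>)
    moreover have "box_ladder n D' D"
      unfolding box_ladder_def
    proof (rule exI[of _ i], rule exI[of _ j], rule exI[of _ p], rule exI[of _ q], intro conjI allI impI)
      show "(i, j) \<in> D'" "(i, j + 1) \<notin> D'" "(p, q) \<notin> D'" "(p, q + 1) \<notin> D'"
        using ij_right left w(3) par by (auto simp: D'_def)
      show "D = D' \<union> {(p, q + 1)} - {(i, j)}" using False right by (auto simp: D'_def)
      fix a b assume *: "(a, b) \<in> SY n \<and> b \<in> {j, 2 * n - j} \<and> ?w (i, j) < ?w (a, b) \<and> ?w (a, b) < ?w (p, q)"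
      then show "(a, b) \<in> D'" "(a, b + 1) \<in> D'" using mid[of a b] mid_ne[of a b] by (auto simp: D'_def)
    qed (use w y col in auto)
    moreover have "sum ?w D' < sum ?w D"
    proof -
      have "sum ?w D' = ?w (i, j) + sum ?w (D - {(p, q + 1)})" using False finD by (simp add: D'_def)
      moreover have "sum ?w D = ?w (p, q + 1) + sum ?w (D - {(p, q + 1)})" using finD right by (rule sum.remove)
      moreover have "?w (i, j) < ?w (p, q + 1)"
        using weight_less_iff[OF w(1) y(1)] weight_less_iff[OF w(1) y(2)] w(3) par by auto
      ultimately show ?thesis by simp
    qed
    ultimately show ?thesis using D' by auto
  qed
qed

lemma box_ladder_closure_preserves:
  assumes "(box_ladder n)\<^sup>*\<^sup>* D E" "D \<subseteq> SY n"
  shows "E \<subseteq> SY n \<and> dream_elt n E = dream_elt n D \<and> card E = card D"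
  using assms by induction (auto dest: box_ladder_preserves)

text \<open>The sum of weights decreases in every step. Inverse ladder moves preserve the number of
  boxes and deletions lower it, so equal cardinality at the end means that only ladder moves
  separate the two diagrams.\<close>

lemma reduction_to_left_justified:
  assumes "D \<subseteq> SY n"
  shows "\<exists>D'\<subseteq>SY n. left_justified n D' \<and> dream_elt n D' = dream_elt n D \<and> card D' \<le> card D \<and>
    (card D' = card D \<longrightarrow> (box_ladder n)\<^sup>*\<^sup>* D' D)"
  using assms
proof (induction "sum (weight n) D" arbitrary: D rule: less_induct)
  case less
  show ?case
  proof (cases "left_justified n D")
    case True
    then show ?thesis using less.prems by auto
  next
    case False
    then obtain D1 where D1: "D1 \<subseteq> SY n" "dream_elt n D1 = dream_elt n D" "sum (weight n) D1 < sum (weight n) D"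
      "box_ladder n D1 D \<or> card D1 < card D"
      using reduction_step[OF less.prems] by blast
    then obtain D' where D': "D' \<subseteq> SY n" "left_justified n D'" "dream_elt n D' = dream_elt n D" "card D' \<le> card D1"
      "card D' = card D1 \<longrightarrow> (box_ladder n)\<^sup>*\<^sup>* D' D1"
      using less.hyps by metis
    have "card D' \<le> card D \<and> (card D' = card D \<longrightarrow> (box_ladder n)\<^sup>*\<^sup>* D' D)"
      using D1(4)
    proof
      assume "box_ladder n D1 D"
      then show ?thesis using D' box_ladder_preserves(3)[OF D1(1)] by (auto intro: rtranclp.rtrancl_into_rtrancl)
    qed (use D' in auto)
    then show ?thesis using D' by blast
  qed
qed

section \<open>Positions of boxes\<close>

text \<open>Squares enter as sums of odd numbers: the blocks before block \<open>m\<close> have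
  \<open>(m - 1)\<^sup>2\<close> entries, so \<open>(m - 1)\<^sup>2 + t\<close> is the position of
  entry \<open>t\<close> of block \<open>m\<close>.\<close>

lemma length_concat_blocks:
  assumes "\<And>m. 1 \<le> m \<Longrightarrow> m \<le> n \<Longrightarrow> length (g m) = 2 * m - 1"
  shows "length (concat (map g [1..<Suc n])) = n\<^sup>2"
  using assms by (induction n) (auto simp: power2_eq_square)

lemma nth_concat_blocks:
  assumes "\<And>m. 1 \<le> m \<Longrightarrow> m \<le> n \<Longrightarrow> length (g m) = 2 * m - 1"
    and "1 \<le> m" "m \<le> n" "1 \<le> t" "t \<le> 2 * m - 1"
  shows "concat (map g [1..<Suc n]) ! ((m - 1)\<^sup>2 + t - 1) = g m ! (t - 1)"
  using assms
proof (induction n)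
  case (Suc n)
  have len: "length (concat (map g [1..<Suc n])) = n\<^sup>2" using Suc.prems(1) by (intro length_concat_blocks) auto
  have split: "concat (map g [1..<Suc (Suc n)]) = concat (map g [1..<Suc n]) @ g (Suc n)" by simp
  show ?case
  proof (cases "m \<le> n")
    case True
    have "(m - 1)\<^sup>2 + (2 * m - 1) = m\<^sup>2" using Suc.prems(2) by (cases m) (auto simp: power2_eq_square)
    also have "\<dots> \<le> n\<^sup>2" using True by (rule power_mono) simp
    finally have "(m - 1)\<^sup>2 + t - 1 < n\<^sup>2" using Suc.prems(4,5) by linarith
    then show ?thesis unfolding split nth_append len using Suc True by simp
  next
    case False
    then have "m = Suc n" using Suc.prems by simp
    moreover have "\<not> n\<^sup>2 + t - 1 < n\<^sup>2" "n\<^sup>2 + t - 1 - n\<^sup>2 = t - 1" using Suc.prems(4) by linarith+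
    ultimately show ?thesis unfolding split nth_append len by simp
  qed
qed simp

lemma position_cases:
  fixes k n :: nat
  assumes "k \<in> {1..n\<^sup>2}"
  obtains m t where "1 \<le> m" "m \<le> n" "1 \<le> t" "t \<le> 2 * m - 1" "k = (m - 1)\<^sup>2 + t"
proof -
  have "\<exists>m t. 1 \<le> m \<and> m \<le> n \<and> 1 \<le> t \<and> t \<le> 2 * m - 1 \<and> k = (m - 1)\<^sup>2 + t"
    using assms
  proof (induction n)
    case (Suc n)
    show ?case
    proof (cases "k \<le> n\<^sup>2")
      case True
      then obtain m t where "1 \<le> m \<and> m \<le> n \<and> 1 \<le> t \<and> t \<le> 2 * m - 1 \<and> k = (m - 1)\<^sup>2 + t"
        using Suc by auto
      then show ?thesis using le_SucI by blast
    next
      case False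
      then have "1 \<le> k - n\<^sup>2" "k - n\<^sup>2 \<le> 2 * Suc n - 1" "k = (Suc n - 1)\<^sup>2 + (k - n\<^sup>2)"
        using Suc.prems by (auto simp: power2_eq_square)
      then show ?thesis using Suc.prems by (intro exI[of _ "Suc n"] exI[of _ "k - n\<^sup>2"]) auto
    qed
  qed simp
  then show ?thesis using that by blast
qed

lemma position_less:
  fixes m m' t t' :: nat
  assumes "1 \<le> m'" "1 \<le> t" "t' \<le> 2 * m' - 1" "(m - 1)\<^sup>2 + t < (m' - 1)\<^sup>2 + t'"
  shows "m < m' \<or> m = m' \<and> t < t'"
proof (rule ccontr)
  assume not: "\<not> ?thesis"
  have "(m' - 1)\<^sup>2 + (2 * m' - 1) = m'\<^sup>2" using assms(1) by (cases m') (auto simp: power2_eq_square)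
  moreover have "m' < m \<Longrightarrow> m'\<^sup>2 \<le> (m - 1)\<^sup>2" by (rule power_mono) auto
  moreover have "m' < m" using not assms(4) by (cases "m = m'") auto
  ultimately show False using assms(2-4) by linarith
qed

lemma position_bounds:
  fixes m t n :: nat
  assumes "1 \<le> m" "m \<le> n" "1 \<le> t" "t \<le> 2 * m - 1" shows "(m - 1)\<^sup>2 + t \<in> {1..n\<^sup>2}"
proof -
  have "(m - 1)\<^sup>2 + (2 * m - 1) = m\<^sup>2" using assms(1) by (cases m) (auto simp: power2_eq_square)
  also have "\<dots> \<le> n\<^sup>2" using assms by (intro power_mono) auto
  finally show ?thesis using assms by auto
qed

text \<open>Block \<open>m\<close> of the list is row \<open>n + 1 - m\<close>, read leftwards from
  its last column \<open>n + m - 1\<close>.\<close>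

lemma nth_box_position:
  assumes "1 \<le> m" "m \<le> n" "1 \<le> t" "t \<le> 2 * m - 1"
  shows "nth_box n ((m - 1)\<^sup>2 + t) = (n + 1 - m, n + m - t)"
proof -
  let ?g = "\<lambda>m. map (Pair (n + 1 - m)) (rev [n + 1 - m..<Suc (2 * n - (n + 1 - m))])"
  have "rev [1..<Suc n] = map (\<lambda>m. n + 1 - m) [1..<Suc n]"
    by (rule nth_equalityI) (auto simp: rev_nth simp del: upt_Suc)
  then have "box_list n = concat (map ?g [1..<Suc n])"
    unfolding box_list_def by (simp add: comp_def del: upt_Suc)
  moreover have "length (?g m) = 2 * m - 1" if "1 \<le> m" "m \<le> n" for m using that by (simp del: upt_Suc)
  ultimately have "box_list n ! ((m - 1)\<^sup>2 + t - 1) = ?g m ! (t - 1)"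
    using nth_concat_blocks[of n ?g m t] assms by (simp del: upt_Suc)
  also have "\<dots> = (n + 1 - m, n + m - t)" using assms by (simp add: rev_nth del: upt_Suc)
  finally show ?thesis by (simp add: nth_box_def)
qed

lemma nth_box_in_SY: "k \<in> {1..n\<^sup>2} \<Longrightarrow> nth_box n k \<in> SY n"
proof (elim position_cases)
  fix m t assume m: "1 \<le> m" "m \<le> n" "1 \<le> t" "t \<le> 2 * m - 1" and k: "k = (m - 1)\<^sup>2 + t"
  show "nth_box n k \<in> SY n" unfolding k nth_box_position[OF m] using m by (auto simp: SY_iff)
qed

lemma nth_box_surj:
  assumes "x \<in> SY n" obtains k where "k \<in> {1..n\<^sup>2}" "nth_box n k = x"
proof -
  obtain i j where x: "x = (i, j)" by force
  then have ij: "1 \<le> i" "i \<le> n" "i \<le> j" "i + j \<le> 2 * n" using assms by (auto simp: SY_iff)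
  define m where "m = n + 1 - i"
  define t where "t = 2 * n + 1 - i - j"
  have mt: "1 \<le> m" "m \<le> n" "1 \<le> t" "t \<le> 2 * m - 1" using ij by (auto simp: m_def t_def)
  have "nth_box n ((m - 1)\<^sup>2 + t) = x"
    unfolding nth_box_position[OF mt] x using ij by (auto simp: m_def t_def)
  then show ?thesis using that position_bounds[OF mt] by blast
qed

lemma weight_nth_box_less_iff:
  assumes "k \<in> {1..n\<^sup>2}" "l \<in> {1..n\<^sup>2}"
  shows "weight n (nth_box n k) < weight n (nth_box n l) \<longleftrightarrow> k < l"
proof -
  have less: "weight n (nth_box n k) < weight n (nth_box n l)"
    if k: "k \<in> {1..n\<^sup>2}" and l: "l \<in> {1..n\<^sup>2}" and "k < l" for k l
  proof -
    obtain m t where m: "1 \<le> m" "m \<le> n" "1 \<le> t" "t \<le> 2 * m - 1" and k': "k = (m - 1)\<^sup>2 + t"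
      using k by (rule position_cases)
    obtain m' t' where m': "1 \<le> m'" "m' \<le> n" "1 \<le> t'" "t' \<le> 2 * m' - 1" and l': "l = (m' - 1)\<^sup>2 + t'"
      using l by (rule position_cases)
    have "m < m' \<or> m = m' \<and> t < t'" using position_less[of m' t t' m] m m' \<open>k < l\<close> k' l' by simp
    then show ?thesis
      using nth_box_in_SY[OF k] nth_box_in_SY[OF l] m m'
      unfolding k' l' nth_box_position[OF m] nth_box_position[OF m']
      by (subst weight_less_iff) auto
  qed
  show ?thesis using less[OF assms] less[OF assms(2,1)] by (cases k l rule: linorder_cases) auto
qed

lemma ladder_move_iff_box_ladder:
  "(\<exists>x\<in>SY n. ladder_move n x D E) \<longleftrightarrow> box_ladder n D E"
proof
  assume "\<exists>x\<in>SY n. ladder_move n x D E"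
  then obtain i j k l where *: "(i, j) \<in> SY n" "k \<in> {1..n\<^sup>2}" "nth_box n k = (i, j)"
    "(i, j) \<in> D" "(i, j + 1) \<notin> D" "k + 1 \<le> l" "l \<le> n\<^sup>2" "box_col n l \<in> {j, 2 * n - j}"
    "{(box_row n l, box_col n l), (box_row n l, box_col n l + 1)} \<subseteq> SY n - D"
    "\<And>r. k + 1 \<le> r \<Longrightarrow> r \<le> l - 1 \<Longrightarrow> box_col n r \<in> {j, 2 * n - j} \<Longrightarrow>
           (box_row n r, box_col n r) \<in> D \<and> (box_row n r, box_col n r + 1) \<in> D"
    "E = (D \<union> {(box_row n l, box_col n l + 1)}) - {(i, j)}"
    unfolding ladder_move_def by auto
  have l: "l \<in> {1..n\<^sup>2}" using *(2,6,7) by auto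
  obtain p q where pq: "nth_box n l = (p, q)" by force
  have mid: "(a, b) \<in> D \<and> (a, b + 1) \<in> D"
    if ab: "(a, b) \<in> SY n" "b \<in> {j, 2 * n - j}" "weight n (i, j) < weight n (a, b)" "weight n (a, b) < weight n (p, q)"
    for a b
  proof -
    obtain r where r: "r \<in> {1..n\<^sup>2}" "nth_box n r = (a, b)" using nth_box_surj[OF ab(1)] .
    have "k < r" "r < l"
      using ab weight_nth_box_less_iff[OF *(2) r(1)] weight_nth_box_less_iff[OF r(1) l] *(3) r pq by auto
    then show ?thesis using *(10)[of r] r ab(2) by auto
  qed
  have "weight n (i, j) < weight n (p, q)"
    using weight_nth_box_less_iff[OF *(2) l] *(3,6) pq by auto
  note less = this
  show "box_ladder n D E"
    unfolding box_ladder_def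
    by (rule exI[of _ i], rule exI[of _ j], rule exI[of _ p], rule exI[of _ q]) (use * pq mid less in simp)
next
  assume "box_ladder n D E"
  then obtain i j p q where *: "(i, j) \<in> SY n" "(p, q) \<in> SY n" "(p, q + 1) \<in> SY n"
    "weight n (i, j) < weight n (p, q)" "q \<in> {j, 2 * n - j}"
    "(i, j) \<in> D" "(i, j + 1) \<notin> D" "(p, q) \<notin> D" "(p, q + 1) \<notin> D"
    "\<And>a b. (a, b) \<in> SY n \<Longrightarrow> b \<in> {j, 2 * n - j} \<Longrightarrow> weight n (i, j) < weight n (a, b) \<Longrightarrow>
       weight n (a, b) < weight n (p, q) \<Longrightarrow> (a, b) \<in> D \<and> (a, b + 1) \<in> D"
    "E = (D \<union> {(p, q + 1)}) - {(i, j)}"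
    unfolding box_ladder_def by blast
  obtain k where k: "k \<in> {1..n\<^sup>2}" "nth_box n k = (i, j)" using nth_box_surj[OF *(1)] .
  obtain l where l: "l \<in> {1..n\<^sup>2}" "nth_box n l = (p, q)" using nth_box_surj[OF *(2)] .
  have kl: "k < l" using weight_nth_box_less_iff[OF k(1) l(1)] *(4) k l by simp
  have mid: "(box_row n r, box_col n r) \<in> D \<and> (box_row n r, box_col n r + 1) \<in> D"
    if "k + 1 \<le> r" "r \<le> l - 1" "box_col n r \<in> {j, 2 * n - j}" for r
  proof -
    have r: "r \<in> {1..n\<^sup>2}" "k < r" "r < l" using that l k kl by auto
    obtain a b where ab: "nth_box n r = (a, b)" by force
    show ?thesis
      using *(10)[of a b] that(3) ab nth_box_in_SY[OF r(1)] weight_nth_box_less_iff[OF k(1) r(1)]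
        weight_nth_box_less_iff[OF r(1) l(1)] r k l by simp
  qed
  have "ladder_move n (i, j) D E"
    unfolding ladder_move_def
    by (rule exI[of _ i], rule exI[of _ j], rule exI[of _ k], rule exI[of _ l]) (use * k l kl mid in simp)
  then show "\<exists>x\<in>SY n. ladder_move n x D E" using *(1) by blast
qed

section \<open>Codes of signed permutations\<close>

lemma word_prod_Nil [simp]: "word_prod [] = id"
  by (simp add: word_prod_def)

lemma word_prod_Cons [simp]: "word_prod (k # ks) = simple_refl k \<circ> word_prod ks"
  by (simp add: word_prod_def)

lemma word_prod_append: "word_prod (ks @ ls) = word_prod ks \<circ> word_prod ls"
  by (induction ks) (auto simp: comp_assoc)

lemma simple_refl_pos:
  assumes "1 \<le> k" "0 < x"
  shows "simple_refl k x = (if k = 1 then (if x = 1 then - 1 else x)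
     else if x = int k then int k - 1 else if x = int k - 1 then int k else x)"
  using assms by (auto simp: simple_refl_def transpose_def)

lemma simple_refl_uminus: "1 \<le> k \<Longrightarrow> simple_refl k (- x) = - simple_refl k x"
  by (auto simp: simple_refl_def transpose_def)

lemma simple_refl_involution: "1 \<le> k \<Longrightarrow> simple_refl k \<circ> simple_refl k = id"
  by (rule ext) (auto simp: simple_refl_def transpose_def)

lemma simple_refl_permutes:
  assumes "1 \<le> k" "k \<le> n" shows "simple_refl k permutes signed_idx n"
  using assms unfolding simple_refl_def
  by (auto intro!: permutes_compose permutes_swap_id simp: signed_idx_def)

lemma weyl_groupD:
  assumes "u \<in> weyl_group n" shows "u permutes signed_idx n" "u (- x) = - u x"
proof -
  show perm: "u permutes signed_idx n" using assms by (simp add: weyl_group_def)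
  show "u (- x) = - u x"
  proof (cases "x \<in> signed_idx n")
    case False
    then have "- x \<notin> signed_idx n" by (auto simp: signed_idx_def)
    then show ?thesis using False permutes_not_in[OF perm] by simp
  qed (use assms in \<open>auto simp: weyl_group_def\<close>)
qed

lemma weyl_group_comp: "u \<in> weyl_group n \<Longrightarrow> v \<in> weyl_group n \<Longrightarrow> u \<circ> v \<in> weyl_group n"
  using permutes_in_image[of v "signed_idx n"] by (auto simp: weyl_group_def intro: permutes_compose)

lemma word_prod_in_weyl_group:
  assumes "set ks \<subseteq> {1..n}" shows "word_prod ks \<in> weyl_group n"
  using assms
proof (induction ks)
  case Nil
  show ?case using permutes_id[of "signed_idx n", unfolded id_def] by (simp add: weyl_group_def id_def)
next
  case (Cons k ks)
  then have "simple_refl k \<in> weyl_group n"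
    using simple_refl_permutes[of k n] simple_refl_uminus[of k] by (auto simp: weyl_group_def)
  moreover have "word_prod ks \<in> weyl_group n" using Cons by simp
  ultimately show ?case unfolding word_prod_Cons by (rule weyl_group_comp)
qed

lemma word_prod_rev:
  assumes "set ks \<subseteq> {1..n}" shows "word_prod (rev ks) \<circ> word_prod ks = id"
  using assms
proof (induction ks)
  case (Cons k ks)
  have "simple_refl k (simple_refl k y) = y" for y
    using Cons.prems simple_refl_involution[of k] by (simp add: pointfree_idE)
  moreover have "word_prod (rev ks) (word_prod ks y) = y" for y
    using pointfree_idE[OF Cons.IH] Cons.prems by simp
  ultimately show ?case by (intro ext) (simp add: word_prod_append)
qed simp

lemma word_prod_rev':
  assumes "set ks \<subseteq> {1..n}" shows "word_prod ks \<circ> word_prod (rev ks) = id"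
  using word_prod_rev[of "rev ks" n] assms by simp

section \<open>Prefixes of blocks as coset representatives\<close>

definition block :: "nat \<Rightarrow> nat list" where
  "block m = rev [2..<Suc m] @ [1..<Suc m]"

lemma length_block: "1 \<le> m \<Longrightarrow> length (block m) = 2 * m - 1"
  by (simp add: block_def del: upt_Suc)

lemma set_block: "set (block m) \<subseteq> {1..m}"
  by (auto simp: block_def)

lemma block_nth:
  assumes "1 \<le> m" "d < 2 * m - 1"
  shows "block m ! d = (if d < m then m - d else d - m + 2)"
  using assms by (auto simp: block_def nth_append rev_nth simp del: upt_Suc)

text \<open>\<open>landing m d\<close> is the position to which the first \<open>d\<close> letters of \<open>block m\<close>
  bring the entry in position \<open>m\<close>, up to sign.\<close>

definition landing :: "nat \<Rightarrow> nat \<Rightarrow> nat" where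
  "landing m d = (if d < m then m - d else d - m + 1)"

lemma take_block_Suc:
  assumes "1 \<le> m" "d < 2 * m - 1"
  shows "take (Suc d) (block m) = take d (block m) @ [if d < m then m - d else d - m + 2]"
  using assms by (simp add: take_Suc_conv_app_nth length_block block_nth)

lemma set_take_block: "set (take d (block m)) \<subseteq> {1..m}"
  by (rule order_trans[OF set_take_subset set_block])

text \<open>With \<open>a = landing m d\<close>, the one-line notation is 1, ..., a - 1, m, a, ...,
  m - 1, where m is negated once the letter 1 has been used. Each further letter moves the entry m
  to the left, changes its sign in position 1, or moves it back to the right.\<close>

lemma word_prod_take_block:
  assumes "1 \<le> m" "d \<le> 2 * m - 1" "1 \<le> x" "x \<le> int m"
  shows "word_prod (take d (block m)) x =
    (if x < int (landing m d) then x else if x = int (landing m d) then (if d < m then int m else - int m) else x - 1)"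
  using assms(2-4)
proof (induction d arbitrary: x)
  case 0
  then show ?case using assms(1) by (simp add: landing_def)
next
  case (Suc d)
  define i where "i = (if d < m then m - d else d - m + 2)"
  have i: "1 \<le> i" "i \<le> m" using Suc.prems assms(1) by (auto simp: i_def)
  have step: "word_prod (take (Suc d) (block m)) x = word_prod (take d (block m)) (simple_refl i x)"
    using Suc.prems(1) assms(1) by (simp add: take_block_Suc i_def word_prod_append)
  have IH: "word_prod (take d (block m)) y =
    (if y < int (landing m d) then y else if y = int (landing m d) then (if d < m then int m else - int m) else y - 1)"
    if "1 \<le> y" "y \<le> int m" for y using Suc.IH[of y] Suc.prems(1) that by simp
  have neg: "word_prod (take d (block m)) (- 1) = - word_prod (take d (block m)) 1"
    by (rule weyl_groupD(2)[OF word_prod_in_weyl_group[OF set_take_block]])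
  have sx: "simple_refl i x = (if i = 1 then (if x = 1 then - 1 else x)
     else if x = int i then int i - 1 else if x = int i - 1 then int i else x)"
    using simple_refl_pos i Suc.prems by simp
  consider "Suc d < m" | "Suc d = m" | "m \<le> d" by linarith
  then show ?case
  proof cases
    case 1
    then have i': "i = m - d" "i \<noteq> 1" "landing m d = m - d" "landing m (Suc d) = m - d - 1"
      by (auto simp: i_def landing_def)
    then show ?thesis unfolding step sx using 1 Suc.prems IH by auto
  next
    case 2
    then have i': "i = 1" "landing m d = 1" "landing m (Suc d) = 1" by (auto simp: i_def landing_def)
    then show ?thesis unfolding step sx using 2 Suc.prems IH neg by auto
  next
    case 3
    then have i': "i = d - m + 2" "i \<noteq> 1" "landing m d = d - m + 1" "landing m (Suc d) = d - m + 2"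
      by (auto simp: i_def landing_def)
    then show ?thesis unfolding step sx using 3 Suc.prems IH by auto
  qed
qed

lemma landing_bounds: "1 \<le> m \<Longrightarrow> d \<le> 2 * m - 1 \<Longrightarrow> 1 \<le> landing m d \<and> landing m d \<le> m"
  by (auto simp: landing_def)

lemma word_prod_rev_take_block:
  assumes m: "1 \<le> m" "d \<le> 2 * m - 1"
  shows "word_prod (rev (take d (block m))) (int m) = (if d < m then int (landing m d) else - int (landing m d))"
    and "1 \<le> x \<Longrightarrow> x < int m \<Longrightarrow>
      word_prod (rev (take d (block m))) x = (if x < int (landing m d) then x else x + 1)"
proof -
  let ?P = "word_prod (take d (block m))" and ?Q = "word_prod (rev (take d (block m)))"
  have QP: "?Q (?P x) = x" for x
    using word_prod_rev[OF set_take_block, of d m] by (simp add: pointfree_idE)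
  have Q: "?Q \<in> weyl_group m" using set_take_block[of d m] by (intro word_prod_in_weyl_group) simp
  note a = landing_bounds[OF m]
  have "?P (int (landing m d)) = (if d < m then int m else - int m)"
    using word_prod_take_block[OF m, of "int (landing m d)"] a by simp
  then show "?Q (int m) = (if d < m then int (landing m d) else - int (landing m d))"
    using QP[of "int (landing m d)"] weyl_groupD(2)[OF Q, of "int m"] by (auto split: if_splits)
  show "?Q x = (if x < int (landing m d) then x else x + 1)" if "1 \<le> x" "x < int m"
    using word_prod_take_block[OF m, of x] word_prod_take_block[OF m, of "x + 1"] QP[of x] QP[of "x + 1"] that a
    by (cases "x < int (landing m d)") auto
qed

definition code_word :: "nat \<Rightarrow> (nat \<Rightarrow> nat) \<Rightarrow> nat list" where
  "code_word n d = concat (map (\<lambda>m. take (d m) (block m)) [1..<Suc n])"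

lemma code_word_0 [simp]: "code_word 0 d = []"
  by (simp add: code_word_def)

lemma code_word_Suc: "code_word (Suc n) d = code_word n d @ take (d (Suc n)) (block (Suc n))"
  by (simp add: code_word_def)

lemma set_code_word: "set (code_word n d) \<subseteq> {1..n}"
proof (induction n)
  case (Suc n)
  then show ?case using set_take_block[of "d (Suc n)" "Suc n"] by (fastforce simp: code_word_Suc)
qed simp

lemma weyl_group_restrict:
  assumes w: "w \<in> weyl_group (Suc n)" and fixed: "w (int (Suc n)) = int (Suc n)"
  shows "w \<in> weyl_group n"
proof -
  have idx: "signed_idx (Suc n) = signed_idx n \<union> {int (Suc n), - int (Suc n)}"
    by (auto simp: signed_idx_def)
  have fixed': "w (- int (Suc n)) = - int (Suc n)" using weyl_groupD(2)[OF w] fixed by metis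
  have "w x = x" if "x \<notin> signed_idx n" for x
    using that fixed fixed' permutes_not_in[OF weyl_groupD(1)[OF w], of x] idx by auto
  then have "w permutes signed_idx n"
    using weyl_groupD(1)[OF w] by (auto simp: permutes_def)
  then show ?thesis using weyl_groupD(2)[OF w] by (simp add: weyl_group_def)
qed

text \<open>The prefix of block \<open>m\<close> is chosen to send the place of the value
  \<open>m\<close> to \<open>m\<close>. Cancelling this prefix on the right leaves an element that
  fixes \<open>m\<close>, to which the induction hypothesis applies.\<close>

lemma weyl_group_code:
  assumes "w \<in> weyl_group n"
  shows "\<exists>d. (\<forall>m. 1 \<le> m \<longrightarrow> d m \<le> 2 * m - 1) \<and> w = word_prod (code_word n d)"
  using assms
proof (induction n arbitrary: w)
  case 0
  then have "w permutes {}" by (simp add: weyl_group_def signed_idx_def)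
  then show ?case by (intro exI[of _ "\<lambda>_. 0"]) (auto simp: permutes_empty)
next
  case (Suc n)
  define m where "m = Suc n"
  have w: "w \<in> weyl_group m" using Suc.prems by (simp add: m_def)
  define x where "x = inv w (int m)"
  have wx: "w x = int m" using permutes_inverses(1)[OF weyl_groupD(1)[OF w]] by (simp add: x_def)
  have "int m \<in> signed_idx m" by (auto simp: signed_idx_def m_def)
  then have x: "x \<in> signed_idx m"
    using permutes_in_image[OF permutes_inv[OF weyl_groupD(1)[OF w]]] by (simp add: x_def)
  \<comment> \<open>Solves \<open>landing m e = \<bar>x\<bar>\<close>, before the sign change for
    positive \<open>x\<close> and after it for negative \<open>x\<close>.\<close>
  define e where "e = (if 0 < x then m - nat x else m - 1 + nat (- x))"
  have e: "e \<le> 2 * m - 1" "1 \<le> m" using x by (auto simp: e_def signed_idx_def m_def)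
  let ?p = "take e (block m)"
  have Qm: "word_prod (rev ?p) (int m) = x"
    using word_prod_rev_take_block(1)[OF e(2,1)] x by (auto simp: e_def landing_def signed_idx_def)
  define w' where "w' = w \<circ> word_prod (rev ?p)"
  have "w' \<in> weyl_group m"
    unfolding w'_def using set_take_block[of e m]
    by (intro weyl_group_comp w word_prod_in_weyl_group) simp
  moreover have "w' (int m) = int m" using Qm wx by (simp add: w'_def)
  ultimately have "w' \<in> weyl_group n" unfolding m_def by (rule weyl_group_restrict)
  then obtain d where d: "\<forall>m. 1 \<le> m \<longrightarrow> d m \<le> 2 * m - 1" "w' = word_prod (code_word n d)"
    using Suc.IH by blast
  have "code_word n (d(m := e)) = code_word n d"
    unfolding code_word_def m_def by (rule arg_cong[of _ _ concat], rule map_cong) auto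
  moreover have "w = w' \<circ> word_prod ?p"
    using word_prod_rev[OF set_take_block, of e m] by (simp add: w'_def comp_assoc)
  ultimately have "w = word_prod (code_word (Suc n) (d(m := e)))"
    using d(2) by (simp add: code_word_Suc word_prod_append m_def)
  moreover have "\<forall>m'. 1 \<le> m' \<longrightarrow> (d(m := e)) m' \<le> 2 * m' - 1" using d(1) e by auto
  ultimately show ?case by blast
qed

section \<open>Length\<close>

text \<open>For \<open>u\<close> the inverse of \<open>w\<close>, this counts the inversions of \<open>w\<close> value by value: the negative values,
  and the inversions that a pair of values \<open>j < m\<close> forms with its negatives.\<close>

definition inv_pair :: "(int \<Rightarrow> int) \<Rightarrow> int \<Rightarrow> int \<Rightarrow> nat" where
  "inv_pair u j m = (if 0 < u m then if \<bar>u m\<bar> < \<bar>u j\<bar> then 1 else 0 else if \<bar>u j\<bar> < \<bar>u m\<bar> then 2 else 1)"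

definition inv_count :: "nat \<Rightarrow> (int \<Rightarrow> int) \<Rightarrow> nat" where
  "inv_count n u = (\<Sum>m\<in>{1..int n}. if u m < 0 then 1 else 0) + (\<Sum>m\<in>{1..int n}. \<Sum>j\<in>{1..<m}. inv_pair u j m)"

lemma weyl_group_abs:
  assumes u: "u \<in> weyl_group n" and x: "1 \<le> x" "x \<le> int n"
  shows "1 \<le> \<bar>u x\<bar>" "\<bar>u x\<bar> \<le> int n"
    and "1 \<le> y \<Longrightarrow> y \<le> int n \<Longrightarrow> \<bar>u x\<bar> = \<bar>u y\<bar> \<Longrightarrow> x = y"
proof -
  have "u x \<in> signed_idx n"
    using x permutes_in_image[OF weyl_groupD(1)[OF u], of x] by (auto simp: signed_idx_def)
  then show "1 \<le> \<bar>u x\<bar>" "\<bar>u x\<bar> \<le> int n" by (auto simp: signed_idx_def)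
  show "x = y" if "1 \<le> y" "y \<le> int n" "\<bar>u x\<bar> = \<bar>u y\<bar>"
  proof -
    have "u x = u y \<or> u x = u (- y)" using that weyl_groupD(2)[OF u, of y] by auto
    then have "x = y \<or> x = - y" using permutes_inj[OF weyl_groupD(1)[OF u]] by (auto dest: injD)
    then show ?thesis using x that by auto
  qed
qed

lemma sum_le_Suc:
  fixes f g :: "'a \<Rightarrow> nat"
  assumes "finite A" and "\<And>x. x \<in> A \<Longrightarrow> x \<noteq> a \<Longrightarrow> f x = g x" and "a \<in> A \<Longrightarrow> f a \<le> g a + 1"
  shows "sum f A \<le> sum g A + 1"
proof (cases "a \<in> A")
  case True
  have "sum f (A - {a}) = sum g (A - {a})" using assms(2) by (intro sum.cong) auto
  then show ?thesis using sum.remove[OF assms(1) True, of f] sum.remove[OF assms(1) True, of g] assms(3)[OF True] by simp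
next
  case False
  then have "sum f A = sum g A" using assms(2) by (intro sum.cong) auto
  then show ?thesis by simp
qed

text \<open>The letter 1 changes only the sign of the entry of absolute value 1. Any other letter
  \<open>k\<close> keeps all signs and exchanges the absolute values \<open>k - 1\<close> and
  \<open>k\<close>, so that at most one pair of places is affected, and its contribution grows by at
  most 1.\<close>

lemma inv_count_simple_refl:
  assumes u: "u \<in> weyl_group n" and k: "1 \<le> k" "k \<le> n"
  shows "inv_count n (simple_refl k \<circ> u) \<le> inv_count n u + 1"
proof -
  let ?v = "simple_refl k \<circ> u" and ?I = "{1..int n}"
  have s: "simple_refl k x = (if k = 1 then (if \<bar>x\<bar> = 1 then - x else x)
     else if \<bar>x\<bar> = int k then sgn x * (int k - 1) else if \<bar>x\<bar> = int k - 1 then sgn x * int k else x)" if "x \<noteq> 0" for x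
    using simple_refl_pos[OF k(1), of x] simple_refl_pos[OF k(1), of "- x"] simple_refl_uminus[OF k(1), of "- x"] that
    by (cases "0 < x") (auto simp: sgn_if abs_if)
  have nz: "u m \<noteq> 0" if "m \<in> ?I" for m using weyl_group_abs(1)[OF u, of m] that by auto
  have inj: "m = m'" if "m \<in> ?I" "m' \<in> ?I" "\<bar>u m\<bar> = \<bar>u m'\<bar>" for m m'
    using weyl_group_abs(3)[OF u, of m m'] that by auto
  show ?thesis
  proof (cases "k = 1")
    case True
    have s1: "?v m = (if \<bar>u m\<bar> = 1 then - u m else u m)" if "m \<in> ?I" for m
      using s[OF nz[OF that]] True by simp
    \<comment> \<open>If \<open>\<bar>u m\<bar> = 1\<close>, then \<open>\<bar>u j\<bar>\<close> is
      larger, and the pair contributes 1 for either sign of \<open>u m\<close>.\<close>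
    have pairs: "inv_pair ?v j m = inv_pair u j m" if "m \<in> ?I" "j \<in> {1..<m}" for j m
      using nz[of m] nz[of j] inj[of m j] that s[of "u m"] s[of "u j"] True
      by (auto simp: inv_pair_def)
    have "(\<Sum>m\<in>?I. if ?v m < 0 then 1 else 0 :: nat) \<le> (\<Sum>m\<in>?I. if u m < 0 then 1 else 0) + 1"
    proof (cases "\<exists>m\<in>?I. \<bar>u m\<bar> = 1")
      case True
      then obtain a where "a \<in> ?I" "\<bar>u a\<bar> = 1" by blast
      show ?thesis
      proof (rule sum_le_Suc[where a = a])
        fix x assume "x \<in> ?I" "x \<noteq> a"
        then have "\<bar>u x\<bar> \<noteq> 1" using inj[of x a] \<open>a \<in> ?I\<close> \<open>\<bar>u a\<bar> = 1\<close> by auto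
        then show "(if ?v x < 0 then 1 else 0) = (if u x < 0 then 1 else (0 :: nat))"
          using s1[OF \<open>x \<in> ?I\<close>] by simp
      qed auto
    next
      case False
      then have "(\<Sum>m\<in>?I. if ?v m < 0 then 1 else 0 :: nat) = (\<Sum>m\<in>?I. if u m < 0 then 1 else 0)"
        using s1 by (intro sum.cong refl) simp
      then show ?thesis by simp
    qed
    moreover have "(\<Sum>m\<in>?I. \<Sum>j\<in>{1..<m}. inv_pair ?v j m) = (\<Sum>m\<in>?I. \<Sum>j\<in>{1..<m}. inv_pair u j m)"
      using pairs by (intro sum.cong) auto
    ultimately show ?thesis unfolding inv_count_def by linarith
  next
    case False
    then have k2: "2 \<le> k" using k by simp
    have sgn: "0 < ?v m \<longleftrightarrow> 0 < u m" "?v m < 0 \<longleftrightarrow> u m < 0" if "m \<in> ?I" for m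
      using s[OF nz[OF that]] nz[OF that] k2 by (auto simp: sgn_if)
    have abs: "\<bar>?v m\<bar> = (if \<bar>u m\<bar> = int k then int k - 1 else if \<bar>u m\<bar> = int k - 1 then int k else \<bar>u m\<bar>)"
      if "m \<in> ?I" for m
      using s[OF nz[OF that]] nz[OF that] k2 by (auto simp: sgn_if)
    have le: "inv_pair ?v j m \<le> inv_pair u j m + 1" if "m \<in> ?I" for j m
      using sgn[OF that] by (auto simp: inv_pair_def)
    define \<theta> where "\<theta> p = (if p = int k then int k - 1 else if p = int k - 1 then int k else p)" for p
    have \<theta>: "\<theta> p < \<theta> q \<longleftrightarrow> p < q"
      if "\<not> (p = int k \<and> q = int k - 1)" "\<not> (p = int k - 1 \<and> q = int k)" for p q
      using that unfolding \<theta>_def by (auto split: if_splits)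
    have eq: "inv_pair ?v j m = inv_pair u j m"
      if m: "m \<in> ?I" and j: "j \<in> ?I"
        and "\<not> (\<bar>u j\<bar> = int k \<and> \<bar>u m\<bar> = int k - 1)" "\<not> (\<bar>u j\<bar> = int k - 1 \<and> \<bar>u m\<bar> = int k)" for j m
    proof -
      have "\<bar>?v j\<bar> < \<bar>?v m\<bar> \<longleftrightarrow> \<bar>u j\<bar> < \<bar>u m\<bar>" "\<bar>?v m\<bar> < \<bar>?v j\<bar> \<longleftrightarrow> \<bar>u m\<bar> < \<bar>u j\<bar>"
        unfolding abs[OF m] abs[OF j] \<theta>_def[symmetric] by (intro \<theta>; use that(3,4) in blast)+
      then show ?thesis unfolding inv_pair_def sgn(1)[OF m] by simp
    qed
    let ?P = "SIGMA m:?I. {1..<m}"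
    have "\<exists>a. \<forall>x\<in>?P. x \<noteq> a \<longrightarrow> (case x of (m, j) \<Rightarrow> inv_pair ?v j m) = (case x of (m, j) \<Rightarrow> inv_pair u j m)"
    proof (cases "\<exists>m j. m \<in> ?I \<and> j \<in> {1..<m} \<and> {\<bar>u j\<bar>, \<bar>u m\<bar>} = {int k - 1, int k}")
      case True
      then obtain m0 j0 where a: "m0 \<in> ?I" "j0 \<in> {1..<m0}" "{\<bar>u j0\<bar>, \<bar>u m0\<bar>} = {int k - 1, int k}" by blast
      have "inv_pair ?v j m = inv_pair u j m" if "m \<in> ?I" "j \<in> {1..<m}" "(m, j) \<noteq> (m0, j0)" for m j
      proof (rule eq)
        have I: "m \<in> ?I" "j \<in> ?I" "m0 \<in> ?I" "j0 \<in> ?I" using a that by auto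
        have "\<not> (\<bar>u m\<bar> = \<bar>u m0\<bar> \<and> \<bar>u j\<bar> = \<bar>u j0\<bar>)" "\<not> (\<bar>u m\<bar> = \<bar>u j0\<bar> \<and> \<bar>u j\<bar> = \<bar>u m0\<bar>)"
          using inj[of m m0] inj[of j j0] inj[of m j0] inj[of j m0] I a(2) that by auto
        moreover have "\<bar>u j0\<bar> = int k - 1 \<and> \<bar>u m0\<bar> = int k \<or> \<bar>u j0\<bar> = int k \<and> \<bar>u m0\<bar> = int k - 1"
          using a(3) by (auto simp: doubleton_eq_iff)
        ultimately show "\<not> (\<bar>u j\<bar> = int k \<and> \<bar>u m\<bar> = int k - 1)" "\<not> (\<bar>u j\<bar> = int k - 1 \<and> \<bar>u m\<bar> = int k)"
          by auto
      qed (use that in auto)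
      then show ?thesis by (intro exI[of _ "(m0, j0)"]) auto
    next
      case False
      have "inv_pair ?v j m = inv_pair u j m" if "m \<in> ?I" "j \<in> {1..<m}" for m j
        by (rule eq) (use that False in \<open>auto simp: doubleton_eq_iff\<close>)
      then show ?thesis by auto
    qed
    then obtain a where a: "\<And>x. x \<in> ?P \<Longrightarrow> x \<noteq> a \<Longrightarrow>
        (case x of (m, j) \<Rightarrow> inv_pair ?v j m) = (case x of (m, j) \<Rightarrow> inv_pair u j m)" by blast
    have "(\<Sum>x\<in>?P. case x of (m, j) \<Rightarrow> inv_pair ?v j m) \<le> (\<Sum>x\<in>?P. case x of (m, j) \<Rightarrow> inv_pair u j m) + 1"
      by (rule sum_le_Suc[where a = a]) (use a le in auto)
    moreover have "(\<Sum>m\<in>?I. if ?v m < 0 then 1 else 0 :: nat) = (\<Sum>m\<in>?I. if u m < 0 then 1 else 0)"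
      using sgn(2) by (intro sum.cong) auto
    ultimately show ?thesis unfolding inv_count_def by (simp add: sum.Sigma)
  qed
qed

lemma inv_count_word_le:
  assumes "set ks \<subseteq> {1..n}" shows "inv_count n (word_prod (rev ks)) \<le> length ks"
  using assms
proof (induction ks rule: rev_induct)
  case Nil
  have "inv_pair (\<lambda>a. a) j m = 0" if "1 \<le> j \<and> j < m" for j m using that by (simp add: inv_pair_def)
  then show ?case by (simp add: inv_count_def id_def)
next
  case (snoc k ks)
  then have "inv_count n (simple_refl k \<circ> word_prod (rev ks)) \<le> inv_count n (word_prod (rev ks)) + 1"
    by (intro inv_count_simple_refl word_prod_in_weyl_group) auto
  moreover have "inv_count n (word_prod (rev ks)) \<le> length ks" using snoc by simp
  moreover have "word_prod (rev (ks @ [k])) = simple_refl k \<circ> word_prod (rev ks)"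
    by (simp only: rev_append rev.simps append.simps word_prod_Cons)
  ultimately show ?case by (simp only: length_append list.size)
qed

text \<open>On the absolute values up to \<open>n\<close> the inverse prefix acts as an increasing
  map and keeps signs, so the old contributions persist. The new place \<open>m\<close> contributes
  one for each of the \<open>m - a\<close> larger values if its entry is \<open>a\<close>. If the
  entry is \<open>- a\<close>, it contributes \<open>n\<close> for the pairs, one more for each of
  the \<open>a - 1\<close> smaller values, and one for its sign. Both totals are
  \<open>d\<close>.\<close>

lemma inv_count_block:
  assumes u: "u \<in> weyl_group n" and d: "d \<le> 2 * Suc n - 1"
  shows "inv_count (Suc n) (word_prod (rev (take d (block (Suc n)))) \<circ> u) = inv_count n u + d"
proof -
  define m where "m = Suc n"
  have m: "1 \<le> m" "d \<le> 2 * m - 1" using d by (auto simp: m_def)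
  let ?Q = "word_prod (rev (take d (block m)))" and ?a = "landing m d" and ?I = "{1..int n}"
  note a = landing_bounds[OF m]
  have "int m \<notin> signed_idx n" by (simp add: m_def signed_idx_def)
  then have um: "u (int m) = int m" using permutes_not_in[OF weyl_groupD(1)[OF u]] by simp
  have Qm: "?Q (u (int m)) = (if d < m then int ?a else - int ?a)"
    unfolding um by (rule word_prod_rev_take_block(1)[OF m])
  have Q_odd: "?Q (- x) = - ?Q x" for x
    using set_take_block[of d m] by (intro weyl_groupD(2)[OF word_prod_in_weyl_group[of _ m]]) simp
  have u_abs: "1 \<le> \<bar>u x\<bar>" "\<bar>u x\<bar> < int m" if "x \<in> ?I" for x
    using weyl_group_abs(1,2)[OF u, of x] that by (auto simp: m_def)
  have Q: "\<bar>?Q (u x)\<bar> = (if \<bar>u x\<bar> < int ?a then \<bar>u x\<bar> else \<bar>u x\<bar> + 1)" "0 < ?Q (u x) \<longleftrightarrow> 0 < u x" "?Q (u x) < 0 \<longleftrightarrow> u x < 0"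
    if "x \<in> ?I" for x
    using u_abs[OF that] word_prod_rev_take_block(2)[OF m, of "u x"] word_prod_rev_take_block(2)[OF m, of "- u x"]
      Q_odd[of "u x"] by (cases "0 < u x"; auto split: if_splits)+
  have pair: "inv_pair (?Q \<circ> u) j x = inv_pair u j x" if "x \<in> ?I" "j \<in> ?I" for x j
    using Q[OF that(1)] Q[OF that(2)] by (auto simp: inv_pair_def)
  have ins: "{1..int m} = insert (int m) ?I" "int m \<notin> ?I" by (auto simp: m_def)
  have bij: "bij_betw (\<lambda>x. \<bar>u x\<bar>) ?I ?I"
  proof -
    have "inj_on (\<lambda>x. \<bar>u x\<bar>) ?I" using weyl_group_abs(3)[OF u] by (intro inj_onI) auto
    moreover have "(\<lambda>x. \<bar>u x\<bar>) ` ?I \<subseteq> ?I" using weyl_group_abs(1,2)[OF u] by auto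
    ultimately show ?thesis using endo_inj_surj[of ?I "\<lambda>x. \<bar>u x\<bar>"] by (simp add: bij_betw_def)
  qed
  have last: "(\<Sum>j\<in>{1..<int m}. inv_pair (?Q \<circ> u) j (int m)) + (if ?Q (u (int m)) < 0 then 1 else 0) = d"
  proof -
    have ivl: "{1..<int m} = ?I" by (auto simp: m_def)
    \<comment> \<open>The contribution depends only on \<open>\<bar>u j\<bar>\<close>, which takes
      each value from 1 to \<open>n\<close> once.\<close>
    define g where "g y = (if d < m then if int ?a \<le> y then 1 else 0 else if y < int ?a then 2 else (1::nat))" for y
    have "inv_pair (?Q \<circ> u) j (int m) = g \<bar>u j\<bar>" if "j \<in> ?I" for j
      using Q[OF that] Qm a unfolding inv_pair_def g_def by (auto split: if_splits)
    then have "(\<Sum>j\<in>{1..<int m}. inv_pair (?Q \<circ> u) j (int m)) = (\<Sum>j\<in>?I. g \<bar>u j\<bar>)"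
      unfolding ivl by (intro sum.cong) auto
    also have "\<dots> = (\<Sum>y\<in>?I. g y)" by (rule sum.reindex_bij_betw[OF bij])
    also have "\<dots> + (if ?Q (u (int m)) < 0 then 1 else 0) = d"
    proof (cases "d < m")
      case True
      have "?I \<inter> {y. int ?a \<le> y} = {int ?a..int n}" using a by auto
      then have "(\<Sum>y\<in>?I. g y) = nat (int n + 1 - int ?a)"
        using True by (simp add: g_def sum.If_cases)
      then show ?thesis using True Qm a by (simp add: landing_def m_def)
    next
      case False
      have "(\<Sum>y\<in>?I. g y) = (\<Sum>y\<in>?I. 1 + (if y < int ?a then 1 else 0))"
        using False by (intro sum.cong) (auto simp: g_def)
      also have "\<dots> = n + card (?I \<inter> {y. y < int ?a})"
        by (subst sum.distrib) (simp add: sum.If_cases)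
      also have "?I \<inter> {y. y < int ?a} = {1..<int ?a}" using a by (auto simp: m_def)
      also have "n + card {1..<int ?a} = n + (?a - 1)" by simp
      finally show ?thesis using False Qm a m by (simp add: landing_def m_def)
    qed
    finally show ?thesis .
  qed
  have "inv_count m (?Q \<circ> u) = inv_count n u +
     ((\<Sum>j\<in>{1..<int m}. inv_pair (?Q \<circ> u) j (int m)) + (if ?Q (u (int m)) < 0 then 1 else 0))"
  proof -
    have "(\<Sum>x\<in>{1..int m}. if (?Q \<circ> u) x < 0 then 1 else 0 :: nat) =
        (if ?Q (u (int m)) < 0 then 1 else 0) + (\<Sum>x\<in>?I. if u x < 0 then 1 else 0)"
      unfolding ins(1) using ins(2) Q(3) by (auto intro!: sum.cong)
    moreover have "(\<Sum>x\<in>{1..int m}. \<Sum>j\<in>{1..<x}. inv_pair (?Q \<circ> u) j x) =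
        (\<Sum>j\<in>{1..<int m}. inv_pair (?Q \<circ> u) j (int m)) + (\<Sum>x\<in>?I. \<Sum>j\<in>{1..<x}. inv_pair u j x)"
      unfolding ins(1) using ins(2) pair by (auto intro!: sum.cong)
    ultimately show ?thesis unfolding inv_count_def by simp
  qed
  then show ?thesis using last by (simp add: m_def)
qed

lemma inv_count_code_word:
  assumes "\<And>m. 1 \<le> m \<Longrightarrow> m \<le> n \<Longrightarrow> d m \<le> 2 * m - 1"
  shows "inv_count n (word_prod (rev (code_word n d))) = length (code_word n d)"
  using assms
proof (induction n)
  case 0
  then show ?case by (simp add: inv_count_def)
next
  case (Suc n)
  have d: "d (Suc n) \<le> 2 * Suc n - 1" using Suc.prems[of "Suc n"] by simp
  have K: "word_prod (rev (code_word n d)) \<in> weyl_group n"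
    using set_code_word by (intro word_prod_in_weyl_group) simp
  have "length (code_word (Suc n) d) = length (code_word n d) + d (Suc n)"
    using d by (simp add: code_word_Suc length_block)
  moreover have "inv_count n (word_prod (rev (code_word n d))) = length (code_word n d)"
    using Suc by simp
  ultimately show ?case
    using inv_count_block[OF K d] by (simp only: code_word_Suc rev_append word_prod_append)
qed

text \<open>The inversion count of the inverse bounds the length of every word from below and is
  attained by the code word.\<close>

lemma weyl_length_code_word:
  assumes "\<And>m. 1 \<le> m \<Longrightarrow> m \<le> n \<Longrightarrow> d m \<le> 2 * m - 1"
  shows "weyl_length n (word_prod (code_word n d)) = length (code_word n d)"
  unfolding weyl_length_def
proof (rule Least_equality)
  show "\<exists>ks. length ks = length (code_word n d) \<and> set ks \<subseteq> {1..n} \<and> word_prod ks = word_prod (code_word n d)"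
    using set_code_word by blast
  fix r assume "\<exists>ks. length ks = r \<and> set ks \<subseteq> {1..n} \<and> word_prod ks = word_prod (code_word n d)"
  then obtain ks where ks: "length ks = r" "set ks \<subseteq> {1..n}" "word_prod ks = word_prod (code_word n d)" by blast
  have "word_prod (rev ks) = word_prod (rev ks) \<circ> (word_prod (code_word n d) \<circ> word_prod (rev (code_word n d)))"
    using word_prod_rev'[OF set_code_word, of n d] by simp
  also have "\<dots> = word_prod (rev (code_word n d))"
    using word_prod_rev[OF ks(2)] ks(3) by (simp add: comp_assoc[symmetric])
  finally show "length (code_word n d) \<le> r"
    using inv_count_word_le[OF ks(2)] inv_count_code_word[of n d, OF assms] ks(1) by simp
qed

lemma weyl_length_le:
  "set ks \<subseteq> {1..n} \<Longrightarrow> weyl_length n (word_prod ks) \<le> length ks"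
  unfolding weyl_length_def by (rule Least_le) blast

section \<open>Lexicographically minimal words\<close>

definition code_positions :: "nat \<Rightarrow> (nat \<Rightarrow> nat) \<Rightarrow> nat list" where
  "code_positions n d = concat (map (\<lambda>m. map (\<lambda>t. (m - 1)\<^sup>2 + t) [1..<Suc (d m)]) [1..<Suc n])"

definition admissible :: "(nat \<Rightarrow> nat) \<Rightarrow> bool" where
  "admissible d \<longleftrightarrow> (\<forall>m\<ge>1. d m \<le> 2 * m - 1)"

lemma admissibleD: "admissible d \<Longrightarrow> 1 \<le> m \<Longrightarrow> d m \<le> 2 * m - 1"
  by (simp add: admissible_def)

lemma code_positions_Suc:
  "code_positions (Suc n) d = code_positions n d @ map (\<lambda>t. n\<^sup>2 + t) [1..<Suc (d (Suc n))]"
  by (simp add: code_positions_def del: upt_Suc) (simp add: upt_Suc)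

lemma set_code_positions:
  "set (code_positions n d) = {(m - 1)\<^sup>2 + t | m t. 1 \<le> m \<and> m \<le> n \<and> 1 \<le> t \<and> t \<le> d m}"
  unfolding code_positions_def set_concat set_map image_image set_upt
  by (rule set_eqI, simp only: less_Suc_eq_le image_iff UN_iff atLeastLessThan_iff mem_Collect_eq Bex_def) blast

lemma code_positions_bounds:
  assumes "admissible d" shows "set (code_positions n d) \<subseteq> {1..n\<^sup>2}"
proof
  fix x assume "x \<in> set (code_positions n d)"
  then obtain m t where x: "x = (m - 1)\<^sup>2 + t" and m: "1 \<le> m" "m \<le> n" "1 \<le> t" "t \<le> d m"
    unfolding set_code_positions by blast
  have "t \<le> 2 * m - 1" using assms m by (auto simp: admissible_def intro: order_trans)
  then show "x \<in> {1..n\<^sup>2}" unfolding x using m by (intro position_bounds)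
qed

lemma sorted_code_positions:
  assumes "admissible d" shows "sorted_wrt (<) (code_positions n d)"
proof (induction n)
  case 0
  then show ?case by (simp add: code_positions_def)
next
  case (Suc n)
  have "x < y" if "x \<in> set (code_positions n d)" "Suc (n\<^sup>2) \<le> y" for x y
    using subsetD[OF code_positions_bounds[OF assms] that(1)] that(2) by simp
  then show ?case using Suc by (auto simp: code_positions_Suc sorted_wrt_append sorted_wrt_map simp del: upt_Suc)
qed

lemma word_C_eq: "word_C n = concat (map block [1..<Suc n])"
  by (simp add: word_C_def block_def[abs_def])

lemma word_C_nth:
  assumes "1 \<le> m" "m \<le> n" "1 \<le> t" "t \<le> 2 * m - 1"
  shows "word_C n ! ((m - 1)\<^sup>2 + t - 1) = block m ! (t - 1)"
  unfolding word_C_eq by (rule nth_concat_blocks) (use assms in \<open>auto simp: length_block\<close>)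

lemma map_word_C_code_positions:
  assumes d: "admissible d" and "n \<le> N"
  shows "map (\<lambda>k. word_C N ! (k - 1)) (code_positions n d) = code_word n d"
  using assms(2)
proof (induction n)
  case 0
  then show ?case by (simp add: code_positions_def)
next
  case (Suc n)
  have dn: "d (Suc n) \<le> 2 * Suc n - 1" using admissibleD[OF d, of "Suc n"] by simp
  have "map (\<lambda>k. word_C N ! (k - 1)) (map (\<lambda>t. n\<^sup>2 + t) [1..<Suc (d (Suc n))]) = take (d (Suc n)) (block (Suc n))"
  proof (rule nth_equalityI)
    fix i assume "i < length (map (\<lambda>k. word_C N ! (k - 1)) (map (\<lambda>t. n\<^sup>2 + t) [1..<Suc (d (Suc n))]))"
    then have i: "i < d (Suc n)" by (simp del: upt_Suc)
    then show "map (\<lambda>k. word_C N ! (k - 1)) (map (\<lambda>t. n\<^sup>2 + t) [1..<Suc (d (Suc n))]) ! i =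
        take (d (Suc n)) (block (Suc n)) ! i"
      using word_C_nth[of "Suc n" N "Suc i"] Suc.prems dn by (simp del: upt_Suc)
  qed (use dn in \<open>simp add: length_block\<close>)
  then show ?case using Suc by (simp add: code_positions_Suc code_word_Suc del: upt_Suc)
qed

text \<open>Block \<open>i\<close> begins with the letter \<open>i\<close>, and all blocks up to
  \<open>r\<close> are empty in \<open>d\<close>; taking one letter from block \<open>i\<close>
  therefore puts \<open>i\<close> in front.\<close>

lemma code_word_upd_Cons:
  assumes "\<And>m. 1 \<le> m \<Longrightarrow> m \<le> r \<Longrightarrow> d m = 0" "1 \<le> i" "i \<le> r" "r \<le> n"
  shows "code_word n (d(i := 1)) = i # code_word n d"
proof -
  have zero: "code_word N d = []" if "N \<le> r" for N
    using that assms(1) by (induction N) (auto simp: code_word_Suc)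
  have hd: "take (Suc 0) (block i) = [i]" using take_block_Suc[of i 0] assms(2) by simp
  have "code_word N (d(i := 1)) = (if i \<le> N then i # code_word N d else [])" for N
  proof (induction N)
    case 0
    then show ?case using assms(2) by simp
  next
    case (Suc N)
    consider "Suc N < i" | "Suc N = i" | "i < Suc N" by linarith
    then show ?case
    proof cases
      case 1
      then show ?thesis using Suc assms by (simp add: code_word_Suc)
    next
      case 2
      then show ?thesis using Suc assms hd zero[of N] by (auto simp: code_word_Suc)
    next
      case 3
      then show ?thesis using Suc by (simp add: code_word_Suc)
    qed
  qed
  then show ?thesis using assms by simp
qed

text \<open>If a valid sequence were smaller, then at the first difference it would take a letter \<open>i \<le> r\<close> of
  block \<open>r\<close> after the prefix of that block; but \<open>i\<close> followed by the prefixes of the later blocks is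
  the word of a code and hence reduced, so that \<open>i\<close> cannot shorten the remaining element.\<close>

lemma lex_min_positions_code_word:
  assumes d: "admissible d"
  shows "lex_min_positions n (word_prod (code_word n d)) = code_positions n d"
proof -
  let ?K = "code_positions n d" and ?w = "word_prod (code_word n d)"
  let ?f = "\<lambda>k. word_C n ! (k - 1)"
  note mapK = map_word_C_code_positions[OF _ order.refl]
  have len: "weyl_length n (word_prod (code_word n d)) = length (code_word n d)" if "admissible d" for d
    using that by (intro weyl_length_code_word) (auto simp: admissible_def)
  have lenK: "length ?K = weyl_length n ?w"
    unfolding len[OF d] using mapK[OF d, of n] by (metis length_map)
  show ?thesis
    unfolding lex_min_positions_def
  proof (rule Least_equality)
    show "length ?K = weyl_length n ?w \<and> set ?K \<subseteq> {1..n\<^sup>2} \<and> sorted_wrt (<) ?K \<and> map ?f ?K \<in> reduced_words n ?w"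
      using lenK code_positions_bounds[OF d] sorted_code_positions[OF d] set_code_word[of n d] len[OF d]
      unfolding reduced_words_def mem_Collect_eq mapK[OF d] by simp
    fix ks assume "length ks = weyl_length n ?w \<and> set ks \<subseteq> {1..n\<^sup>2} \<and> sorted_wrt (<) ks \<and>
        map ?f ks \<in> reduced_words n ?w"
    then have ks: "length ks = length ?K" "set ks \<subseteq> {1..n\<^sup>2}" "sorted_wrt (<) ks"
      "set (map ?f ks) \<subseteq> {1..n}" "word_prod (map ?f ks) = ?w"
      using lenK by (auto simp: reduced_words_def)
    show "?K \<le> ks"
    proof (rule ccontr)
      assume "\<not> ?K \<le> ks"
      then have "(ks, ?K) \<in> lexord {(u, v). u < v}" by (simp add: list_less_def not_le)
      then consider a v where "?K = ks @ a # v"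
        | u a b v w where "a < b" "ks = u @ a # v" "?K = u @ b # w"
        unfolding lexord_def by blast
      then show False
      proof cases
        case 1
        then show False using ks(1) by simp
      next
        case 2
        have sK: "sorted_wrt (<) (u @ b # w)" using sorted_code_positions[OF d] 2 by metis
        have "a \<in> {1..n\<^sup>2}" using ks(2) 2 by auto
        then obtain r t where r: "1 \<le> r" "r \<le> n" "1 \<le> t" "t \<le> 2 * r - 1" and a: "a = (r - 1)\<^sup>2 + t"
          by (rule position_cases)
        have u_less: "x < a" if "x \<in> set u" for x using ks(3) that unfolding 2 by (simp add: sorted_wrt_append)
        have w_less: "a < x" if "x \<in> set (b # w)" for x
          using sK that 2(1) by (auto simp: sorted_wrt_append)
        have K_set: "set ?K = set u \<union> set (b # w)" using 2 by simp
        have "a \<notin> set ?K"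
        proof
          assume "a \<in> set ?K"
          then have "a \<in> set u \<or> a \<in> set (b # w)" unfolding K_set by (rule UnE) simp_all
          then show False using u_less[of a] w_less[of a] by blast
        qed
        then have t: "d r < t" using r unfolding set_code_positions a by (auto simp: not_less[symmetric])
        \<comment> \<open>The part of the code that lies in blocks after block
          \<open>r\<close>.\<close>
        define d' where "d' m = (if r < m then d m else 0)" for m
        define i where "i = ?f a"
        have i: "1 \<le> i" "i \<le> r"
        proof -
          have "i = block r ! (t - 1)" unfolding i_def a by (rule word_C_nth[OF r])
          then have "i \<in> set (block r)" using r by (simp add: length_block)
          then show "1 \<le> i" "i \<le> r" using set_block[of r] by auto
        qed
        have adm: "admissible d'" "admissible (d'(i := 1))" using d i by (auto simp: admissible_def d'_def)
        \<comment> \<open>As \<open>a\<close> lies behind the prefix of its block \<open>r\<close>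
          and before \<open>b\<close>, the rest of the code positions from \<open>b\<close> on is
          exactly what the later blocks contribute.\<close>
        have post: "code_positions n d' = b # w"
        proof (rule strict_sorted_equal)
          show "sorted_wrt (<) (code_positions n d')" "sorted_wrt (<) (b # w)"
            using sorted_code_positions[OF adm(1)] sK by (auto simp: sorted_wrt_append)
          show "set (code_positions n d') = set (b # w)"
          proof
            show "set (b # w) \<subseteq> set (code_positions n d')"
            proof
              fix x assume x: "x \<in> set (b # w)"
              then have "x \<in> set ?K" unfolding K_set by (rule UnI2)
              then obtain m t' where m: "1 \<le> m" "m \<le> n" "1 \<le> t'" "t' \<le> d m" and xm: "x = (m - 1)\<^sup>2 + t'"
                unfolding set_code_positions by blast
              have "t' \<le> 2 * m - 1" using d m by (auto simp: admissible_def intro: order_trans)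
              then have "r < m \<or> r = m \<and> t < t'"
                using position_less[of m t t' r] w_less[OF x] m r a xm by simp
              then have "r < m" using t m by auto
              then show "x \<in> set (code_positions n d')"
                using m unfolding set_code_positions xm by (auto simp: d'_def)
            qed
            show "set (code_positions n d') \<subseteq> set (b # w)"
            proof
              fix x assume "x \<in> set (code_positions n d')"
              then obtain m t' where m: "1 \<le> m" "m \<le> n" "1 \<le> t'" "t' \<le> d' m" and xm: "x = (m - 1)\<^sup>2 + t'"
                unfolding set_code_positions by blast
              then have rm: "r < m" "t' \<le> d m" by (auto simp: d'_def split: if_splits)
              have xK: "x \<in> set ?K" using m rm unfolding set_code_positions xm by blast
              have "\<not> x < a" using position_less[of r t' t m] r m a xm rm by auto
              then show "x \<in> set (b # w)" using xK u_less unfolding K_set by blast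
            qed
          qed
        qed
        have word_post: "code_word n d' = map ?f (b # w)" using mapK[OF adm(1), of n] post by simp
        have word_i: "code_word n (d'(i := 1)) = i # map ?f (b # w)"
          unfolding word_post[symmetric] by (rule code_word_upd_Cons[of r]) (use i r in \<open>auto simp: d'_def\<close>)
        have sets: "set (map ?f u) \<subseteq> {1..n}" "set (map ?f v) \<subseteq> {1..n}" using ks(4) 2 by auto
        have "word_prod (map ?f u) \<circ> word_prod (map ?f (b # w)) = word_prod (map ?f u) \<circ> word_prod (map ?f (a # v))"
          using ks(5) mapK[OF d, of n] 2 by (simp only: map_append word_prod_append[symmetric])
        then have "word_prod (rev (map ?f u)) \<circ> (word_prod (map ?f u) \<circ> word_prod (map ?f (b # w))) =
            word_prod (rev (map ?f u)) \<circ> (word_prod (map ?f u) \<circ> word_prod (map ?f (a # v)))" by simp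
        then have "word_prod (map ?f (b # w)) = word_prod (map ?f (a # v))"
          unfolding comp_assoc[symmetric] word_prod_rev[OF sets(1)] by simp
        also have "\<dots> = simple_refl i \<circ> word_prod (map ?f v)" by (simp add: i_def)
        \<comment> \<open>The code word \<open>i # map ?f (b # w)\<close> is reduced, but cancelling
          the letter \<open>i\<close> makes its product equal to that of \<open>v\<close>, a word
          shorter by 2.\<close>
        finally have "word_prod (code_word n (d'(i := 1))) = simple_refl i \<circ> simple_refl i \<circ> word_prod (map ?f v)"
          unfolding word_i word_prod_Cons by (simp add: comp_assoc)
        then have "word_prod (code_word n (d'(i := 1))) = word_prod (map ?f v)"
          using simple_refl_involution[OF i(1)] by simp
        then have "length (code_word n (d'(i := 1))) \<le> length (map ?f v)"
          using len[OF adm(2)] weyl_length_le[OF sets(2)] by simp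
        then show False using word_i ks(1) 2 by simp
      qed
    qed
  qed
qed

section \<open>Codes and left-justified diagrams\<close>

definition code_dream :: "nat \<Rightarrow> (nat \<Rightarrow> nat) \<Rightarrow> box set" where
  "code_dream n d = {(i, j) \<in> SY n. i + j + d (n + 1 - i) \<le> 2 * n}"

text \<open>Block \<open>m\<close> reads row \<open>n + 1 - m\<close> from the right, so taking
  \<open>d m\<close> of its letters removes the last \<open>d m\<close> boxes of that row.\<close>

lemma code_dream_eq:
  assumes "admissible d"
  shows "code_dream n d = SY n - nth_box n ` set (code_positions n d)"
proof -
  have "(i, j) \<in> nth_box n ` set (code_positions n d) \<longleftrightarrow> 2 * n < i + j + d (n + 1 - i)" if "(i, j) \<in> SY n" for i j
  proof
    assume "(i, j) \<in> nth_box n ` set (code_positions n d)"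
    then obtain m t where m: "1 \<le> m" "m \<le> n" "1 \<le> t" "t \<le> d m" "(i, j) = nth_box n ((m - 1)\<^sup>2 + t)"
      unfolding set_code_positions by blast
    have "t \<le> 2 * m - 1" using assms m by (auto simp: admissible_def intro: order_trans)
    then have "i = n + 1 - m" "j = n + m - t" using m nth_box_position[of m n t] by auto
    then show "2 * n < i + j + d (n + 1 - i)" using m by simp
  next
    assume *: "2 * n < i + j + d (n + 1 - i)"
    have ij: "1 \<le> i" "i \<le> n" "i \<le> j" "i + j \<le> 2 * n" using that by (auto simp: SY_iff)
    define m where "m = n + 1 - i"
    define t where "t = 2 * n + 1 - i - j"
    have mt: "1 \<le> m" "m \<le> n" "1 \<le> t" "t \<le> 2 * m - 1" "t \<le> d m" using ij * by (auto simp: m_def t_def)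
    have "nth_box n ((m - 1)\<^sup>2 + t) = (i, j)"
      unfolding nth_box_position[OF mt(1-4)] using ij by (auto simp: m_def t_def)
    moreover have "(m - 1)\<^sup>2 + t \<in> set (code_positions n d)" unfolding set_code_positions using mt by blast
    ultimately show "(i, j) \<in> nth_box n ` set (code_positions n d)" by (metis imageI)
  qed
  then show ?thesis by (fastforce simp: code_dream_def)
qed

lemma dream_of_code_word:
  assumes "admissible d" shows "dream_of n (word_prod (code_word n d)) = code_dream n d"
  unfolding dream_of_def lex_min_positions_code_word[OF assms] code_dream_eq[OF assms]
  by (simp add: image_def) blast

lemma card_code_dream:
  assumes d: "admissible d" shows "card (code_dream n d) = n\<^sup>2 - length (code_word n d)"
proof -
  have inj: "inj_on (nth_box n) {1..n\<^sup>2}"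
  proof (rule inj_onI)
    fix x y assume xy: "x \<in> {1..n\<^sup>2}" "y \<in> {1..n\<^sup>2}" "nth_box n x = nth_box n y"
    then have "\<not> x < y" "\<not> y < x"
      using weight_nth_box_less_iff[OF xy(1,2)] weight_nth_box_less_iff[OF xy(2,1)] by auto
    then show "x = y" by simp
  qed
  have "SY n = nth_box n ` {1..n\<^sup>2}" using nth_box_surj nth_box_in_SY by blast
  then have card_SY: "card (SY n) = n\<^sup>2" using card_image[OF inj] by simp
  have sub: "set (code_positions n d) \<subseteq> {1..n\<^sup>2}" by (rule code_positions_bounds[OF d])
  have "card (nth_box n ` set (code_positions n d)) = length (code_positions n d)"
    using card_image[OF inj_on_subset[OF inj sub]] distinct_card[of "code_positions n d"]
      strict_sorted_iff[of "code_positions n d"] sorted_code_positions[OF d] by simp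
  also have "\<dots> = length (code_word n d)"
    using map_word_C_code_positions[OF d order.refl, of n] by (metis length_map)
  finally show ?thesis
    unfolding code_dream_eq[OF d] using sub nth_box_in_SY card_SY
    by (subst card_Diff_subset) auto
qed

lemma left_justified_code_dream:
  assumes D: "D \<subseteq> SY n" and left: "left_justified n D"
  shows "\<exists>d. admissible d \<and> D = code_dream n d"
proof -
  define j0 where "j0 i = (LEAST j. i \<le> j \<and> (i, j) \<notin> D)" for i
  have out: "(i, 2 * n - i + 1) \<notin> D" if "i \<le> n" for i using subsetD[OF D, of "(i, 2 * n - i + 1)"] that by (auto simp: SY_iff)
  have j0: "i \<le> j0 i" "(i, j0 i) \<notin> D" "j0 i \<le> 2 * n - i + 1" if "i \<le> n" for i
  proof -
    have *: "i \<le> 2 * n - i + 1 \<and> (i, 2 * n - i + 1) \<notin> D" using out[OF that] that by simp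
    show "i \<le> j0 i" "(i, j0 i) \<notin> D" using LeastI[of "\<lambda>j. i \<le> j \<and> (i, j) \<notin> D", OF *] by (auto simp: j0_def)
    show "j0 i \<le> 2 * n - i + 1" unfolding j0_def by (rule Least_le) (rule *)
  qed
  have mem: "(i, j) \<in> D \<longleftrightarrow> j < j0 i" if "(i, j) \<in> SY n" for i j
  proof
    have ij: "1 \<le> i" "i \<le> n" "i \<le> j" using that by (auto simp: SY_iff)
    show "j < j0 i \<Longrightarrow> (i, j) \<in> D" using not_less_Least[of j "\<lambda>j. i \<le> j \<and> (i, j) \<notin> D"] ij by (auto simp: j0_def)
    have "(i, j') \<notin> D" if "j0 i \<le> j'" for j'
      using that
    proof (induction j' rule: dec_induct)
      case base then show ?case using j0 ij by blast
    next
      case (step k)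
      show ?case
      proof
        assume *: "(i, Suc k) \<in> D"
        then have "(i, Suc k) \<in> SY n" using D by blast
        then have "(i, k) \<in> SY n" using step(1) j0(1)[OF ij(2)] by (auto simp: SY_iff)
        then show False using left * step by (auto simp: left_justified_def)
      qed
    qed
    then show "(i, j) \<in> D \<Longrightarrow> j < j0 i" by (meson not_le)
  qed
  \<comment> \<open>Row \<open>n + 1 - m\<close> ends in column \<open>n + m - 1\<close>, so this
    counts the boxes from the first gap on. The value 0 beyond \<open>n\<close> keeps
    \<open>d\<close> admissible.\<close>
  define d where "d m = (if m \<le> n then n + m - j0 (n + 1 - m) else 0)" for m
  have "d m \<le> 2 * m - 1" if "1 \<le> m" for m
  proof (cases "m \<le> n")
    case True
    then have "n + 1 - m \<le> j0 (n + 1 - m)" using j0(1)[of "n + 1 - m"] that by simp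
    then have "n + m - j0 (n + 1 - m) \<le> n + m - (n + 1 - m)" by (rule diff_le_mono2)
    then show ?thesis using True by (simp add: d_def)
  qed (simp add: d_def)
  then have "admissible d" by (simp add: admissible_def)
  moreover have "(i, j) \<in> D \<longleftrightarrow> i + j + d (n + 1 - i) \<le> 2 * n" if "(i, j) \<in> SY n" for i j
    unfolding mem[OF that] using that j0[of i] by (auto simp: SY_iff d_def)
  ultimately show ?thesis using D by (intro exI[of _ d]) (auto simp: code_dream_def)
qed

text \<open>Taking all blocks completely gives the longest element, since the full block
  \<open>m\<close> negates \<open>m\<close> and fixes the smaller positive values.\<close>

lemma weyl_length_longest_elt: "weyl_length n (longest_elt n) = n\<^sup>2"
proof -
  define d where "d m = 2 * m - 1" for m :: nat
  have adm: "admissible d" by (simp add: admissible_def d_def)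
  have "word_prod (code_word n d) x = - x" if "1 \<le> x" "x \<le> int n" for x
    using that
  proof (induction n arbitrary: x)
    case (Suc n)
    let ?w = "word_prod (code_word n d)"
    have w: "?w \<in> weyl_group n" by (intro word_prod_in_weyl_group set_code_word)
    have "- int (Suc n) \<notin> signed_idx n" by (simp add: signed_idx_def)
    then have "?w (- int (Suc n)) = - int (Suc n)" using permutes_not_in[OF weyl_groupD(1)[OF w]] by blast
    moreover have "d (Suc n) = Suc (2 * n)" by (simp add: d_def)
    ultimately show ?case
      using Suc word_prod_take_block[of "Suc n" "d (Suc n)" x]
      by (cases "x = int (Suc n)") (auto simp: code_word_Suc word_prod_append landing_def)
  qed simp
  moreover have w: "word_prod (code_word n d) \<in> weyl_group n" by (intro word_prod_in_weyl_group set_code_word)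
  ultimately have "word_prod (code_word n d) x = longest_elt n x" for x
    using weyl_groupD(2)[OF w, of x] permutes_not_in[OF weyl_groupD(1)[OF w], of x]
    by (cases "x < 0") (force simp: longest_elt_def signed_idx_def)+
  then have "longest_elt n = word_prod (code_word n d)" by auto
  moreover have "weyl_length n (word_prod (code_word n d)) = length (code_word n d)"
    using adm by (intro weyl_length_code_word) (auto simp: admissible_def)
  moreover have "length (code_word n d) = n\<^sup>2"
    by (induction n) (auto simp: code_word_Suc length_block d_def power2_eq_square)
  ultimately show ?thesis by simp
qed

section \<open>Labels of left-justified diagrams\<close>

text \<open>For \<open>e < m\<close> the odd row consists of crossings: the new pipe runs to the
  U-turn, returns with label \<open>m\<close> and turns up in column \<open>a\<close>. For
  \<open>e \<ge> m\<close> the even row has no crossings, and the new pipe turns up from the odd row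
  in column \<open>a\<close> with label \<open>- m\<close>. In both cases the strands from below
  keep their column to the right of \<open>a\<close> and move one column to the left otherwise, as
  in \<open>word_prod_take_block\<close>.\<close>

lemma labelling_code_dream_row:
  assumes L: "labelling n (crossings n (code_dream n d)) (pipe_start_label n) H V"
    and d: "admissible d" and k: "1 \<le> k" "k \<le> n" and j: "1 \<le> j" "j \<le> n + 1 - k"
  shows "H (2 * k - 1) (n + 1 - j) =
    (if j < landing (n + 1 - k) (d (n + 1 - k)) then H (2 * k + 1) (n + 1 - j)
     else if j = landing (n + 1 - k) (d (n + 1 - k))
       then (if d (n + 1 - k) < n + 1 - k then int (n + 1 - k) else - int (n + 1 - k))
     else H (2 * k + 1) (n + 2 - j))"
proof -
  let ?C = "crossings n (code_dream n d)"
  define m where "m = n + 1 - k"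
  define e where "e = d m"
  have m: "1 \<le> m" "m \<le> n" "k = n + 1 - m" using k by (auto simp: m_def)
  have e: "e \<le> 2 * m - 1" using admissibleD[OF d m(1)] by (simp add: e_def)
  have sub: "code_dream n d \<subseteq> SY n" by (auto simp: code_dream_def)
  have odd_in: "(2 * k - 1, c) \<in> ?C \<longleftrightarrow> k + c + e \<le> 2 * n" if "k \<le> c" "c \<le> n" for c
  proof -
    have "(k, c) \<in> SY n" using that k by (auto simp: SY_iff)
    moreover have "tile_of n (k, c) = (2 * k - 1, c)" using that by (simp add: tile_of_def)
    ultimately show ?thesis
      using tile_of_in_crossings_iff[OF sub, of "(k, c)"] by (simp add: code_dream_def e_def m_def)
  qed
  have even_in: "(2 * k, c) \<in> ?C \<longleftrightarrow> k + 1 + e \<le> c" if "k \<le> c" "c \<le> n" for c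
  proof (cases "c = k")
    case True
    then show ?thesis using crossings_bounds(4)[of "2 * k" c n] by auto
  next
    case False
    then have "(k, 2 * n + 1 - c) \<in> SY n" using that k by (auto simp: SY_iff)
    moreover have "tile_of n (k, 2 * n + 1 - c) = (2 * k, c)" using that by (auto simp: tile_of_def)
    ultimately show ?thesis
      using tile_of_in_crossings_iff[OF sub, of "(k, 2 * n + 1 - c)"] that by (auto simp: code_dream_def e_def m_def)
  qed
  have odd_cross: "V (2 * k - 1) (c + 1) = V (2 * k - 1) c" "H (2 * k - 1) c = H (2 * k) c"
    if "k \<le> c" "c \<le> n" "k + c + e \<le> 2 * n" for c
    using labelling_odd[OF L k(1) that(1,2)] odd_in[OF that(1,2)] that(3) by simp_all
  have odd_elbow: "H (2 * k - 1) c = V (2 * k - 1) c" "V (2 * k - 1) (c + 1) = H (2 * k) c"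
    if "k \<le> c" "c \<le> n" "2 * n < k + c + e" for c
    using labelling_odd[OF L k(1) that(1,2)] odd_in[OF that(1,2)] that(3) by simp_all
  have even_cross: "V (2 * k) c = V (2 * k) (c + 1)" "H (2 * k) c = H (2 * k + 1) c"
    if "k \<le> c" "c \<le> n" "k + 1 + e \<le> c" for c
    using labelling_even[OF L k(1) that(1,2)] even_in[OF that(1,2)] that(3) by simp_all
  have even_elbow: "H (2 * k) c = V (2 * k) (c + 1)" "V (2 * k) c = H (2 * k + 1) c"
    if "k \<le> c" "c \<le> n" "c < k + 1 + e" for c
    using labelling_even[OF L k(1) that(1,2)] even_in[OF that(1,2)] that(3) by simp_all
  have start: "V (2 * k - 1) k = - int m" using labelling_ends(1)[OF L k] by (simp add: m_def)
  define c where "c = n + 1 - j"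
  have c: "k \<le> c" "c \<le> n" "j = n + 1 - c" using j k by (auto simp: c_def)
  define a where "a = n + 1 - landing m e"
  have "1 \<le> landing m e" "landing m e \<le> m" using landing_bounds[OF m(1) e] by auto
  then have a: "k \<le> a" "a \<le> n" "landing m e = n + 1 - a" using m by (auto simp: a_def)
  have cases: "j < landing m e \<longleftrightarrow> a < c" "j = landing m e \<longleftrightarrow> c = a" "n + 2 - j = c + 1"
    using a c by auto
  have run: "V (2 * k - 1) i = - int m" if "k \<le> i" "\<And>c. k \<le> c \<Longrightarrow> c < i \<Longrightarrow> c \<le> n \<and> k + c + e \<le> 2 * n" for i
    using that
  proof (induction i rule: dec_induct)
    case base show ?case by (rule start)
  next
    case (step i) then show ?case using odd_cross(1)[of i] by simp
  qed
  have "H (2 * k - 1) c = (if a < c then H (2 * k + 1) c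
     else if c = a then (if e < m then int m else - int m) else H (2 * k + 1) (c + 1))"
  proof (cases "e < m")
    case False
    then have ae: "a + k + e = 2 * n + 1" using m e by (auto simp: a_def landing_def)
    have no_even: "i < k + 1 + e" if "i \<le> n" for i using that False m by auto
    consider "a < c" | "c = a" | "c < a" by linarith
    then show ?thesis
    proof cases
      case 1
      have "H (2 * k - 1) c = V (2 * k - 1) c" using odd_elbow(1)[OF c(1,2)] 1 ae by simp
      also have "\<dots> = H (2 * k) (c - 1)" using odd_elbow(2)[of "c - 1"] c a 1 ae by auto
      also have "\<dots> = V (2 * k) c" using even_elbow(1)[of "c - 1"] no_even[of "c - 1"] c a 1 by auto
      also have "\<dots> = H (2 * k + 1) c" using even_elbow(2)[OF c(1,2)] no_even[of c] c by simp
      finally show ?thesis using 1 by simp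
    next
      case 2
      have "H (2 * k - 1) c = V (2 * k - 1) c" using odd_elbow(1)[OF c(1,2)] 2 ae by simp
      also have "\<dots> = - int m" by (rule run) (use c 2 ae in auto)
      finally show ?thesis using 2 False by simp
    next
      case 3
      have "H (2 * k - 1) c = H (2 * k) c" using odd_cross(2)[OF c(1,2)] 3 ae by simp
      also have "\<dots> = V (2 * k) (c + 1)" using even_elbow(1)[OF c(1,2)] no_even[of c] c by simp
      also have "\<dots> = H (2 * k + 1) (c + 1)" using even_elbow(2)[of "c + 1"] no_even[of "c + 1"] c a 3 by simp
      finally show ?thesis using 3 by simp
    qed
  next
    case True
    then have ae: "a = k + e" using m by (auto simp: a_def landing_def)
    have all_odd: "k + i + e \<le> 2 * n" if "i \<le> n" for i using that True m by auto
    have "V (2 * k - 1) (n + 1) = - int m" by (rule run) (use k all_odd in auto)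
    then have right: "V (2 * k) (n + 1) = int m" using labelling_ends(3)[OF L k] by simp
    have run_back: "V (2 * k) i = int m" if "a < i" "i \<le> n + 1" for i
      using that(2,1)
    proof (induction i rule: inc_induct)
      case base show ?case by (rule right)
    next
      case (step i) then show ?case using even_cross(1)[of i] ae by simp
    qed
    have H_eq: "H (2 * k - 1) c = H (2 * k) c" using odd_cross(2)[OF c(1,2)] all_odd[OF c(2)] by simp
    consider "a < c" | "c = a" | "c < a" by linarith
    then show ?thesis
    proof cases
      case 1
      then show ?thesis using H_eq even_cross(2)[OF c(1,2)] ae by simp
    next
      case 2
      then show ?thesis using H_eq even_elbow(1)[OF c(1,2)] ae run_back[of "c + 1"] c True by simp
    next
      case 3
      then show ?thesis using H_eq even_elbow(1)[OF c(1,2)] even_elbow(2)[of "c + 1"] ae c a by simp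
    qed
  qed
  then show ?thesis unfolding m_def[symmetric] e_def[symmetric] cases c_def[symmetric] .
qed

text \<open>Read from right to left, the labels above the lowest \<open>m\<close> double rows are
  the one-line notation of the product of the first \<open>m\<close> blocks; another double row acts
  on them as the next prefix does by right multiplication.\<close>

lemma labelling_code_dream:
  assumes L: "labelling n (crossings n (code_dream n d)) (pipe_start_label n) H V"
    and d: "admissible d" and m: "1 \<le> m" "m \<le> n" and j: "1 \<le> j" "j \<le> m"
  shows "H (2 * (n + 1 - m) - 1) (n + 1 - j) = word_prod (code_word m d) (int j)"
  using m j
proof (induction m arbitrary: j)
  case (Suc m)
  define k where "k = n + 1 - Suc m"
  have k: "1 \<le> k" "k \<le> n" "n + 1 - k = Suc m" using Suc.prems by (auto simp: k_def)
  let ?a = "landing (Suc m) (d (Suc m))" and ?w = "word_prod (code_word m d)"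
  have dm: "d (Suc m) \<le> 2 * Suc m - 1" using admissibleD[OF d, of "Suc m"] by simp
  have w: "?w \<in> weyl_group m" by (intro word_prod_in_weyl_group set_code_word)
  have a: "1 \<le> ?a" "?a \<le> Suc m" using landing_bounds[OF _ dm] by auto
  have out: "?w (int (Suc m)) = int (Suc m)" "?w (- int (Suc m)) = - int (Suc m)"
    using permutes_not_in[OF weyl_groupD(1)[OF w]] by (auto simp: signed_idx_def)
  have IH: "H (2 * k + 1) (n + 1 - i) = ?w (int i)" if "1 \<le> i" "i \<le> m" for i
  proof -
    have "2 * (n + 1 - m) - 1 = 2 * k + 1" using Suc.prems by (auto simp: k_def)
    then show ?thesis using Suc.IH[of i] that Suc.prems by simp
  qed
  have "H (2 * k - 1) (n + 1 - j) = (if j < ?a then H (2 * k + 1) (n + 1 - j)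
     else if j = ?a then (if d (Suc m) < Suc m then int (Suc m) else - int (Suc m))
     else H (2 * k + 1) (n + 2 - j))"
    using labelling_code_dream_row[OF L d k(1,2), of j] Suc.prems unfolding k(3) by simp
  also have "\<dots> = ?w (if int j < int ?a then int j
     else if int j = int ?a then (if d (Suc m) < Suc m then int (Suc m) else - int (Suc m)) else int j - 1)"
  proof -
    consider "j < ?a" | "j = ?a" | "?a < j" by linarith
    then show ?thesis
    proof cases
      case 1
      then show ?thesis using IH[of j] Suc.prems a by simp
    next
      case 2
      then show ?thesis using out by simp
    next
      case 3
      then have "n + 2 - j = n + 1 - (j - 1)" "1 \<le> j - 1" "j - 1 \<le> m" "int (j - 1) = int j - 1" using Suc.prems a by auto
      then show ?thesis using IH[of "j - 1"] 3 by simp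
    qed
  qed
  also have "\<dots> = ?w (word_prod (take (d (Suc m)) (block (Suc m))) (int j))"
    using word_prod_take_block[OF _ dm, of "int j"] Suc.prems by simp
  also have "\<dots> = word_prod (code_word (Suc m) d) (int j)"
    by (simp add: code_word_Suc word_prod_append)
  finally show ?case by (simp add: k_def)
qed simp

lemma dream_elt_code_dream:
  assumes d: "admissible d"
  shows "dream_elt n (code_dream n d) = word_prod (code_word n d)"
proof
  fix x
  obtain H V where L: "labelling n (crossings n (code_dream n d)) (pipe_start_label n) H V"
    using labelling_exists by blast
  have pos: "dream_elt_pos n (code_dream n d) j = word_prod (code_word n d) (int j)" if "j \<in> {1..n}" for j
    using dream_elt_pos_eq_label[OF L that] labelling_code_dream[OF L d, of n j] that by simp
  have w: "word_prod (code_word n d) \<in> weyl_group n" by (intro word_prod_in_weyl_group set_code_word)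
  show "dream_elt n (code_dream n d) x = word_prod (code_word n d) x"
  proof (cases "x \<in> signed_idx n")
    case True
    then have "0 < x \<Longrightarrow> nat x \<in> {1..n}" "\<not> 0 < x \<Longrightarrow> nat (- x) \<in> {1..n}"
      by (auto simp: signed_idx_def nat_le_iff nat_le_eq_zle)
    then show ?thesis
      using True pos[of "nat x"] pos[of "nat (- x)"] weyl_groupD(2)[OF w, of x]
      by (cases "0 < x") (simp_all add: dream_elt_def)
  next
    case False
    then show ?thesis using permutes_not_in[OF weyl_groupD(1)[OF w]] by (simp add: dream_elt_def)
  qed
qed

lemma reduced_code_dream:
  assumes d: "admissible d"
  shows "int (card (code_dream n d)) = int (n\<^sup>2) - int (weyl_length n (word_prod (code_word n d)))"
proof -
  have "weyl_length n (word_prod (code_word n d)) = length (code_word n d)"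
    using d by (intro weyl_length_code_word) (auto simp: admissible_def)
  moreover have "length (code_word n d) \<le> n\<^sup>2"
  proof -
    have "length (code_word n d) = length (code_positions n d)"
      using map_word_C_code_positions[OF d order.refl, of n] by (metis length_map)
    also have "\<dots> = card (set (code_positions n d))"
      using distinct_card[of "code_positions n d"] strict_sorted_iff[of "code_positions n d"]
        sorted_code_positions[OF d] by simp
    also have "\<dots> \<le> card {1..n\<^sup>2}" using code_positions_bounds[OF d] by (intro card_mono) auto
    finally show ?thesis by simp
  qed
  ultimately show ?thesis using card_code_dream[OF d, of n] by simp
qed

theorem theorem4p5:
  fixes n :: nat and w :: "int \<Rightarrow> int"
  assumes "n \<ge> 2" and "w \<in> weyl_group n"
  shows "ladder_closure n (dream_of n w) =
           {D \<in> SPD n. reduced_dream n D \<and> dream_elt n D = w}"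
proof -
  obtain d where "\<forall>m. 1 \<le> m \<longrightarrow> d m \<le> 2 * m - 1" and w: "w = word_prod (code_word n d)"
    using weyl_group_code[OF assms(2)] by blast
  then have d: "admissible d" by (simp add: admissible_def)
  define D\<^sub>0 where "D\<^sub>0 = code_dream n d"
  have D0: "D\<^sub>0 \<subseteq> SY n" "dream_elt n D\<^sub>0 = w" "int (card D\<^sub>0) = int (n\<^sup>2) - int (weyl_length n w)"
    using dream_elt_code_dream[OF d, of n] reduced_code_dream[OF d, of n]
    by (auto simp: D\<^sub>0_def w code_dream_def)
  have closure: "ladder_closure n (dream_of n w) = {E. (box_ladder n)\<^sup>*\<^sup>* D\<^sub>0 E}"
    unfolding ladder_closure_def ladder_move_iff_box_ladder w dream_of_code_word[OF d] D\<^sub>0_def ..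
  have reduced: "reduced_dream n E \<longleftrightarrow> int (card E) = int (n\<^sup>2) - int (weyl_length n (dream_elt n E))" for E
    by (simp add: reduced_dream_def weyl_length_longest_elt)
  show ?thesis
    unfolding closure
  proof (intro set_eqI iffI)
    fix E assume "E \<in> {E. (box_ladder n)\<^sup>*\<^sup>* D\<^sub>0 E}"
    then show "E \<in> {D \<in> SPD n. reduced_dream n D \<and> dream_elt n D = w}"
      using box_ladder_closure_preserves[of n D\<^sub>0 E] D0 by (auto simp: SPD_def reduced)
  next
    fix E assume "E \<in> {D \<in> SPD n. reduced_dream n D \<and> dream_elt n D = w}"
    then have E: "E \<subseteq> SY n" "dream_elt n E = w" "card E = card D\<^sub>0"
      using D0 by (auto simp: SPD_def reduced)
    obtain D' where D': "D' \<subseteq> SY n" "left_justified n D'" "dream_elt n D' = w"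
      "card D' = card E \<longrightarrow> (box_ladder n)\<^sup>*\<^sup>* D' E"
      using reduction_to_left_justified[OF E(1)] E(2) by auto
    obtain d' where d': "admissible d'" "D' = code_dream n d'"
      using left_justified_code_dream[OF D'(1,2)] by blast
    then have "word_prod (code_word n d') = w" using dream_elt_code_dream D'(3) by simp
    \<comment> \<open>Both diagrams are complements of the minimal positions of the same element
      \<open>w\<close>.\<close>
    then have "D' = D\<^sub>0"
      using dream_of_code_word[OF d'(1), of n] dream_of_code_word[OF d, of n] d'(2) by (simp add: w D\<^sub>0_def)
    \<comment> \<open>Now \<open>D'\<close> and \<open>E\<close> have the same number of boxes, so
      no pair was deleted in the reduction of \<open>E\<close>.\<close>
    then show "E \<in> {E. (box_ladder n)\<^sup>*\<^sup>* D\<^sub>0 E}" using D'(4) E(3) by simp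
  qed
qed

end
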